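(* Consider the $K$-armed Bayesian bandit with horizon $n$ in which, in environment $\boldsymbol\nu=(\nu_1,\dots,\nu_K)\in[0,1]^K$, the $k$-th arm gives reward $\gamma(n)$ with probability $\nu_k$ and $-\gamma(n)$ with probability $1-\nu_k$, and the prior is the product of $\nu_k\sim\mathrm{Beta}(\alpha_k(n),\beta_k(n))$, $1\le k\le K$. Let $w^i(\mathbf s,\mathbf q)$ be its optimal expected cumulative reward from round $i$ (defined in the context). Let $f(n)>0$ be a scaling factor such that there exist real numbers $\hat\alpha_k,\hat\beta_k$ ($1\le k\le K$) and $\hat\sigma$ with $$\lim_{n\to\infty}\frac{\gamma(n)(\alpha_k(n)-\beta_k(n))}{f(n)}=\hat\alpha_k,\qquad \lim_{n\to\infty}\frac{\alpha_k(n)+\beta_k(n)}{n}=\hat\beta_k,\qquad \lim_{n\to\infty}\frac{\sqrt n}{f(n)}\gamma(n)=\hat\sigma .$$ Then, as $n\to\infty$, the rescaled Bayesian bandit problem with scaling factor $f(n)$ converges (in the sense defined in the context) to the HJB equation $$\partial_t v+\max_{\hat{\boldsymbol\pi}\in\Delta^K}\sum_{k=1}^K\Big(\partial_{\hat q_k}v+\hat\mu(\hat s_k,\hat q_k,\hat\alpha_k,\hat\beta_k)\,\partial_{\hat s_k}v+\tfrac12\hat\sigma^2\,\partial_{\hat s_k}^2v+\hat\mu(\hat s_k,\hat q_k,\hat\alpha_k,\hat\beta_k)\Big)\hat\pi_k=0,\qquad v(1,\hat{\mathbf s},\hat{\mathbf q})=0,$$ where $$\hat\mu(s,q,\hat\alpha_k,\hat\beta_k)=\frac{\hat\alpha_k+s}{\hat\beta_k+q}$$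 and the diffusion coefficient is the constant $\hat\sigma$.
   Context: $K\ge1$ is fixed, $n\in\mathbb Z_+$ is the horizon (number of rounds), $\gamma(n)>0$, $\alpha_k(n),\beta_k(n)>0$, $\mathbf e_k$ is the $k$-th standard basis vector of $\mathbb R^K$, and $\Delta^K=\{\pi\in[0,1]^K:\sum_k\pi_k=1\}$. Bayesian bandit. In each round $i=1,\dots,n$ one arm is pulled and its reward is observed. The state at the beginning of round $i$ is $(\mathbf s,\mathbf q)$, where $s_k$ is the cumulative reward from arm $k$ and $q_k\in\{0,\dots,i-1\}$ the number of pulls of arm $k$ in rounds $1,\dots,i-1$. Given $(\mathbf s,\mathbf q)$, the posterior $\rho(\boldsymbol\nu|\mathbf s,\mathbf q)$ makes the $\nu_k$ independent with $\nu_k\sim\mathrm{Beta}\big(\alpha_k+\tfrac{s_k}{2\gamma}+\tfrac{q_k}{2},\ \beta_k-\tfrac{s_k}{2\gamma}+\tfrac{q_k}{2}\big)$. The goal is to maximize the total expected reward, each reward being averaged over the current posterior. The optimal expected cumulative reward $w^i(\mathbf s,\mathbf q)$ collected in rounds $i,\dots,n$ starting from state $(\mathbf s,\mathbf q)$ satisfies $w^{n+1}\equiv0$ and $$w^i(\mathbf s,\mathbf q)=\max_{1\le k\le K}\Big\{\int\mu_k(\boldsymbol\nu)\rho(\boldsymbol\nu|\mathbf s,\mathbf q)d\boldsymbol\nu+\int\mathbb E_{X\sim P_k^{\boldsymbol\nu}}\big[w^{i+1}(\mathbf s+X\mathbf e_k,\mathbf q+\mathbf e_k)\big]\rho(\boldsymbol\nu|\mathbf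 s,\mathbf q)d\boldsymbol\nu\Big\},$$ where $P^{\boldsymbol\nu}_k$ is the reward law of arm $k$ and $\mu_k(\boldsymbol\nu)=\gamma(2\nu_k-1)$ its mean. Admissible states at round $i$ are those with $q_k\in\{0,\dots,i-1\}$ and $s_k\in\{-\gamma q_k,-\gamma q_k+2\gamma,\dots,\gamma q_k\}$. Convergence. Let $Q=\{\hat{\mathbf q}\in[0,1]^K:\hat\beta_k+\hat q_k>0\ \forall k\}$. "The rescaled Bayesian bandit problem with scaling factor $f(n)$ converges to the HJB equation" means: there is a function $v$ on $[0,1]\times\mathbb R^K\times Q$ that is a viscosity solution of the HJB equation in $(0,1)\times\mathbb R^K\times(0,1)^K$ with $v(1,\cdot,\cdot)=0$, such that $\frac1{f(n)}w^{i_n}(\mathbf s_n,\mathbf q_n)\to v(t,\hat{\mathbf s},\hat{\mathbf q})$ as $n\to\infty$ for every $(t,\hat{\mathbf s},\hat{\mathbf q})\in[0,1]\times\mathbb R^K\times Q$ and every sequence of rounds $i_n\in\{1,\dots,n+1\}$ and admissible states $(\mathbf s_n,\mathbf q_n)$ at round $i_n$ with $\big(\frac{i_n-1}{n},\frac{\mathbf s_n}{f(n)},\frac{\mathbf q_n}{n}\big)\to(t,\hat{\mathbf s},\hat{\mathbf q})$. *)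

theory Defs
  imports "HOL-Probability.Probability"
begin

section \<open>The Bayesian bandit\<close>

definition beta_distr :: "real \<Rightarrow> real \<Rightarrow> real measure" where
  "beta_distr a b = density lborel
     (\<lambda>x. ennreal (indicator {0..1} x * (x powr (a - 1) * (1 - x) powr (b - 1) / Beta a b)))"

text \<open>The number of arms is \<open>K = CARD('k)\<close>. The arguments \<open>\<alpha>\<close>, \<open>\<beta>\<close> are the parameters of the
  prior, which is the posterior at the state \<open>(0, 0)\<close>.\<close>

definition posterior ::
  "real \<Rightarrow> real^'k \<Rightarrow> real^'k \<Rightarrow> real^'k \<Rightarrow> nat^'k \<Rightarrow> ('k::finite \<Rightarrow> real) measure" where
  "posterior \<gamma> \<alpha> \<beta> s q = (\<Pi>\<^sub>M k\<in>UNIV. beta_distr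
     (\<alpha> $ k + s $ k / (2 * \<gamma>) + real (q $ k) / 2)
     (\<beta> $ k - s $ k / (2 * \<gamma>) + real (q $ k) / 2))"

definition reward_law :: "real \<Rightarrow> ('k \<Rightarrow> real) \<Rightarrow> 'k \<Rightarrow> real pmf" where
  "reward_law \<gamma> \<nu> k = map_pmf (\<lambda>b. if b then \<gamma> else - \<gamma>) (bernoulli_pmf (\<nu> k))"

definition mean_reward :: "real \<Rightarrow> ('k \<Rightarrow> real) \<Rightarrow> 'k \<Rightarrow> real" where
  "mean_reward \<gamma> \<nu> k = measure_pmf.expectation (reward_law \<gamma> \<nu> k) (\<lambda>x. x)"

lemma mean_reward_eq:
  assumes "\<nu> k \<in> {0..1}"
  shows "mean_reward \<gamma> \<nu> k = \<gamma> * (2 * \<nu> k - 1)"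
  using assms by (simp add: mean_reward_def reward_law_def algebra_simps)

text \<open>\<open>opt_reward \<gamma> \<alpha> \<beta> n i s q\<close> is the optimal expected reward collected in the rounds
  \<open>i, \<dots>, n\<close> when the state at the beginning of round \<open>i\<close> is \<open>(s, q)\<close>.\<close>

function opt_reward ::
  "real \<Rightarrow> real^'k \<Rightarrow> real^'k \<Rightarrow> nat \<Rightarrow> nat \<Rightarrow> real^'k \<Rightarrow> nat^'k::finite \<Rightarrow> real" where
  "opt_reward \<gamma> \<alpha> \<beta> n i s q =
     (if i \<le> n then
        MAX k\<in>UNIV.
          (\<integral>\<nu>. mean_reward \<gamma> \<nu> k \<partial>posterior \<gamma> \<alpha> \<beta> s q) +
          (\<integral>\<nu>. measure_pmf.expectation (reward_law \<gamma> \<nu> k)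
                 (\<lambda>X. opt_reward \<gamma> \<alpha> \<beta> n (Suc i) (s + X *\<^sub>R axis k 1) (q + axis k 1))
             \<partial>posterior \<gamma> \<alpha> \<beta> s q)
      else 0)"
  by pat_completeness auto
termination
  by (relation "Wellfounded.measure (\<lambda>(\<gamma>, \<alpha>, \<beta>, n, i, s, q). Suc n - i)") auto

declare opt_reward.simps [simp del]

definition admissible :: "real \<Rightarrow> nat \<Rightarrow> real^'k \<Rightarrow> nat^'k::finite \<Rightarrow> bool" where
  "admissible \<gamma> i s q \<longleftrightarrow>
     (\<forall>k. q $ k < i \<and> (\<exists>j\<le>q $ k. s $ k = - \<gamma> * real (q $ k) + 2 * \<gamma> * real j))"


section \<open>Viscosity solutions of the HJB equation\<close>

definition hjb_drift :: "real \<Rightarrow> real \<Rightarrow> real \<Rightarrow> real \<Rightarrow> real" where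
  "hjb_drift s q a b = (a + s) / (b + q)"

definition prob_simplex :: "(real^'k::finite) set" where
  "prob_simplex = {\<pi>. (\<forall>k. \<pi> $ k \<in> {0..1}) \<and> (\<Sum>k\<in>UNIV. \<pi> $ k) = 1}"

text \<open>The left-hand side of the HJB equation for a function \<open>\<phi>\<close> of \<open>(t, s, q)\<close>. The supremum is a
  maximum, since a linear function is maximised over the (compact) simplex.\<close>

definition hjb_lhs ::
  "real \<Rightarrow> real^'k \<Rightarrow> real^'k \<Rightarrow> (real \<times> (real^'k) \<times> (real^'k) \<Rightarrow> real)
    \<Rightarrow> real \<times> (real^'k) \<times> (real^'k::finite) \<Rightarrow> real" where
  "hjb_lhs \<sigma> a b \<phi> = (\<lambda>(t, s, q).
     deriv (\<lambda>\<tau>. \<phi> (\<tau>, s, q)) t +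
     (SUP \<pi>\<in>prob_simplex. \<Sum>k\<in>UNIV.
        (deriv (\<lambda>h. \<phi> (t, s, q + h *\<^sub>R axis k 1)) 0
         + hjb_drift (s $ k) (q $ k) (a $ k) (b $ k)
             * deriv (\<lambda>h. \<phi> (t, s + h *\<^sub>R axis k 1, q)) 0
         + 1/2 * \<sigma>\<^sup>2 * (deriv ^^ 2) (\<lambda>h. \<phi> (t, s + h *\<^sub>R axis k 1, q)) 0
         + hjb_drift (s $ k) (q $ k) (a $ k) (b $ k)) * \<pi> $ k))"

definition C2_on :: "'a::real_normed_vector set \<Rightarrow> ('a \<Rightarrow> real) \<Rightarrow> bool" where
  "C2_on S \<phi> \<longleftrightarrow> (\<exists>(D :: 'a \<Rightarrow> 'a \<Rightarrow>\<^sub>L real) (D2 :: 'a \<Rightarrow> 'a \<Rightarrow>\<^sub>L 'a \<Rightarrow>\<^sub>L real).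
     (\<forall>x\<in>S. (\<phi> has_derivative blinfun_apply (D x)) (at x)) \<and>
     (\<forall>x\<in>S. (D has_derivative blinfun_apply (D2 x)) (at x)) \<and>
     continuous_on S D2)"

text \<open>The equation \<open>L v = 0\<close> evolves backwards from a terminal condition; its degenerate elliptic
  form is \<open>- L v = 0\<close>. Hence a subsolution satisfies \<open>L \<phi> \<ge> 0\<close> where \<open>v - \<phi>\<close> has a local maximum,
  and a supersolution satisfies \<open>L \<phi> \<le> 0\<close> where it has a local minimum. The set \<open>U\<close> is meant to be
  open.\<close>

definition viscosity_subsolution ::
  "(('a::real_normed_vector \<Rightarrow> real) \<Rightarrow> 'a \<Rightarrow> real) \<Rightarrow> 'a set \<Rightarrow> ('a \<Rightarrow> real) \<Rightarrow> bool" where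
  "viscosity_subsolution L U v \<longleftrightarrow>
     (\<forall>\<phi> x. C2_on U \<phi> \<and> x \<in> U \<and> (\<forall>\<^sub>F y in nhds x. v y - \<phi> y \<le> v x - \<phi> x) \<longrightarrow> L \<phi> x \<ge> 0)"

definition viscosity_supersolution ::
  "(('a::real_normed_vector \<Rightarrow> real) \<Rightarrow> 'a \<Rightarrow> real) \<Rightarrow> 'a set \<Rightarrow> ('a \<Rightarrow> real) \<Rightarrow> bool" where
  "viscosity_supersolution L U v \<longleftrightarrow>
     (\<forall>\<phi> x. C2_on U \<phi> \<and> x \<in> U \<and> (\<forall>\<^sub>F y in nhds x. v y - \<phi> y \<ge> v x - \<phi> x) \<longrightarrow> L \<phi> x \<le> 0)"

definition viscosity_solution ::
  "(('a::real_normed_vector \<Rightarrow> real) \<Rightarrow> 'a \<Rightarrow> real) \<Rightarrow> 'a set \<Rightarrow> ('a \<Rightarrow> real) \<Rightarrow> bool" where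
  "viscosity_solution L U v \<longleftrightarrow>
     continuous_on U v \<and> viscosity_subsolution L U v \<and> viscosity_supersolution L U v"


section \<open>Convergence to the HJB equation\<close>

definition q_domain :: "real^'k \<Rightarrow> (real^'k::finite) set" where
  "q_domain b = {q. \<forall>k. q $ k \<in> {0..1} \<and> b $ k + q $ k > 0}"

text \<open>The values of \<open>v\<close> outside \<open>{0..1} \<times> UNIV \<times> q_domain b\<close> are irrelevant. Sequences in \<open>n\<close> are only
  constrained for \<open>n > 0\<close>.\<close>

definition converges_to_hjb ::
  "(nat \<Rightarrow> real) \<Rightarrow> (nat \<Rightarrow> real^'k) \<Rightarrow> (nat \<Rightarrow> real^'k) \<Rightarrow> (nat \<Rightarrow> real)
    \<Rightarrow> real \<Rightarrow> real^'k \<Rightarrow> real^'k::finite \<Rightarrow> bool" where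
  "converges_to_hjb \<gamma> \<alpha> \<beta> f \<sigma> a b \<longleftrightarrow>
     (\<exists>v. viscosity_solution (hjb_lhs \<sigma> a b)
            ({0<..<1} \<times> UNIV \<times> {q. \<forall>k. q $ k \<in> {0<..<1}}) v \<and>
          (\<forall>s. \<forall>q\<in>q_domain b. v (1, s, q) = 0) \<and>
          (\<forall>t\<in>{0..1}. \<forall>s. \<forall>q\<in>q_domain b. \<forall>i sn qn.
             (\<forall>n>0. i n \<in> {1..n + 1} \<and> admissible (\<gamma> n) (i n) (sn n) (qn n)) \<longrightarrow>
             (\<lambda>n. (real (i n) - 1) / real n) \<longlonglongrightarrow> t \<longrightarrow>
             (\<lambda>n. sn n /\<^sub>R f n) \<longlonglongrightarrow> s \<longrightarrow>
             (\<lambda>n. \<chi> k. real (qn n $ k) / real n) \<longlonglongrightarrow> q \<longrightarrow>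
             (\<lambda>n. opt_reward (\<gamma> n) (\<alpha> n) (\<beta> n) n (i n) (sn n) (qn n) / f n)
               \<longlonglongrightarrow> v (t, s, q)))"

end

(*
In the rescaled coordinates m_k = (a_k + s_k) / (b_k + q_k) (posterior mean) and p_k = b_k + q_k
(posterior precision), pulling arm k is deterministic in p and makes m_k a martingale with increments
of variance about sigma^2 (1/p_k - 1/(p_k + h)), h = 1/n. This variance does not depend on m, and over
consecutive pulls it telescopes. Replace the increments by symmetric +- steps of exactly this
variance: the value walk_value of the resulting control problem is convex, Lipschitz and monotone in m.
No comparison principle for the HJB equation (degenerate, with unbounded coefficients) is needed:

- Since the dynamics commute with translations of m up to a bounded change of the reward, averaging a
  value over small boxes in m yields smooth functions satisfying the dynamic programming inequality
  up to a small error. Lindeberg's comparison then shows that dividing every round into several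
  shorter ones decreases the value by little. Hence the values are almost increasing in n and
  converge to a limit, locally uniformly.

- By convexity in m, the two-point increments of the bandit lie in the convex order between symmetric
  steps of slightly smaller and slightly larger volatility, outside a region of large m that a
  quadratic penalty controls. The limit depends continuously on the volatility, so the rescaled bandit
  has the same limit.

- The symmetric scheme is monotone and consistent with the HJB equation in the coordinates (s, q), so
  by the Barles-Souganidis argument its limit is a viscosity solution.
*)
theory Submission
  imports Defs
begin

text \<open>Only one half of a Lindeberg comparison is available. Holding an arm for a block of
  short rounds imitates a coarse policy, whereas a fine policy may switch arms inside a block and
  has no coarse counterpart. Hence the limit comes from boundedness and almost monotonicity, and
  only the inequality of a supersolution is mollified: the average of a maximum dominates the
  maximum of the averages.

  Positive homogeneity of the walk value, jointly in (\<sigma>, m), drives the continuity estimates: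
  a relative change of volatility or precision becomes a dilation of m, which the Lipschitz bound in
  m absorbs. It says nothing about increasing a zero volatility, so that case is separate.

  The increments of the bandit are asymmetric by a relative amount |m| / \<Gamma>. A round is bad if
  |m| sqrt h exceeds a tolerance \<delta>; a crude comparison there costs O(sqrt h), hence at most a
  constant times h^(3/2) |m|^2. Since the expectation of |m|^2 stays bounded, at most 1 / h rounds
  cost O(sqrt h) altogether.\<close>

section \<open>Maxima over the arms\<close>

lemma max_arm_ge: "F k \<le> (MAX k\<in>UNIV. F k :: real)" for F :: "'k::finite \<Rightarrow> real"
  by (rule Max_ge) auto

lemma max_arm_le: "(\<And>k. F k \<le> x) \<Longrightarrow> (MAX k\<in>UNIV. F k) \<le> x" for F :: "'k::finite \<Rightarrow> real"
  by (subst Max_le_iff) auto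

lemma max_arm_attained:
  fixes F :: "'k::finite \<Rightarrow> real"
  obtains k where "(MAX k\<in>UNIV. F k) = F k"
proof -
  have "(MAX k\<in>UNIV. F k) \<in> range F" by (rule Max_in) auto
  then show ?thesis using that by blast
qed

section \<open>Convex functions and centred two-point laws on a line\<close>

text \<open>The law on \<open>a\<close> and \<open>- b\<close> with mean \<open>x\<close> has the
  weights \<open>(b + x) / (a + b)\<close> and \<open>(a - x) / (a + b)\<close>.\<close>

lemma convex_on_chord:
  fixes \<phi> :: "'a::real_vector \<Rightarrow> real"
  assumes "convex_on UNIV \<phi>" "- b \<le> x" "x \<le> a" "0 < a + b"
  shows "\<phi> (m + x *\<^sub>R e) \<le> ((b + x) * \<phi> (m + a *\<^sub>R e) + (a - x) * \<phi> (m - b *\<^sub>R e)) / (a + b)"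
proof -
  define t where "t = (b + x) / (a + b)"
  have t: "0 \<le> t" "t \<le> 1" "1 - t = (a - x) / (a + b)"
    using assms by (auto simp: t_def field_simps)
  have "(1 - t) *\<^sub>R (m - b *\<^sub>R e) + t *\<^sub>R (m + a *\<^sub>R e) = m + (t * a - (1 - t) * b) *\<^sub>R e"
    by (simp add: algebra_simps)
  moreover have "t * a - (1 - t) * b = x"
  proof -
    have "t * a - (1 - t) * b = t * (a + b) - b" by (simp add: algebra_simps)
    then show ?thesis using assms by (simp add: t_def)
  qed
  ultimately have "\<phi> (m + x *\<^sub>R e) \<le> (1 - t) * \<phi> (m - b *\<^sub>R e) + t * \<phi> (m + a *\<^sub>R e)"
    using convex_onD[OF assms(1) t(1,2), of "m - b *\<^sub>R e" "m + a *\<^sub>R e"] by simp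
  then show ?thesis unfolding t(3) unfolding t_def by (simp add: add_divide_distrib distrib_right)
qed

text \<open>Both atoms \<open>c\<close> and \<open>- c\<close> lie between \<open>- b\<close> and
  \<open>a\<close>. Spreading each of them to the endpoints keeps the mean 0 and produces the
  centred law with weights \<open>b / (a + b)\<close> and \<open>a / (a + b)\<close>. The form
  multiplied by \<open>a + b\<close> admits \<open>a = b = 0\<close>.\<close>

lemma symmetric_le_two_point:
  fixes \<phi> :: "'a::real_vector \<Rightarrow> real"
  assumes "convex_on UNIV \<phi>" "0 \<le> c" "c \<le> a" "c \<le> b"
  shows "(a + b) * (\<phi> (m + c *\<^sub>R e) + \<phi> (m - c *\<^sub>R e)) / 2 \<le>
      b * \<phi> (m + a *\<^sub>R e) + a * \<phi> (m - b *\<^sub>R e)"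
proof (cases "a + b = 0")
  case True
  then have "a = 0" "b = 0" using assms by auto
  then show ?thesis by simp
next
  case False
  then have ab: "0 < a + b" using assms by auto
  have "\<phi> (m + c *\<^sub>R e) * (a + b) \<le> (b + c) * \<phi> (m + a *\<^sub>R e) + (a - c) * \<phi> (m - b *\<^sub>R e)"
    using convex_on_chord[OF assms(1) _ _ ab, of c m e] assms ab by (simp add: pos_le_divide_eq)
  moreover have "\<phi> (m - c *\<^sub>R e) * (a + b) \<le> (b - c) * \<phi> (m + a *\<^sub>R e) + (a + c) * \<phi> (m - b *\<^sub>R e)"
    using convex_on_chord[OF assms(1) _ _ ab, of "-c" m e] assms ab by (simp add: pos_le_divide_eq)
  ultimately show ?thesis by (simp add: algebra_simps)
qed

text \<open>The opposite inclusion of intervals: \<open>a\<close> and \<open>- b\<close> are spread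
  to \<open>c\<close> and \<open>- c\<close>. With the previous bound, an asymmetric centred step is
  sandwiched between two symmetric ones.\<close>

lemma two_point_le_symmetric:
  fixes \<phi> :: "'a::real_vector \<Rightarrow> real"
  assumes "convex_on UNIV \<phi>" "0 \<le> a" "0 \<le> b" "a \<le> c" "b \<le> c"
  shows "b * \<phi> (m + a *\<^sub>R e) + a * \<phi> (m - b *\<^sub>R e) \<le>
      (a + b) * (\<phi> (m + c *\<^sub>R e) + \<phi> (m - c *\<^sub>R e)) / 2"
proof (cases "c = 0")
  case True
  then have "a = 0" "b = 0" using assms by auto
  then show ?thesis by simp
next
  case False
  then have c: "0 < c + c" using assms by auto
  have "\<phi> (m + a *\<^sub>R e) * (c + c) \<le> (c + a) * \<phi> (m + c *\<^sub>R e) + (c - a) * \<phi> (m - c *\<^sub>R e)"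
    using convex_on_chord[OF assms(1) _ _ c, of a m e] assms c by (simp add: pos_le_divide_eq)
  from mult_left_mono[OF this assms(3)]
  have 1: "b * \<phi> (m + a *\<^sub>R e) * (c + c) \<le> b * ((c + a) * \<phi> (m + c *\<^sub>R e) + (c - a) * \<phi> (m - c *\<^sub>R e))"
    by (simp only: mult.assoc)
  have "\<phi> (m - b *\<^sub>R e) * (c + c) \<le> (c - b) * \<phi> (m + c *\<^sub>R e) + (c + b) * \<phi> (m - c *\<^sub>R e)"
    using convex_on_chord[OF assms(1) _ _ c, of "-b" m e] assms c by (simp add: pos_le_divide_eq)
  from mult_left_mono[OF this assms(2)]
  have 2: "a * \<phi> (m - b *\<^sub>R e) * (c + c) \<le> a * ((c - b) * \<phi> (m + c *\<^sub>R e) + (c + b) * \<phi> (m - c *\<^sub>R e))"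
    by (simp only: mult.assoc)
  have "(b * \<phi> (m + a *\<^sub>R e) + a * \<phi> (m - b *\<^sub>R e)) * (c + c)
     \<le> ((a + b) * (\<phi> (m + c *\<^sub>R e) + \<phi> (m - c *\<^sub>R e)) / 2) * (c + c)"
    using 1 2 by (simp add: algebra_simps)
  then show ?thesis using c by (simp only: mult_le_cancel_right_pos)
qed

lemma symmetric_mono:
  fixes \<phi> :: "'a::real_vector \<Rightarrow> real"
  assumes "convex_on UNIV \<phi>" "0 \<le> c" "c \<le> c'"
  shows "\<phi> (m + c *\<^sub>R e) + \<phi> (m - c *\<^sub>R e) \<le> \<phi> (m + c' *\<^sub>R e) + \<phi> (m - c' *\<^sub>R e)"
proof (cases "c' = 0")
  case True then show ?thesis using assms by auto
next
  case False
  then have c: "c' > 0" using assms by auto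
  have "c' * (\<phi> (m + c *\<^sub>R e) + \<phi> (m - c *\<^sub>R e)) \<le> c' * (\<phi> (m + c' *\<^sub>R e) + \<phi> (m - c' *\<^sub>R e))"
    using symmetric_le_two_point[OF assms(1,2,3,3), of m e] by (simp add: algebra_simps)
  then show ?thesis using c by simp
qed

section \<open>The symmetric random walk problem\<close>

text \<open>In a Gaussian model with posterior variance \<open>\<sigma>\<^sup>2 / x\<close>, the
  posterior mean moves with variance
  \<open>\<sigma>\<^sup>2 / x - \<sigma>\<^sup>2 / (x + h)\<close> while the precision grows from
  \<open>x\<close> to \<open>x + h\<close>. This is its standard deviation.\<close>

definition step_size :: "real \<Rightarrow> real \<Rightarrow> real \<Rightarrow> real" where
  "step_size \<sigma> h x = \<sigma> * sqrt (h / (x * (x + h)))"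

primrec walk_value :: "real \<Rightarrow> real \<Rightarrow> nat \<Rightarrow> real^'k::finite \<Rightarrow> real^'k \<Rightarrow> real" where
  "walk_value \<sigma> h 0 m p = 0"
| "walk_value \<sigma> h (Suc j) m p = (MAX k\<in>UNIV. h * m $ k +
     (walk_value \<sigma> h j (m + step_size \<sigma> h (p $ k) *\<^sub>R axis k 1) (p + h *\<^sub>R axis k 1) +
      walk_value \<sigma> h j (m - step_size \<sigma> h (p $ k) *\<^sub>R axis k 1) (p + h *\<^sub>R axis k 1)) / 2)"

declare walk_value.simps(2) [simp del]

lemma walk_value_Suc_ge:
  "h * m $ k +
     (walk_value \<sigma> h j (m + step_size \<sigma> h (p $ k) *\<^sub>R axis k 1) (p + h *\<^sub>R axis k 1) +
      walk_value \<sigma> h j (m - step_size \<sigma> h (p $ k) *\<^sub>R axis k 1) (p + h *\<^sub>R axis k 1)) / 2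
   \<le> walk_value \<sigma> h (Suc j) m p"
  unfolding walk_value.simps(2) by (rule max_arm_ge)

lemma walk_value_Suc_le:
  assumes "\<And>k. h * m $ k +
     (walk_value \<sigma> h j (m + step_size \<sigma> h (p $ k) *\<^sub>R axis k 1) (p + h *\<^sub>R axis k 1) +
      walk_value \<sigma> h j (m - step_size \<sigma> h (p $ k) *\<^sub>R axis k 1) (p + h *\<^sub>R axis k 1)) / 2 \<le> x"
  shows "walk_value \<sigma> h (Suc j) m p \<le> x"
  unfolding walk_value.simps(2) by (rule max_arm_le) (rule assms)

lemma step_size_nonneg [simp]: "0 \<le> \<sigma> \<Longrightarrow> 0 \<le> h \<Longrightarrow> 0 < x \<Longrightarrow> 0 \<le> step_size \<sigma> h x"
  by (simp add: step_size_def)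

lemma step_size_power2:
  "0 \<le> h \<Longrightarrow> 0 < x \<Longrightarrow> (step_size \<sigma> h x)\<^sup>2 = \<sigma>\<^sup>2 * h / (x * (x + h))"
  by (simp add: step_size_def power_mult_distrib)

lemma step_size_le:
  assumes "0 \<le> \<sigma>" "0 \<le> h" "0 < d" "d \<le> x"
  shows "step_size \<sigma> h x \<le> \<sigma> * sqrt h / d"
proof -
  have "d * d \<le> x * (x + h)" using assms by (intro mult_mono) auto
  then have "h / (x * (x + h)) \<le> h / (d * d)" using assms by (intro divide_left_mono) auto
  then have "sqrt (h / (x * (x + h))) \<le> sqrt h / d"
    using assms by (metis abs_of_pos real_sqrt_abs2 real_sqrt_divide real_sqrt_le_mono)
  then show ?thesis using assms by (simp add: step_size_def mult_left_mono times_divide_eq_right[symmetric] del: times_divide_eq_right)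
qed

lemma step_size_power2_le:
  assumes "0 \<le> \<sigma>" "0 \<le> h" "0 < d" "d \<le> x"
  shows "(step_size \<sigma> h x)\<^sup>2 \<le> \<sigma>\<^sup>2 * h / d\<^sup>2"
proof -
  have "(step_size \<sigma> h x)\<^sup>2 \<le> (\<sigma> * sqrt h / d)\<^sup>2"
    using step_size_le[OF assms] assms by (intro power_mono) auto
  then show ?thesis using assms by (simp add: power_mult_distrib power_divide)
qed

text \<open>Steps depend on \<open>p\<close> only, so walks from \<open>m\<close> and
  \<open>m'\<close> driven by the same noise and the same pulls keep their distance; each round
  contributes at most \<open>h\<close> times it.\<close>

lemma walk_value_lipschitz_le:
  assumes "0 \<le> h"
  shows "walk_value \<sigma> h j m p \<le> walk_value \<sigma> h j m' p + real j * h * norm (m - m')"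
proof (induction j arbitrary: m m' p)
  case (Suc j)
  show ?case
  proof (rule walk_value_Suc_le)
    fix k
    let ?c = "step_size \<sigma> h (p $ k) *\<^sub>R axis k 1" and ?p = "p + h *\<^sub>R axis k 1"
    have 1: "walk_value \<sigma> h j (m + ?c) ?p \<le> walk_value \<sigma> h j (m' + ?c) ?p + real j * h * norm (m - m')"
      using Suc[of "m + ?c" ?p "m' + ?c"] by simp
    have 2: "walk_value \<sigma> h j (m - ?c) ?p \<le> walk_value \<sigma> h j (m' - ?c) ?p + real j * h * norm (m - m')"
      using Suc[of "m - ?c" ?p "m' - ?c"] by simp
    have "m $ k \<le> m' $ k + norm (m - m')"
      using component_le_norm_cart[of "m - m'" k] by simp
    then have "h * m $ k \<le> h * m' $ k + h * norm (m - m')"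
      using mult_left_mono[OF _ assms] by (metis distrib_left)
    then show "h * m $ k + (walk_value \<sigma> h j (m + ?c) ?p + walk_value \<sigma> h j (m - ?c) ?p) / 2
      \<le> walk_value \<sigma> h (Suc j) m' p + real (Suc j) * h * norm (m - m')"
    proof -
      have "real (Suc j) * h * norm (m - m') = h * norm (m - m') + real j * h * norm (m - m')"
        by (simp add: algebra_simps)
      then show ?thesis
        using 1 2 walk_value_Suc_ge[of h m' k \<sigma> j p] \<open>h * m $ k \<le> _\<close>
        unfolding \<open>real (Suc j) * h * norm (m - m') = _\<close> by argo
    qed
  qed
qed simp

lemma walk_value_lipschitz:
  assumes "0 \<le> h"
  shows "\<bar>walk_value \<sigma> h j m p - walk_value \<sigma> h j m' p\<bar> \<le> real j * h * norm (m - m')"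
  using walk_value_lipschitz_le[OF assms, of \<sigma> j m p m'] walk_value_lipschitz_le[OF assms, of \<sigma> j m' p m]
  by (simp add: norm_minus_commute)

text \<open>As the step does not depend on \<open>m\<close>, each arm is an affine reward plus an
  average of translates of a convex function, and a maximum of convex functions is convex.\<close>

lemma walk_value_convex: "convex_on UNIV (\<lambda>m. walk_value \<sigma> h j m p)"
proof (induction j arbitrary: p)
  case 0
  show ?case by (simp add: convex_on_def)
next
  case (Suc j)
  show ?case
  proof (rule convex_onI)
    fix t :: real and x y :: "real^'a"
    assume t: "0 < t" "t < 1"
    let ?z = "(1 - t) *\<^sub>R x + t *\<^sub>R y"
    show "walk_value \<sigma> h (Suc j) ?z p \<le>
      (1 - t) * walk_value \<sigma> h (Suc j) x p + t * walk_value \<sigma> h (Suc j) y p"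
    proof (rule walk_value_Suc_le)
      fix k
      let ?c = "step_size \<sigma> h (p $ k) *\<^sub>R axis k 1" and ?p = "p + h *\<^sub>R axis k 1"
      let ?w = "\<lambda>m. walk_value \<sigma> h j m ?p"
      have eq: "?z + v = (1 - t) *\<^sub>R (x + v) + t *\<^sub>R (y + v)" for v
        by (simp add: algebra_simps)
      have *: "?w (?z + v) \<le> (1 - t) * ?w (x + v) + t * ?w (y + v)" for v
        unfolding eq using convex_onD[OF Suc, of t "x + v" "y + v"] t by simp
      have "h * ?z $ k + (?w (?z + ?c) + ?w (?z - ?c)) / 2 \<le>
        (1 - t) * (h * x $ k + (?w (x + ?c) + ?w (x - ?c)) / 2) +
        t * (h * y $ k + (?w (y + ?c) + ?w (y - ?c)) / 2)"
      proof -
        have avg: "a + (b + c) / 2 \<le> (1 - t) * (x1 + (x2 + x3) / 2) + t * (y1 + (y2 + y3) / 2)"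
          if "a = (1 - t) * x1 + t * y1" "b \<le> (1 - t) * x2 + t * y2" "c \<le> (1 - t) * x3 + t * y3"
          for a b c x1 x2 x3 y1 y2 y3 :: real
          using that by (simp add: algebra_simps add_divide_distrib diff_divide_distrib)
        show ?thesis
          using *[of ?c] *[of "- ?c"] by (intro avg) (simp_all add: algebra_simps)
      qed
      also have "\<dots> \<le> (1 - t) * walk_value \<sigma> h (Suc j) x p + t * walk_value \<sigma> h (Suc j) y p"
        using t by (intro add_mono mult_left_mono walk_value_Suc_ge) auto
      finally show "h * ?z $ k + (?w (?z + ?c) + ?w (?z - ?c)) / 2 \<le>
        (1 - t) * walk_value \<sigma> h (Suc j) x p + t * walk_value \<sigma> h (Suc j) y p" .
    qed
  qed simp
qed

text \<open>A longer symmetric step increases the average of a convex function. The ratio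
  \<open>l\<close> lets a larger volatility make up for a larger precision, and
  \<open>p2 $ k \<le> l * p1 $ k\<close> survives a pull because
  \<open>h \<le> l * h\<close>.\<close>

lemma walk_value_mono:
  assumes "0 \<le> \<sigma>1" "0 < h" "1 \<le> l" "l * \<sigma>1 \<le> \<sigma>2"
    and "\<And>k. 0 < p1 $ k" "\<And>k. 0 < p2 $ k" "\<And>k. p2 $ k \<le> l * p1 $ k"
  shows "walk_value \<sigma>1 h j m p1 \<le> walk_value \<sigma>2 h j m p2"
  using assms(5-)
proof (induction j arbitrary: m p1 p2)
  case (Suc j)
  show ?case
  proof (rule walk_value_Suc_le)
    fix k
    let ?c1 = "step_size \<sigma>1 h (p1 $ k)" and ?c2 = "step_size \<sigma>2 h (p2 $ k)"
    let ?q1 = "p1 + h *\<^sub>R axis k 1" and ?q2 = "p2 + h *\<^sub>R axis k 1"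
    have lh: "h \<le> l * h" using assms by simp
    have IH: "walk_value \<sigma>1 h j m' ?q1 \<le> walk_value \<sigma>2 h j m' ?q2" for m'
    proof (rule Suc.IH)
      fix i
      show "0 < ?q1 $ i" "0 < ?q2 $ i"
        using Suc.prems(1)[of i] Suc.prems(2)[of i] assms(2) by (auto simp: axis_def)
      show "?q2 $ i \<le> l * ?q1 $ i"
        using Suc.prems(3)[of i] lh by (auto simp: axis_def algebra_simps)
    qed
    define x1 x2 where "x1 = p1 $ k" and "x2 = p2 $ k"
    have x: "0 < x1" "0 < x2" "x2 \<le> l * x1" using Suc.prems by (auto simp: x1_def x2_def)
    have s2: "0 \<le> \<sigma>2" using assms by (meson mult_nonneg_nonneg order_trans zero_le_one)
    have "x2 * (x2 + h) \<le> (l * x1) * (l * x1 + l * h)"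
      using x lh assms by (intro mult_mono add_mono) auto
    then have "sqrt (x2 * (x2 + h)) \<le> sqrt (l\<^sup>2 * (x1 * (x1 + h)))"
      by (intro real_sqrt_le_mono) (simp add: algebra_simps power2_eq_square)
    then have le: "sqrt (x2 * (x2 + h)) \<le> l * sqrt (x1 * (x1 + h))"
      using assms by (simp add: real_sqrt_mult)
    have pos: "0 < sqrt (x1 * (x1 + h))" "0 < sqrt (x2 * (x2 + h))"
      using x assms by auto
    have "\<sigma>1 * sqrt (x2 * (x2 + h)) \<le> \<sigma>1 * (l * sqrt (x1 * (x1 + h)))"
      using le assms by (intro mult_left_mono)
    also have "\<dots> \<le> \<sigma>2 * sqrt (x1 * (x1 + h))"
      using assms pos by (simp add: mult.assoc[symmetric] mult.commute[of l])
    finally have "\<sigma>1 / sqrt (x1 * (x1 + h)) \<le> \<sigma>2 / sqrt (x2 * (x2 + h))"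
      using pos by (simp add: field_simps)
    then have "(\<sigma>1 / sqrt (x1 * (x1 + h))) * sqrt h \<le> (\<sigma>2 / sqrt (x2 * (x2 + h))) * sqrt h"
      using assms by (intro mult_right_mono) auto
    then have c: "?c1 \<le> ?c2"
      by (simp add: step_size_def real_sqrt_divide x1_def x2_def)
    have "0 \<le> ?c1" using assms x by (simp add: x1_def)
    then have "walk_value \<sigma>2 h j (m + ?c1 *\<^sub>R axis k 1) ?q2 + walk_value \<sigma>2 h j (m - ?c1 *\<^sub>R axis k 1) ?q2
      \<le> walk_value \<sigma>2 h j (m + ?c2 *\<^sub>R axis k 1) ?q2 + walk_value \<sigma>2 h j (m - ?c2 *\<^sub>R axis k 1) ?q2"
      using symmetric_mono[OF walk_value_convex _ c] by blast
    then show "h * m $ k + (walk_value \<sigma>1 h j (m + ?c1 *\<^sub>R axis k 1) ?q1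
        + walk_value \<sigma>1 h j (m - ?c1 *\<^sub>R axis k 1) ?q1) / 2 \<le> walk_value \<sigma>2 h (Suc j) m p2"
      using IH[of "m + ?c1 *\<^sub>R axis k 1"] IH[of "m - ?c1 *\<^sub>R axis k 1"]
        walk_value_Suc_ge[of h m k \<sigma>2 j p2] by argo
  qed
qed simp

text \<open>Rewards and steps are linear in (\<sigma>, m). With the Lipschitz bound in
  \<open>m\<close> this gives continuity in the volatility and, together with monotonicity, in the
  precision.\<close>

lemma walk_value_homogeneous:
  assumes "0 \<le> l"
  shows "walk_value (l * \<sigma>) h j (l *\<^sub>R m) p = l * walk_value \<sigma> h j m p"
proof (induction j arbitrary: m p)
  case (Suc j)
  have *: "step_size (l * \<sigma>) h x = l * step_size \<sigma> h x" for x
    by (simp add: step_size_def)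
  have eq: "l *\<^sub>R m + (l * c) *\<^sub>R v = l *\<^sub>R (m + c *\<^sub>R v)" "l *\<^sub>R m - (l * c) *\<^sub>R v = l *\<^sub>R (m - c *\<^sub>R v)" for c v
    by (simp_all add: algebra_simps)
  let ?F = "\<lambda>k. h * m $ k +
     (walk_value \<sigma> h j (m + step_size \<sigma> h (p $ k) *\<^sub>R axis k 1) (p + h *\<^sub>R axis k 1) +
      walk_value \<sigma> h j (m - step_size \<sigma> h (p $ k) *\<^sub>R axis k 1) (p + h *\<^sub>R axis k 1)) / 2"
  have "walk_value (l * \<sigma>) h (Suc j) (l *\<^sub>R m) p = (MAX k\<in>UNIV. l * ?F k)"
    unfolding walk_value.simps(2) * eq Suc by (simp add: algebra_simps)
  also have "\<dots> = l * (MAX k\<in>UNIV. ?F k)"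
    using mono_Max_commute[of "(*) l" "range ?F"] assms
    by (simp add: monoI mult_left_mono image_image)
  finally show ?case by (simp add: walk_value.simps(2))
qed simp

lemma max_arm_diff:
  fixes F G :: "'k::finite \<Rightarrow> real"
  assumes "\<And>k. \<bar>F k - G k\<bar> \<le> B"
  shows "\<bar>(MAX k\<in>UNIV. F k) - (MAX k\<in>UNIV. G k)\<bar> \<le> B"
proof -
  have "(MAX k\<in>UNIV. F k) \<le> (MAX k\<in>UNIV. G k) + B"
  proof (rule max_arm_le)
    fix k show "F k \<le> (MAX k\<in>UNIV. G k) + B"
      using assms[of k] max_arm_ge[of G k] by linarith
  qed
  moreover have "(MAX k\<in>UNIV. G k) \<le> (MAX k\<in>UNIV. F k) + B"
  proof (rule max_arm_le)
    fix k show "G k \<le> (MAX k\<in>UNIV. F k) + B"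
      using assms[of k] max_arm_ge[of F k] by linarith
  qed
  ultimately show ?thesis by linarith
qed

lemma tendsto_max_arm:
  fixes F :: "'k::finite \<Rightarrow> 'a \<Rightarrow> real"
  assumes "\<And>k. (F k \<longlongrightarrow> L k) G"
  shows "((\<lambda>x. MAX k\<in>UNIV. F k x) \<longlongrightarrow> (MAX k\<in>UNIV. L k)) G"
proof (rule LIM_zero_cancel, rule Lim_null_comparison)
  show "\<forall>\<^sub>F x in G. norm ((MAX k\<in>UNIV. F k x) - (MAX k\<in>UNIV. L k)) \<le> (\<Sum>k\<in>UNIV. \<bar>F k x - L k\<bar>)"
    unfolding real_norm_def
    by (intro always_eventually allI max_arm_diff member_le_sum) auto
  have "((\<lambda>x. \<Sum>k\<in>UNIV. \<bar>F k x - L k\<bar>) \<longlongrightarrow> (\<Sum>k\<in>(UNIV::'k set). 0)) G"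
    by (intro tendsto_sum tendsto_rabs_zero LIM_zero assms)
  then show "((\<lambda>x. \<Sum>k\<in>UNIV. \<bar>F k x - L k\<bar>) \<longlongrightarrow> 0) G" by simp
qed

text \<open>Parallelogram identity. A quadratic bound passes through a symmetric round by adding the
  variance \<open>c\<^sup>2\<close>, with no loss; this is why squares instead of norms appear in
  the growth bounds.\<close>

lemma norm_axis_average:
  fixes m :: "real^'k"
  shows "((norm (m + c *\<^sub>R axis k 1))\<^sup>2 + (norm (m - c *\<^sub>R axis k 1))\<^sup>2) / 2 = (norm m)\<^sup>2 + c\<^sup>2"
proof -
  have "(norm (c *\<^sub>R axis k 1 :: real^'k))\<^sup>2 = c\<^sup>2" by simp
  then show ?thesis
    unfolding power2_norm_eq_inner by (simp add: inner_simps inner_commute)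
qed

lemma average_affine: "(a * (B + x) + a * (B + y)) / 2 = a * (B + (x + y) / 2)" for a B x y :: real
  by (simp add: field_simps)

lemma arm_le: "r \<le> s \<Longrightarrow> w1 \<le> v1 \<Longrightarrow> w2 \<le> v2 \<Longrightarrow> r + (w1 + w2) / 2 \<le> s + (v1 + v2) / 2"
  for r s v1 v2 w1 w2 :: real
  unfolding add_divide_distrib by linarith

lemma arm_diff: "\<bar>w1 - v1\<bar> \<le> b1 \<Longrightarrow> \<bar>w2 - v2\<bar> \<le> b2 \<Longrightarrow>
    \<bar>(r + (w1 + w2) / 2) - (r + (v1 + v2) / 2)\<bar> \<le> (b1 + b2) / 2"
  for r b1 b2 v1 v2 w1 w2 :: real
  unfolding add_divide_distrib by linarith

lemma le_one_plus_square: "(x::real) \<le> 1 + x\<^sup>2"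
proof -
  have "0 \<le> (x - 1/2)\<^sup>2" by simp
  then show ?thesis by (simp add: power2_eq_square algebra_simps)
qed

section \<open>Growth bounds and continuity of the walk value\<close>

text \<open>Pulling arm \<open>k\<close> in all rounds is a policy, and \<open>m $ k\<close> is a
  martingale under it.\<close>

lemma walk_value_ge:
  assumes "0 \<le> h"
  shows "real j * h * m $ k \<le> walk_value \<sigma> h j m p"
proof (induction j arbitrary: m p)
  case (Suc j)
  let ?c = "step_size \<sigma> h (p $ k)" and ?p = "p + h *\<^sub>R axis k 1"
  have "real j * h * (m $ k + ?c) \<le> walk_value \<sigma> h j (m + ?c *\<^sub>R axis k 1) ?p"
    using Suc[of "m + ?c *\<^sub>R axis k 1" ?p] by simp
  moreover have "real j * h * (m $ k - ?c) \<le> walk_value \<sigma> h j (m - ?c *\<^sub>R axis k 1) ?p"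
    using Suc[of "m - ?c *\<^sub>R axis k 1" ?p] by simp
  ultimately have "h * m $ k + (real j * h * (m $ k + ?c) + real j * h * (m $ k - ?c)) / 2
      \<le> walk_value \<sigma> h (Suc j) m p"
    by (intro order_trans[OF arm_le[OF order_refl] walk_value_Suc_ge])
  then show ?case
    by (simp add: algebra_simps)
qed simp

text \<open>Under every policy the expected squared distance to \<open>m0\<close> grows by at most
  \<open>h * \<sigma>\<^sup>2 / d\<^sup>2\<close> per round, and every coordinate is at most
  \<open>x + 1\<close> plus that square. The centre is free: \<open>m0 = 0\<close> leads to a bound
  of the modulus, \<open>m0 = m\<close> to a bound by the largest coordinate of
  \<open>m\<close>.\<close>

lemma walk_value_le:
  assumes "0 \<le> \<sigma>" "0 \<le> h" "0 < d" "\<And>k. d \<le> p $ k" "\<And>k. m0 $ k \<le> x"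
  shows "walk_value \<sigma> h j m p \<le> real j * h * (x + 1 + (norm (m - m0))\<^sup>2 + real j * h * \<sigma>\<^sup>2 / d\<^sup>2)"
  using assms(4)
proof (induction j arbitrary: m p)
  case (Suc j)
  show ?case
  proof (rule walk_value_Suc_le)
    fix k
    let ?c = "step_size \<sigma> h (p $ k)" and ?p = "p + h *\<^sub>R axis k 1"
    have p: "d \<le> ?p $ i" for i
      using Suc.prems[of i] assms(2) by (auto simp: axis_def)
    define B where "B = x + 1 + real j * h * \<sigma>\<^sup>2 / d\<^sup>2"
    define n where "n = norm (m - m0)"
    have eq: "m + v - m0 = (m - m0) + v" "m - v - m0 = (m - m0) - v" for v by simp_all
    have "walk_value \<sigma> h j (m + ?c *\<^sub>R axis k 1) ?p
        \<le> real j * h * (B + (norm ((m - m0) + ?c *\<^sub>R axis k 1))\<^sup>2)"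
      using Suc.IH[OF p, of "m + ?c *\<^sub>R axis k 1"] unfolding eq by (simp add: B_def algebra_simps)
    moreover have "walk_value \<sigma> h j (m - ?c *\<^sub>R axis k 1) ?p
        \<le> real j * h * (B + (norm ((m - m0) - ?c *\<^sub>R axis k 1))\<^sup>2)"
      using Suc.IH[OF p, of "m - ?c *\<^sub>R axis k 1"] unfolding eq by (simp add: B_def algebra_simps)
    ultimately have "(walk_value \<sigma> h j (m + ?c *\<^sub>R axis k 1) ?p
        + walk_value \<sigma> h j (m - ?c *\<^sub>R axis k 1) ?p) / 2
        \<le> real j * h * (B + (((norm ((m - m0) + ?c *\<^sub>R axis k 1))\<^sup>2
            + (norm ((m - m0) - ?c *\<^sub>R axis k 1))\<^sup>2) / 2))"
      unfolding average_affine[symmetric] by (intro divide_right_mono add_mono) auto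
    also have "\<dots> = real j * h * (B + (n\<^sup>2 + ?c\<^sup>2))"
      unfolding norm_axis_average n_def ..
    also have "\<dots> \<le> real j * h * (B + (n\<^sup>2 + h * \<sigma>\<^sup>2 / d\<^sup>2))"
      using step_size_power2_le[OF assms(1-3) Suc.prems[of k]] assms(2)
      by (intro mult_left_mono add_left_mono) (auto simp: mult.commute)
    finally have 1: "(walk_value \<sigma> h j (m + ?c *\<^sub>R axis k 1) ?p
        + walk_value \<sigma> h j (m - ?c *\<^sub>R axis k 1) ?p) / 2 \<le> \<dots>" .
    have "m $ k \<le> m0 $ k + n"
      using component_le_norm_cart[of "m - m0" k] by (simp add: n_def)
    then have "m $ k \<le> x + (1 + n\<^sup>2)"
      using assms(5)[of k] le_one_plus_square[of n] by linarith
    also have "\<dots> \<le> x + (1 + n\<^sup>2) + real (Suc j) * h * \<sigma>\<^sup>2 / d\<^sup>2"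
      using assms by simp
    finally have 2: "h * m $ k \<le> h * (x + (1 + n\<^sup>2) + real (Suc j) * h * \<sigma>\<^sup>2 / d\<^sup>2)"
      using assms(2) by (rule mult_left_mono)
    have "h * (x + (1 + n\<^sup>2) + real (Suc j) * h * \<sigma>\<^sup>2 / d\<^sup>2) + real j * h * (B + (n\<^sup>2 + h * \<sigma>\<^sup>2 / d\<^sup>2))
      = real (Suc j) * h * (x + 1 + n\<^sup>2 + real (Suc j) * h * \<sigma>\<^sup>2 / d\<^sup>2)"
      by (simp add: B_def algebra_simps add_divide_distrib)
    then show "h * m $ k + (walk_value \<sigma> h j (m + ?c *\<^sub>R axis k 1) ?p
        + walk_value \<sigma> h j (m - ?c *\<^sub>R axis k 1) ?p) / 2
        \<le> real (Suc j) * h * (x + 1 + (norm (m - m0))\<^sup>2 + real (Suc j) * h * \<sigma>\<^sup>2 / d\<^sup>2)"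
      using add_mono[OF 2 1] unfolding n_def[symmetric] by (simp only:)
  qed
qed simp

lemma walk_value_abs_le:
  assumes "0 \<le> \<sigma>" "0 \<le> h" "0 < d" "\<And>k. d \<le> p $ k"
  shows "\<bar>walk_value \<sigma> h j m p\<bar> \<le> real j * h * (1 + (norm m)\<^sup>2 + real j * h * \<sigma>\<^sup>2 / d\<^sup>2)"
proof -
  have "walk_value \<sigma> h j m p \<le> real j * h * (1 + (norm m)\<^sup>2 + real j * h * \<sigma>\<^sup>2 / d\<^sup>2)"
    using walk_value_le[of \<sigma> h d p 0 0 j m] assms by simp
  moreover have "- (real j * h * (1 + (norm m)\<^sup>2 + real j * h * \<sigma>\<^sup>2 / d\<^sup>2)) \<le> walk_value \<sigma> h j m p"
  proof -
    \<comment> \<open>An arbitrary arm; there is one because types are inhabited.\<close>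
    fix k
    have "- m $ k \<le> norm m" using component_le_norm_cart[of m k] by linarith
    also have "\<dots> \<le> 1 + (norm m)\<^sup>2 + real j * h * \<sigma>\<^sup>2 / d\<^sup>2"
      using le_one_plus_square[of "norm m"] assms by (simp add: add_increasing2)
    finally have "- (1 + (norm m)\<^sup>2 + real j * h * \<sigma>\<^sup>2 / d\<^sup>2) \<le> m $ k" by simp
    then have "real j * h * (- (1 + (norm m)\<^sup>2 + real j * h * \<sigma>\<^sup>2 / d\<^sup>2)) \<le> real j * h * m $ k"
      using assms by (intro mult_left_mono) auto
    then show ?thesis using walk_value_ge[OF assms(2), of j m k \<sigma> p] by linarith
  qed
  ultimately show ?thesis by linarith
qed

text \<open>The extra round comes last: the first \<open>j\<close> rounds can be matched, and the
  last reward has modulus at most \<open>h\<close> times one plus the squared norm of the mean,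
  whose expectation has grown by at most \<open>h * \<sigma>\<^sup>2 / d\<^sup>2\<close> per
  round.\<close>

lemma walk_value_time_step:
  assumes "0 \<le> \<sigma>" "0 \<le> h" "0 < d" "\<And>k. d \<le> p $ k"
  shows "\<bar>walk_value \<sigma> h (Suc j) m p - walk_value \<sigma> h j m p\<bar>
    \<le> h * (1 + (norm m)\<^sup>2 + real j * h * \<sigma>\<^sup>2 / d\<^sup>2)"
  using assms(4)
proof (induction j arbitrary: m p)
  case 0
  have "\<bar>(MAX k\<in>UNIV. h * m $ k) - (MAX k\<in>(UNIV::'a set). 0)\<bar> \<le> h * (1 + (norm m)\<^sup>2)"
  proof (rule max_arm_diff)
    fix k
    have "\<bar>m $ k\<bar> \<le> 1 + (norm m)\<^sup>2"
      using component_le_norm_cart[of m k] le_one_plus_square[of "norm m"] by linarith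
    then show "\<bar>h * m $ k - 0\<bar> \<le> h * (1 + (norm m)\<^sup>2)"
      using assms(2) by (simp add: abs_mult mult_left_mono)
  qed
  then show ?case by (simp add: walk_value.simps(2))
next
  case (Suc j)
  show ?case unfolding walk_value.simps(2)[of \<sigma> h "Suc j"] walk_value.simps(2)[of \<sigma> h "j" m p]
  proof (rule max_arm_diff)
    fix k
    let ?c = "step_size \<sigma> h (p $ k)" and ?p = "p + h *\<^sub>R axis k 1"
    have p: "d \<le> ?p $ i" for i
      using Suc.prems[of i] assms(2) by (auto simp: axis_def)
    define B where "B = 1 + real j * h * \<sigma>\<^sup>2 / d\<^sup>2"
    let ?w = "\<lambda>j m. walk_value \<sigma> h j m ?p"
    have IH: "\<bar>?w (Suc j) m - ?w j m\<bar> \<le> h * (B + (norm m)\<^sup>2)" for m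
      using Suc.IH[OF p, of m] by (simp add: B_def algebra_simps)
    let ?P = "m + ?c *\<^sub>R axis k 1" and ?M = "m - ?c *\<^sub>R axis k 1"
    have "\<bar>(h * m $ k + (?w (Suc j) ?P + ?w (Suc j) ?M) / 2) - (h * m $ k + (?w j ?P + ?w j ?M) / 2)\<bar>
      \<le> (h * (B + (norm ?P)\<^sup>2) + h * (B + (norm ?M)\<^sup>2)) / 2"
      by (intro arm_diff IH)
    also have "\<dots> = h * (B + ((norm ?P)\<^sup>2 + (norm ?M)\<^sup>2) / 2)" by (rule average_affine)
    also have "\<dots> = h * (B + ((norm m)\<^sup>2 + ?c\<^sup>2))" unfolding norm_axis_average ..
    also have "\<dots> \<le> h * (B + ((norm m)\<^sup>2 + h * \<sigma>\<^sup>2 / d\<^sup>2))"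
      using step_size_power2_le[OF assms(1-3) Suc.prems[of k]] assms(2)
      by (intro mult_left_mono add_left_mono) (auto simp: mult.commute)
    also have "\<dots> = h * (1 + (norm m)\<^sup>2 + real (Suc j) * h * \<sigma>\<^sup>2 / d\<^sup>2)"
      by (simp add: B_def algebra_simps add_divide_distrib)
    finally show "\<bar>(h * m $ k + (?w (Suc j) ?P + ?w (Suc j) ?M) / 2) - (h * m $ k + (?w j ?P + ?w j ?M) / 2)\<bar>
      \<le> h * (1 + (norm m)\<^sup>2 + real (Suc j) * h * \<sigma>\<^sup>2 / d\<^sup>2)" .
  qed
qed

lemma walk_value_time_le:
  assumes "0 \<le> \<sigma>" "0 \<le> h" "0 < d" "\<And>k. d \<le> p $ k" "i \<le> j"
  shows "\<bar>walk_value \<sigma> h j m p - walk_value \<sigma> h i m p\<bar>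
    \<le> real (j - i) * h * (1 + (norm m)\<^sup>2 + real j * h * \<sigma>\<^sup>2 / d\<^sup>2)"
  using assms(5)
proof (induction j rule: dec_induct)
  case (step j)
  let ?B = "\<lambda>j. 1 + (norm m)\<^sup>2 + real j * h * \<sigma>\<^sup>2 / d\<^sup>2"
  have mono: "?B j \<le> ?B (Suc j)"
    using assms by (intro add_left_mono divide_right_mono mult_right_mono) auto
  have "\<bar>walk_value \<sigma> h (Suc j) m p - walk_value \<sigma> h i m p\<bar> \<le> h * ?B j + real (j - i) * h * ?B j"
    using step.IH walk_value_time_step[OF assms(1-4), of j m] by linarith
  also have "\<dots> = real (Suc j - i) * h * ?B j"
  proof -
    have "real (Suc j - i) = real (j - i) + 1" using step.hyps by (simp add: Suc_diff_le)
    then show ?thesis by (simp only: distrib_right mult_1 add.commute)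
  qed
  also have "\<dots> \<le> real (Suc j - i) * h * ?B (Suc j)"
    using mono assms by (intro mult_left_mono) auto
  finally show ?case .
qed simp

lemma tendsto_step_size:
  assumes "(h' \<longlongrightarrow> h) F" "(x' \<longlongrightarrow> x) F" "0 \<le> h" "0 < x"
  shows "((\<lambda>i. step_size \<sigma> (h' i) (x' i)) \<longlongrightarrow> step_size \<sigma> h x) F"
  unfolding step_size_def using assms
  by (intro tendsto_intros) auto

text \<open>The number of rounds is fixed, so continuity passes through finitely many maxima and
  averages. It serves to replace the step \<open>(n div n0) / n\<close> by its limit
  \<open>1 / n0\<close>.\<close>

lemma tendsto_walk_value:
  assumes "(h' \<longlongrightarrow> h) F" "(m' \<longlongrightarrow> m) F" "(p' \<longlongrightarrow> p) F" "0 \<le> h" "\<And>k. 0 < p $ k"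
  shows "((\<lambda>i. walk_value \<sigma> (h' i) j (m' i) (p' i)) \<longlongrightarrow> walk_value \<sigma> h j m p) F"
  using assms(2,3,5)
proof (induction j arbitrary: m m' p p')
  case (Suc j)
  have "((\<lambda>i. walk_value \<sigma> (h' i) j (m' i + step_size \<sigma> (h' i) (p' i $ k) *\<^sub>R axis k 1) (p' i + h' i *\<^sub>R axis k 1))
    \<longlongrightarrow> walk_value \<sigma> h j (m + step_size \<sigma> h (p $ k) *\<^sub>R axis k 1) (p + h *\<^sub>R axis k 1)) F" for k
    by (rule Suc.IH) (use assms(1,4) Suc.prems in
        \<open>auto intro!: tendsto_intros tendsto_step_size add_pos_nonneg simp: axis_def\<close>)
  moreover have "((\<lambda>i. walk_value \<sigma> (h' i) j (m' i - step_size \<sigma> (h' i) (p' i $ k) *\<^sub>R axis k 1) (p' i + h' i *\<^sub>R axis k 1))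
    \<longlongrightarrow> walk_value \<sigma> h j (m - step_size \<sigma> h (p $ k) *\<^sub>R axis k 1) (p + h *\<^sub>R axis k 1)) F" for k
    by (rule Suc.IH) (use assms(1,4) Suc.prems in
        \<open>auto intro!: tendsto_intros tendsto_step_size add_pos_nonneg simp: axis_def\<close>)
  ultimately show ?case
    unfolding walk_value.simps(2)
    by (intro tendsto_max_arm tendsto_intros assms(1) Suc.prems) auto
qed simp

section \<open>Averaging over boxes\<close>

text \<open>Averaging one coordinate at a time requires only integrals over an interval; iterating
  over the axes smooths in all directions.\<close>

definition box_avg :: "real \<Rightarrow> 'k \<Rightarrow> (real^'k::finite \<Rightarrow> real) \<Rightarrow> real^'k \<Rightarrow> real" where
  "box_avg \<epsilon> k g m = integral {- \<epsilon>..\<epsilon>} (\<lambda>y. g (m + y *\<^sub>R axis k 1)) / (2 * \<epsilon>)"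

lemma has_integral_box_avg:
  assumes "continuous_on UNIV g" "0 < \<epsilon>"
  shows "((\<lambda>y. g (m + y *\<^sub>R axis k 1)) has_integral 2 * \<epsilon> * box_avg \<epsilon> k g m) {- \<epsilon>..\<epsilon>}"
proof -
  have "continuous_on {- \<epsilon>..\<epsilon>} (\<lambda>y. g (m + y *\<^sub>R axis k 1))"
    by (intro continuous_on_compose2[OF assms(1)] continuous_intros) auto
  then have "(\<lambda>y. g (m + y *\<^sub>R axis k 1)) integrable_on {- \<epsilon>..\<epsilon>}"
    by (rule integrable_continuous_real)
  then show ?thesis using assms(2) by (simp add: box_avg_def integrable_integral)
qed

lemma has_integral_box_avg_shift:
  assumes "continuous_on UNIV g" "0 < \<epsilon>"
  shows "((\<lambda>y. g (m + y *\<^sub>R axis k 1 + v)) has_integral 2 * \<epsilon> * box_avg \<epsilon> k g (m + v)) {- \<epsilon>..\<epsilon>}"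
proof -
  have "m + y *\<^sub>R axis k 1 + v = m + v + y *\<^sub>R axis k 1" for y by simp
  then show ?thesis using has_integral_box_avg[OF assms, of "m + v" k] by (simp only:)
qed

lemma box_avg_lipschitz:
  assumes "L-lipschitz_on UNIV g" "0 < \<epsilon>"
  shows "L-lipschitz_on UNIV (box_avg \<epsilon> k g)"
proof (rule lipschitz_onI)
  show "0 \<le> L" using assms(1) by (rule lipschitz_on_nonneg)
  fix x y :: "real^'a"
  note cont = lipschitz_on_continuous_on[OF assms(1)]
  have "((\<lambda>z. g (x + z *\<^sub>R axis k 1) - g (y + z *\<^sub>R axis k 1)) has_integral
      2 * \<epsilon> * box_avg \<epsilon> k g x - 2 * \<epsilon> * box_avg \<epsilon> k g y) {- \<epsilon>..\<epsilon>}"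
    by (intro has_integral_diff has_integral_box_avg cont assms)
  then have "norm (2 * \<epsilon> * box_avg \<epsilon> k g x - 2 * \<epsilon> * box_avg \<epsilon> k g y)
      \<le> (L * dist x y) * measure lborel {- \<epsilon>..\<epsilon>}"
  proof (rule has_integral_bound_real[where S="{}", rotated 2])
    show "0 \<le> L * dist x y" using \<open>0 \<le> L\<close> by simp
    fix z
    show "norm (g (x + z *\<^sub>R axis k 1) - g (y + z *\<^sub>R axis k 1)) \<le> L * dist x y"
      using lipschitz_onD[OF assms(1), of "x + z *\<^sub>R axis k 1" "y + z *\<^sub>R axis k 1"]
      by (simp add: dist_norm)
  qed simp
  moreover have "norm (2 * \<epsilon> * box_avg \<epsilon> k g x - 2 * \<epsilon> * box_avg \<epsilon> k g y)
     = 2 * \<epsilon> * dist (box_avg \<epsilon> k g x) (box_avg \<epsilon> k g y)"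
    using assms(2) by (simp add: dist_norm abs_mult flip: right_diff_distrib)
  ultimately show "dist (box_avg \<epsilon> k g x) (box_avg \<epsilon> k g y) \<le> L * dist x y"
    using assms(2) by simp
qed

lemma box_avg_close:
  assumes "L-lipschitz_on UNIV g" "0 < \<epsilon>"
  shows "\<bar>box_avg \<epsilon> k g m - g m\<bar> \<le> L * \<epsilon>"
proof -
  note cont = lipschitz_on_continuous_on[OF assms(1)]
  have L: "0 \<le> L" using assms(1) by (rule lipschitz_on_nonneg)
  have "((\<lambda>z. g m) has_integral (2 * \<epsilon>) * g m) {- \<epsilon>..\<epsilon>}"
    using has_integral_const_real[of "g m" "-\<epsilon>" \<epsilon>] assms(2) by simp
  then have "((\<lambda>z. g (m + z *\<^sub>R axis k 1) - g m) has_integral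
      2 * \<epsilon> * box_avg \<epsilon> k g m - 2 * \<epsilon> * g m) {- \<epsilon>..\<epsilon>}"
    by (intro has_integral_diff has_integral_box_avg cont assms)
  then have "norm (2 * \<epsilon> * box_avg \<epsilon> k g m - 2 * \<epsilon> * g m)
      \<le> (L * \<epsilon>) * measure lborel {- \<epsilon>..\<epsilon>}"
  proof (rule has_integral_bound_real[where S="{}", rotated 2])
    show "0 \<le> L * \<epsilon>" using L assms by simp
    fix z assume "z \<in> {- \<epsilon>..\<epsilon>} - {}"
    then have "L * \<bar>z\<bar> \<le> L * \<epsilon>" using L by (intro mult_left_mono) auto
    then show "norm (g (m + z *\<^sub>R axis k 1) - g m) \<le> L * \<epsilon>"
      using lipschitz_onD[OF assms(1), of "m + z *\<^sub>R axis k 1" "m"]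
      by (simp add: dist_norm)
  qed simp
  moreover have "norm (2 * \<epsilon> * box_avg \<epsilon> k g m - 2 * \<epsilon> * g m)
     = 2 * \<epsilon> * \<bar>box_avg \<epsilon> k g m - g m\<bar>"
    using assms(2) by (simp add: abs_mult flip: right_diff_distrib)
  ultimately show ?thesis
    using assms(2) by simp
qed

text \<open>The reward is affine in the shift and the interval is centred, so the reward averages to
  its value at \<open>m\<close>. The step \<open>v\<close> commutes with translations. Hence the
  inequality survives with no error.\<close>

lemma box_avg_arm:
  assumes "continuous_on UNIV f" "continuous_on UNIV g" "0 < \<epsilon>"
    and "\<And>m. h * m $ i + (g (m + v) + g (m - v)) / 2 \<le> f m"
  shows "h * m $ i + (box_avg \<epsilon> k g (m + v) + box_avg \<epsilon> k g (m - v)) / 2 \<le> box_avg \<epsilon> k f m"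
proof -
  have lin: "((\<lambda>y. h * (m + y *\<^sub>R axis k 1) $ i) has_integral 2 * \<epsilon> * (h * m $ i)) {- \<epsilon>..\<epsilon>}"
  proof -
    define a where "a = h * axis k 1 $ i"
    have "((\<lambda>y. h * m $ i + a * y) has_integral
        (h * m $ i * \<epsilon> + a * (\<epsilon>\<^sup>2 / 2)) - (h * m $ i * (- \<epsilon>) + a * ((- \<epsilon>)\<^sup>2 / 2))) {- \<epsilon>..\<epsilon>}"
      using assms(3)
      by (intro fundamental_theorem_of_calculus)
        (auto intro!: derivative_eq_intros simp flip: has_real_derivative_iff_has_vector_derivative)
    then show ?thesis by (simp add: a_def algebra_simps)
  qed
  have "((\<lambda>y. h * (m + y *\<^sub>R axis k 1) $ i +
      (g (m + y *\<^sub>R axis k 1 + v) + g (m + y *\<^sub>R axis k 1 + - v)) / 2) has_integral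
      2 * \<epsilon> * (h * m $ i) + (2 * \<epsilon> * box_avg \<epsilon> k g (m + v) + 2 * \<epsilon> * box_avg \<epsilon> k g (m + - v)) / 2) {- \<epsilon>..\<epsilon>}"
    by (intro has_integral_add lin has_integral_divide has_integral_box_avg_shift assms)
  from has_integral_le[OF this has_integral_box_avg[OF assms(1,3), of m k]]
  have "2 * \<epsilon> * (h * m $ i) + (2 * \<epsilon> * box_avg \<epsilon> k g (m + v) + 2 * \<epsilon> * box_avg \<epsilon> k g (m + - v)) / 2
    \<le> 2 * \<epsilon> * box_avg \<epsilon> k f m"
    using assms(4) by (simp only: add_uminus_conv_diff)
  then have "(2 * \<epsilon>) * (h * m $ i + (box_avg \<epsilon> k g (m + v) + box_avg \<epsilon> k g (m - v)) / 2)
    \<le> (2 * \<epsilon>) * box_avg \<epsilon> k f m" by (simp add: algebra_simps)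
  then show ?thesis using assms(3) by simp
qed

definition second_diff :: "('a::real_vector \<Rightarrow> real) \<Rightarrow> 'a \<Rightarrow> 'a \<Rightarrow> real" where
  "second_diff g v m = g (m + v) + g (m - v) - 2 * g m"

text \<open>A derivative-free form of the statement that the second derivative of \<open>g\<close> along the \<open>k\<close>-th
  axis is Lipschitz. It only involves translates of \<open>g\<close>, hence it survives averaging.\<close>

definition smooth_along :: "real \<Rightarrow> 'k \<Rightarrow> (real^'k::finite \<Rightarrow> real) \<Rightarrow> bool" where
  "smooth_along \<Lambda> k g \<longleftrightarrow> (\<forall>m x a b. 0 \<le> a \<longrightarrow> 0 < b \<longrightarrow>
     \<bar>b\<^sup>2 * second_diff g (a *\<^sub>R axis k 1) (m + x *\<^sub>R axis k 1) - a\<^sup>2 * second_diff g (b *\<^sub>R axis k 1) m\<bar>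
       \<le> \<Lambda> * a\<^sup>2 * b\<^sup>2 * (\<bar>x\<bar> + a + b))"

lemma box_avg_smooth_along:
  assumes "continuous_on UNIV g" "0 < \<epsilon>" "smooth_along \<Lambda> i g" "0 \<le> \<Lambda>"
  shows "smooth_along \<Lambda> i (box_avg \<epsilon> k g)"
  unfolding smooth_along_def
proof (intro allI impI)
  fix m :: "real^'a" and x a b :: real
  assume ab: "0 \<le> a" "0 < b"
  let ?e = "axis i 1 :: real^'a"
  let ?C = "\<Lambda> * a\<^sup>2 * b\<^sup>2 * (\<bar>x\<bar> + a + b)"
  have I: "((\<lambda>y. second_diff g v (m + y *\<^sub>R axis k 1 + w)) has_integral
      2 * \<epsilon> * second_diff (box_avg \<epsilon> k g) v (m + w)) {- \<epsilon>..\<epsilon>}" for v w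
  proof -
    have "((\<lambda>y. g (m + y *\<^sub>R axis k 1 + (w + v)) + g (m + y *\<^sub>R axis k 1 + (w - v))
          - 2 * g (m + y *\<^sub>R axis k 1 + w)) has_integral
      2 * \<epsilon> * box_avg \<epsilon> k g (m + (w + v)) + 2 * \<epsilon> * box_avg \<epsilon> k g (m + (w - v))
        - 2 * (2 * \<epsilon> * box_avg \<epsilon> k g (m + w))) {- \<epsilon>..\<epsilon>}"
      by (intro has_integral_add has_integral_diff has_integral_mult_right has_integral_box_avg_shift assms)
    then show ?thesis by (simp add: second_diff_def algebra_simps)
  qed
  have "((\<lambda>y. b\<^sup>2 * second_diff g (a *\<^sub>R ?e) (m + y *\<^sub>R axis k 1 + x *\<^sub>R ?e)
       - a\<^sup>2 * second_diff g (b *\<^sub>R ?e) (m + y *\<^sub>R axis k 1 + 0)) has_integral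
      b\<^sup>2 * (2 * \<epsilon> * second_diff (box_avg \<epsilon> k g) (a *\<^sub>R ?e) (m + x *\<^sub>R ?e))
       - a\<^sup>2 * (2 * \<epsilon> * second_diff (box_avg \<epsilon> k g) (b *\<^sub>R ?e) (m + 0))) {- \<epsilon>..\<epsilon>}"
    by (intro has_integral_diff has_integral_mult_right I)
  then have "norm (b\<^sup>2 * (2 * \<epsilon> * second_diff (box_avg \<epsilon> k g) (a *\<^sub>R ?e) (m + x *\<^sub>R ?e))
       - a\<^sup>2 * (2 * \<epsilon> * second_diff (box_avg \<epsilon> k g) (b *\<^sub>R ?e) (m + 0))) \<le> ?C * measure lborel {- \<epsilon>..\<epsilon>}"
  proof (rule has_integral_bound_real[where S="{}", rotated 2])
    show "0 \<le> ?C" using ab assms(4) by simp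
    fix y
    show "norm (b\<^sup>2 * second_diff g (a *\<^sub>R ?e) (m + y *\<^sub>R axis k 1 + x *\<^sub>R ?e)
       - a\<^sup>2 * second_diff g (b *\<^sub>R ?e) (m + y *\<^sub>R axis k 1 + 0)) \<le> ?C"
      using assms(3) ab unfolding smooth_along_def by simp
  qed simp
  moreover have "b\<^sup>2 * (2 * \<epsilon> * second_diff (box_avg \<epsilon> k g) (a *\<^sub>R ?e) (m + x *\<^sub>R ?e))
       - a\<^sup>2 * (2 * \<epsilon> * second_diff (box_avg \<epsilon> k g) (b *\<^sub>R ?e) (m + 0))
      = (2 * \<epsilon>) * (b\<^sup>2 * second_diff (box_avg \<epsilon> k g) (a *\<^sub>R ?e) (m + x *\<^sub>R ?e)
       - a\<^sup>2 * second_diff (box_avg \<epsilon> k g) (b *\<^sub>R ?e) m)"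
    by (simp add: algebra_simps)
  ultimately have "(2 * \<epsilon>) * \<bar>b\<^sup>2 * second_diff (box_avg \<epsilon> k g) (a *\<^sub>R ?e) (m + x *\<^sub>R ?e)
       - a\<^sup>2 * second_diff (box_avg \<epsilon> k g) (b *\<^sub>R ?e) m\<bar> \<le> (2 * \<epsilon>) * ?C"
    using assms(2) by (simp only: real_norm_def abs_mult) (simp add: mult.commute)
  then show "\<bar>b\<^sup>2 * second_diff (box_avg \<epsilon> k g) (a *\<^sub>R ?e) (m + x *\<^sub>R ?e)
       - a\<^sup>2 * second_diff (box_avg \<epsilon> k g) (b *\<^sub>R ?e) m\<bar> \<le> ?C"
    using assms(2) by simp
qed

section \<open>Smoothness gained by averaging twice\<close>

lemma antiderivative_exists:
  fixes \<phi> :: "real \<Rightarrow> real"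
  assumes "continuous_on UNIV \<phi>"
  obtains F where "\<And>x. (F has_real_derivative \<phi> x) (at x)"
proof -
  have "\<exists>F. \<forall>x :: real. -\<infinity> < ereal x \<longrightarrow> ereal x < \<infinity> \<longrightarrow> (F has_vector_derivative \<phi> x) (at x)"
    using assms by (intro einterval_antiderivative) (auto simp: continuous_on_eq_continuous_at)
  then show ?thesis
    using that by (auto simp: has_real_derivative_iff_has_vector_derivative)
qed

text \<open>Taylor expansions to the right and to the left of \<open>x\<close> cancel the
  first-order term. The result is measured against \<open>G2\<close> at the fixed point 0, so that
  second differences with different centres and increments can be compared with one and the same
  number.\<close>

lemma second_diff_second_derivative:
  fixes G :: "real \<Rightarrow> real"
  assumes G: "\<And>x. (G has_real_derivative G1 x) (at x)" "\<And>x. (G1 has_real_derivative G2 x) (at x)"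
    and lip: "\<And>x y. \<bar>G2 x - G2 y\<bar> \<le> \<Lambda> * \<bar>x - y\<bar>" and a: "0 \<le> a" and L: "0 \<le> \<Lambda>"
  shows "\<bar>G (x + a) + G (x - a) - 2 * G x - a\<^sup>2 * G2 0\<bar> \<le> \<Lambda> * a\<^sup>2 * (\<bar>x\<bar> + a)"
proof (cases "a = 0")
  case False
  then have a: "0 < a" using a by simp
  define diff where "diff n = (if n = 0 then G else if n = 1 then G1 else G2)" for n :: nat
  have D: "\<forall>m t. m < 2 \<and> x - a \<le> t \<and> t \<le> x + a \<longrightarrow> (diff m has_real_derivative diff (Suc m) t) (at t)"
    by (auto simp: diff_def G less_2_cases_iff)
  have "\<exists>t>x. t < x + a \<and> G (x + a) = (\<Sum>m<2. diff m x / fact m * (x + a - x) ^ m) + diff 2 t / fact 2 * (x + a - x)\<^sup>2"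
    by (rule Taylor_up) (use D a in \<open>auto simp: diff_def\<close>)
  then obtain s where s: "x < s" "s < x + a" "G (x + a) = G x + G1 x * a + G2 s / 2 * a\<^sup>2"
    by (auto simp: diff_def numeral_2_eq_2)
  have "\<exists>t>x - a. t < x \<and> G (x - a) = (\<Sum>m<2. diff m x / fact m * (x - a - x) ^ m) + diff 2 t / fact 2 * (x - a - x)\<^sup>2"
    by (rule Taylor_down) (use D a in \<open>auto simp: diff_def\<close>)
  then obtain t where t: "x - a < t" "t < x" "G (x - a) = G x - G1 x * a + G2 t / 2 * a\<^sup>2"
    by (auto simp: diff_def numeral_2_eq_2)
  have "\<bar>G2 s - G2 0\<bar> \<le> \<Lambda> * (\<bar>x\<bar> + a)"
    by (rule order_trans[OF lip]) (use s L a in \<open>auto intro!: mult_left_mono\<close>)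
  moreover have "\<bar>G2 t - G2 0\<bar> \<le> \<Lambda> * (\<bar>x\<bar> + a)"
    by (rule order_trans[OF lip]) (use t L a in \<open>auto intro!: mult_left_mono\<close>)
  ultimately have "\<bar>(G2 s - G2 0) / 2 + (G2 t - G2 0) / 2\<bar> \<le> \<Lambda> * (\<bar>x\<bar> + a)"
    unfolding add_divide_distrib diff_divide_distrib by linarith
  then have "a\<^sup>2 * \<bar>(G2 s - G2 0) / 2 + (G2 t - G2 0) / 2\<bar> \<le> a\<^sup>2 * (\<Lambda> * (\<bar>x\<bar> + a))"
    by (rule mult_left_mono) simp
  moreover have "a\<^sup>2 * \<bar>(G2 s - G2 0) / 2 + (G2 t - G2 0) / 2\<bar>
      = \<bar>a\<^sup>2 * ((G2 s - G2 0) / 2 + (G2 t - G2 0) / 2)\<bar>"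
    by (simp add: abs_mult)
  moreover have "G (x + a) + G (x - a) - 2 * G x - a\<^sup>2 * G2 0 = a\<^sup>2 * ((G2 s - G2 0) / 2 + (G2 t - G2 0) / 2)"
    unfolding s(3) t(3) by (simp add: algebra_simps diff_divide_distrib)
  ultimately show ?thesis by (simp add: mult_ac)
qed simp

lemma box_avg_antiderivative:
  assumes "\<And>x. (F has_real_derivative g (m + x *\<^sub>R axis k 1)) (at x)" "0 < \<epsilon>"
  shows "box_avg \<epsilon> k g (m + x *\<^sub>R axis k 1) = (F (x + \<epsilon>) - F (x - \<epsilon>)) / (2 * \<epsilon>)"
proof -
  have "((\<lambda>y. g (m + (x + y) *\<^sub>R axis k 1)) has_integral F (x + \<epsilon>) - F (x + - \<epsilon>)) {- \<epsilon>..\<epsilon>}"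
    using assms
    by (intro fundamental_theorem_of_calculus)
      (auto simp flip: has_real_derivative_iff_has_vector_derivative
        intro!: DERIV_shift[THEN iffD1, THEN has_field_derivative_at_within] simp: add.commute)
  then have "integral {- \<epsilon>..\<epsilon>} (\<lambda>y. g (m + x *\<^sub>R axis k 1 + y *\<^sub>R axis k 1)) = F (x + \<epsilon>) - F (x - \<epsilon>)"
    by (simp add: integral_unique scaleR_add_left add.assoc)
  then show ?thesis by (simp add: box_avg_def)
qed

text \<open>Along the axis, two averages are a second difference quotient of a double
  antiderivative. The second derivative is therefore the quotient \<open>(\<phi> (x + 2 *
  \<epsilon>) - 2 * \<phi> x + \<phi> (x - 2 * \<epsilon>)) / (4 * \<epsilon>\<^sup>2)\<close> of
  \<open>g\<close> itself, and its Lipschitz constant is \<open>4 * L\<close> over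
  \<open>4 * \<epsilon>\<^sup>2\<close>.\<close>

lemma box_avg_twice_smooth_along:
  assumes lip: "L-lipschitz_on UNIV g" and e: "0 < \<epsilon>"
  shows "smooth_along (L / \<epsilon>\<^sup>2) k (box_avg \<epsilon> k (box_avg \<epsilon> k g))"
  unfolding smooth_along_def
proof (intro allI impI)
  fix m :: "real^'a" and x a b :: real
  assume ab: "0 \<le> a" "0 < b"
  have L: "0 \<le> L" using lip by (rule lipschitz_on_nonneg)
  let ?e = "axis k 1 :: real^'a"
  define \<phi> where "\<phi> x = g (m + x *\<^sub>R ?e)" for x
  define G where "G x = box_avg \<epsilon> k (box_avg \<epsilon> k g) (m + x *\<^sub>R ?e)" for x
  have "continuous_on UNIV \<phi>"
    unfolding \<phi>_def
    by (intro continuous_on_compose2[OF lipschitz_on_continuous_on[OF lip]] continuous_intros) auto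
  then obtain F where F: "\<And>x. (F has_real_derivative \<phi> x) (at x)"
    using antiderivative_exists by blast
  then have "continuous_on UNIV F"
    by (meson DERIV_continuous_on has_field_derivative_at_within)
  then obtain F2 where F2: "\<And>x. (F2 has_real_derivative F x) (at x)"
    using antiderivative_exists by blast
  have avg1: "box_avg \<epsilon> k g (m + x *\<^sub>R ?e) = (F (x + \<epsilon>) - F (x - \<epsilon>)) / (2 * \<epsilon>)" for x
    using F e by (intro box_avg_antiderivative) (simp_all add: \<phi>_def)
  have shift: "((\<lambda>x. H (x + c)) has_real_derivative H' (x + c)) (at x)"
    if "\<And>x. (H has_real_derivative H' x) (at x)" for H H' and c x :: real
    using that[of "x + c"] by (simp add: DERIV_shift)
  have D1: "((\<lambda>x. (F2 (x + \<epsilon>) - F2 (x + - \<epsilon>)) / (2 * \<epsilon>)) has_real_derivative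
      (F (x + \<epsilon>) - F (x + - \<epsilon>)) / (2 * \<epsilon>)) (at x)" for x
    by (intro DERIV_cdivide DERIV_diff shift F2)
  \<comment> \<open>The inner average is \<open>F (x + \<epsilon>) - F (x - \<epsilon>)\<close> over
    \<open>2 * \<epsilon>\<close>; integrating it once more uses \<open>F2\<close> and doubles the
    spacing.\<close>
  have G: "G x = (F2 (x + 2 * \<epsilon>) - 2 * F2 x + F2 (x + - 2 * \<epsilon>)) / (4 * \<epsilon>\<^sup>2)" for x
  proof -
    let ?F = "\<lambda>x. (F2 (x + \<epsilon>) - F2 (x + - \<epsilon>)) / (2 * \<epsilon>)"
    have "(?F has_real_derivative box_avg \<epsilon> k g (m + x *\<^sub>R ?e)) (at x)" for x
      unfolding avg1 using D1[of x] by simp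
    from box_avg_antiderivative[of ?F, OF this e] have "G x = (?F (x + \<epsilon>) - ?F (x - \<epsilon>)) / (2 * \<epsilon>)"
      by (simp only: G_def)
    moreover have "x + \<epsilon> + \<epsilon> = x + 2 * \<epsilon>" "x + \<epsilon> + - \<epsilon> = x" "x - \<epsilon> + \<epsilon> = x" "x - \<epsilon> + - \<epsilon> = x + - 2 * \<epsilon>"
      by simp_all
    ultimately have "G x = ((F2 (x + 2 * \<epsilon>) - F2 x) - (F2 x - F2 (x + - 2 * \<epsilon>))) / (2 * \<epsilon>) / (2 * \<epsilon>)"
      by (simp only: diff_divide_distrib)
    moreover have "(F2 (x + 2 * \<epsilon>) - F2 x) - (F2 x - F2 (x + - 2 * \<epsilon>))
        = F2 (x + 2 * \<epsilon>) - 2 * F2 x + F2 (x + - 2 * \<epsilon>)" by simp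
    moreover have "4 * \<epsilon>\<^sup>2 = (2 * \<epsilon>) * (2 * \<epsilon>)" by (simp add: power2_eq_square)
    ultimately show ?thesis by (simp only: divide_divide_eq_left)
  qed
  define G1 where "G1 x = (F (x + 2 * \<epsilon>) - 2 * F x + F (x + - 2 * \<epsilon>)) / (4 * \<epsilon>\<^sup>2)" for x
  define G2 where "G2 x = (\<phi> (x + 2 * \<epsilon>) - 2 * \<phi> x + \<phi> (x + - 2 * \<epsilon>)) / (4 * \<epsilon>\<^sup>2)" for x
  have GD: "(G has_real_derivative G1 x) (at x)" for x
    unfolding G G1_def by (intro DERIV_cdivide DERIV_diff DERIV_add DERIV_cmult shift F2)
  have G1D: "(G1 has_real_derivative G2 x) (at x)" for x
    unfolding G1_def G2_def by (intro DERIV_cdivide DERIV_diff DERIV_add DERIV_cmult shift F)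
  have \<phi>: "\<bar>\<phi> x - \<phi> y\<bar> \<le> L * \<bar>x - y\<bar>" for x y
    using lipschitz_onD[OF lip, of "m + x *\<^sub>R ?e" "m + y *\<^sub>R ?e"]
    by (simp add: \<phi>_def dist_norm flip: scaleR_diff_left)
  have G2L: "\<bar>G2 x - G2 y\<bar> \<le> L / \<epsilon>\<^sup>2 * \<bar>x - y\<bar>" for x y
  proof -
    have "\<bar>(\<phi> (x + 2 * \<epsilon>) - 2 * \<phi> x + \<phi> (x + - 2 * \<epsilon>)) - (\<phi> (y + 2 * \<epsilon>) - 2 * \<phi> y + \<phi> (y + - 2 * \<epsilon>))\<bar>
       \<le> 4 * (L * \<bar>x - y\<bar>)"
      using \<phi>[of "x + 2 * \<epsilon>" "y + 2 * \<epsilon>"] \<phi>[of x y] \<phi>[of "x + - 2 * \<epsilon>" "y + - 2 * \<epsilon>"] by simp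
    then have "\<bar>(\<phi> (x + 2 * \<epsilon>) - 2 * \<phi> x + \<phi> (x + - 2 * \<epsilon>)) - (\<phi> (y + 2 * \<epsilon>) - 2 * \<phi> y + \<phi> (y + - 2 * \<epsilon>))\<bar> / (4 * \<epsilon>\<^sup>2)
       \<le> 4 * (L * \<bar>x - y\<bar>) / (4 * \<epsilon>\<^sup>2)"
      by (rule divide_right_mono) simp
    then show ?thesis by (simp add: G2_def flip: diff_divide_distrib)
  qed
  have L': "0 \<le> L / \<epsilon>\<^sup>2" using L by simp
  have 1: "\<bar>G (x + a) + G (x - a) - 2 * G x - a\<^sup>2 * G2 0\<bar> \<le> L / \<epsilon>\<^sup>2 * a\<^sup>2 * (\<bar>x\<bar> + a)"
    by (rule second_diff_second_derivative[OF GD G1D G2L ab(1) L'])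
  have 2: "\<bar>G (0 + b) + G (0 - b) - 2 * G 0 - b\<^sup>2 * G2 0\<bar> \<le> L / \<epsilon>\<^sup>2 * b\<^sup>2 * (\<bar>0\<bar> + b)"
    by (rule second_diff_second_derivative[OF GD G1D G2L _ L']) (use ab in simp)
  have sd: "second_diff (box_avg \<epsilon> k (box_avg \<epsilon> k g)) (a *\<^sub>R ?e) (m + x *\<^sub>R ?e) = G (x + a) + G (x - a) - 2 * G x" for a x
    by (simp add: second_diff_def G_def algebra_simps)
  have sd0: "second_diff (box_avg \<epsilon> k (box_avg \<epsilon> k g)) (b *\<^sub>R ?e) m = G (0 + b) + G (0 - b) - 2 * G 0"
    using sd[of b 0] by simp
  define A B where "A = G (x + a) + G (x - a) - 2 * G x" and "B = G (0 + b) + G (0 - b) - 2 * G 0"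
  \<comment> \<open>The common reference \<open>G2 0\<close> cancels between the two normalised
    second differences.\<close>
  have "b\<^sup>2 * A - a\<^sup>2 * B = b\<^sup>2 * (A - a\<^sup>2 * G2 0) - a\<^sup>2 * (B - b\<^sup>2 * G2 0)" by (simp add: algebra_simps)
  also have "\<bar>\<dots>\<bar> \<le> b\<^sup>2 * \<bar>A - a\<^sup>2 * G2 0\<bar> + a\<^sup>2 * \<bar>B - b\<^sup>2 * G2 0\<bar>"
    by (rule order_trans[OF abs_triangle_ineq4]) (simp add: abs_mult)
  also have "\<dots> \<le> b\<^sup>2 * (L / \<epsilon>\<^sup>2 * a\<^sup>2 * (\<bar>x\<bar> + a)) + a\<^sup>2 * (L / \<epsilon>\<^sup>2 * b\<^sup>2 * (\<bar>0\<bar> + b))"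
    using 1 2 unfolding A_def B_def by (intro add_mono mult_left_mono) auto
  also have "\<dots> = L / \<epsilon>\<^sup>2 * a\<^sup>2 * b\<^sup>2 * (\<bar>x\<bar> + a + b)"
    by (simp add: algebra_simps add_divide_distrib)
  finally show "\<bar>b\<^sup>2 * second_diff (box_avg \<epsilon> k (box_avg \<epsilon> k g)) (a *\<^sub>R ?e) (m + x *\<^sub>R ?e)
      - a\<^sup>2 * second_diff (box_avg \<epsilon> k (box_avg \<epsilon> k g)) (b *\<^sub>R ?e) m\<bar>
      \<le> L / \<epsilon>\<^sup>2 * a\<^sup>2 * b\<^sup>2 * (\<bar>x\<bar> + a + b)"
    unfolding sd sd0 A_def B_def .
qed

text \<open>Each axis is averaged twice because a single average of a Lipschitz function only has a
  Lipschitz first derivative, and the argument needs a Lipschitz second derivative.\<close>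

primrec mollify :: "real \<Rightarrow> 'k list \<Rightarrow> (real^'k::finite \<Rightarrow> real) \<Rightarrow> real^'k \<Rightarrow> real" where
  "mollify \<epsilon> [] g = g"
| "mollify \<epsilon> (k # ks) g = box_avg \<epsilon> k (box_avg \<epsilon> k (mollify \<epsilon> ks g))"

lemma mollify_lipschitz:
  "L-lipschitz_on UNIV g \<Longrightarrow> 0 < \<epsilon> \<Longrightarrow> L-lipschitz_on UNIV (mollify \<epsilon> ks g)"
  by (induction ks) (auto intro: box_avg_lipschitz)

lemma mollify_close:
  assumes "L-lipschitz_on UNIV g" "0 < \<epsilon>"
  shows "\<bar>mollify \<epsilon> ks g m - g m\<bar> \<le> 2 * L * \<epsilon> * real (length ks)"
proof (induction ks)
  case (Cons k ks)
  note lip = mollify_lipschitz[OF assms, of ks]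
  have "\<bar>mollify \<epsilon> (k # ks) g m - g m\<bar> \<le> L * \<epsilon> + (L * \<epsilon> + 2 * L * \<epsilon> * real (length ks))"
    using box_avg_close[OF box_avg_lipschitz[OF lip assms(2)] assms(2), of k k m]
      box_avg_close[OF lip assms(2), of k m] Cons by simp
  then show ?case by (simp add: algebra_simps)
qed simp

text \<open>The two averages along \<open>k\<close> create the smoothness from the Lipschitz bound,
  which all earlier averages preserve; later averages along other axes preserve the
  smoothness.\<close>

lemma mollify_smooth_along:
  assumes "L-lipschitz_on UNIV g" "0 < \<epsilon>" "k \<in> set ks"
  shows "smooth_along (L / \<epsilon>\<^sup>2) k (mollify \<epsilon> ks g)"
  using assms(3)
proof (induction ks)
  case (Cons i ks)
  note lip = mollify_lipschitz[OF assms(1,2), of ks]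
  note cont = lipschitz_on_continuous_on[OF lip]
    lipschitz_on_continuous_on[OF box_avg_lipschitz[OF lip assms(2)]]
  have L: "0 \<le> L / \<epsilon>\<^sup>2" using lipschitz_on_nonneg[OF assms(1)] by simp
  show ?case
  proof (cases "k = i")
    case True
    then show ?thesis using box_avg_twice_smooth_along[OF lip assms(2)] by simp
  next
    case False
    then have "smooth_along (L / \<epsilon>\<^sup>2) k (mollify \<epsilon> ks g)" using Cons by simp
    then show ?thesis by (auto intro!: box_avg_smooth_along cont assms(2) L)
  qed
qed simp

lemma mollify_arm:
  assumes "L-lipschitz_on UNIV f" "L'-lipschitz_on UNIV g" "0 < \<epsilon>"
    and "\<And>m. h * m $ i + (g (m + v) + g (m - v)) / 2 \<le> f m"
  shows "h * m $ i + (mollify \<epsilon> ks g (m + v) + mollify \<epsilon> ks g (m - v)) / 2 \<le> mollify \<epsilon> ks f m"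
proof (induction ks arbitrary: m)
  case (Cons k ks)
  note lf = mollify_lipschitz[OF assms(1,3), of ks] and lg = mollify_lipschitz[OF assms(2,3), of ks]
  show ?case
    by (simp, intro box_avg_arm Cons lipschitz_on_continuous_on[OF lf] lipschitz_on_continuous_on[OF lg]
        lipschitz_on_continuous_on[OF box_avg_lipschitz[OF lf]]
        lipschitz_on_continuous_on[OF box_avg_lipschitz[OF lg]] assms(3))
qed (simp add: assms)

section \<open>Refining the time step\<close>

text \<open>A supersolution of the discrete dynamic programming equation, tested arm by arm. An
  averaged value function satisfies this inequality but in general not the equation.\<close>

definition superscheme :: "real \<Rightarrow> real \<Rightarrow> (nat \<Rightarrow> real^'k::finite \<Rightarrow> real^'k \<Rightarrow> real) \<Rightarrow> bool" where
  "superscheme \<sigma> h u \<longleftrightarrow> (\<forall>j m p k. (\<forall>i. 0 < p $ i) \<longrightarrow>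
     h * m $ k + (u j (m + step_size \<sigma> h (p $ k) *\<^sub>R axis k 1) (p + h *\<^sub>R axis k 1)
       + u j (m - step_size \<sigma> h (p $ k) *\<^sub>R axis k 1) (p + h *\<^sub>R axis k 1)) / 2 \<le> u (Suc j) m p)"

lemma walk_value_lipschitz_on:
  assumes "0 \<le> h"
  shows "(real j * h)-lipschitz_on UNIV (\<lambda>m. walk_value \<sigma> h j m p)"
  using walk_value_lipschitz[OF assms] assms by (intro lipschitz_onI) (auto simp: dist_norm)

lemma superscheme_mollify:
  assumes "0 \<le> h" "0 < \<epsilon>"
  shows "superscheme \<sigma> h (\<lambda>j m p. mollify \<epsilon> ks (\<lambda>m. walk_value \<sigma> h j m p) m)"
  unfolding superscheme_def
  by (intro allI impI, rule mollify_arm[OF walk_value_lipschitz_on[OF assms(1)]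
        walk_value_lipschitz_on[OF assms(1)] assms(2) walk_value_Suc_ge])

text \<open>The quotient of a second difference by \<open>b\<^sup>2\<close> stands in for the second
  derivative at \<open>m\<close>, from both sides.\<close>

lemma second_diff_ge:
  assumes "smooth_along \<Lambda> k g" "0 \<le> a" "0 < b"
  shows "a\<^sup>2 * second_diff g (b *\<^sub>R axis k 1) m / b\<^sup>2 - \<Lambda> * a\<^sup>2 * (\<bar>x\<bar> + a + b)
      \<le> second_diff g (a *\<^sub>R axis k 1) (m + x *\<^sub>R axis k 1)"
    and "second_diff g (a *\<^sub>R axis k 1) (m + x *\<^sub>R axis k 1)
      \<le> a\<^sup>2 * second_diff g (b *\<^sub>R axis k 1) m / b\<^sup>2 + \<Lambda> * a\<^sup>2 * (\<bar>x\<bar> + a + b)"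
proof -
  define A B E where "A = second_diff g (a *\<^sub>R axis k 1) (m + x *\<^sub>R axis k 1)"
    and "B = second_diff g (b *\<^sub>R axis k 1) m" and "E = \<Lambda> * a\<^sup>2 * (\<bar>x\<bar> + a + b)"
  have "\<bar>b\<^sup>2 * A - a\<^sup>2 * B\<bar> \<le> b\<^sup>2 * E"
    using assms unfolding smooth_along_def A_def B_def E_def by (simp add: mult_ac)
  then have "b\<^sup>2 * A \<le> a\<^sup>2 * B + b\<^sup>2 * E" "a\<^sup>2 * B - b\<^sup>2 * E \<le> b\<^sup>2 * A" by linarith+
  moreover have "b\<^sup>2 * (a\<^sup>2 * B / b\<^sup>2 + E) = a\<^sup>2 * B + b\<^sup>2 * E"
    "b\<^sup>2 * (a\<^sup>2 * B / b\<^sup>2 - E) = a\<^sup>2 * B - b\<^sup>2 * E"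
    using assms(3) by (simp_all add: distrib_left right_diff_distrib)
  ultimately have "b\<^sup>2 * A \<le> b\<^sup>2 * (a\<^sup>2 * B / b\<^sup>2 + E)" "b\<^sup>2 * (a\<^sup>2 * B / b\<^sup>2 - E) \<le> b\<^sup>2 * A" by simp_all
  then show "a\<^sup>2 * B / b\<^sup>2 - E \<le> A" "A \<le> a\<^sup>2 * B / b\<^sup>2 + E"
    using assms(3) by (simp_all only: mult_le_cancel_left_pos zero_less_power)
qed

text \<open>Pulling arm \<open>k\<close> in \<open>i\<close> consecutive rounds moves \<open>m\<close> by a sum of independent centred steps
  whose total variance is \<open>\<Theta> i\<close>, so this is Lindeberg's argument. The quadratic \<open>x\<^sup>2\<close> in the error
  term stands for the modulus of the partial sums, since it is propagated exactly.\<close>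

lemma superscheme_block:
  fixes q m :: "real^'k::finite" and \<sigma> :: real
  assumes super: "superscheme \<sigma> h u" and smooth: "smooth_along \<Lambda> k (\<lambda>m. u j m q)"
    and pos: "0 \<le> \<Lambda>" "0 < b" "0 < h" "0 \<le> \<sigma>" "0 < d"
    and q: "\<And>i. 0 < q $ i" "d \<le> q $ k - real N * h" and C: "\<sigma> * sqrt h / d \<le> C"
  defines "\<Theta> \<equiv> \<lambda>i::nat. \<sigma>\<^sup>2 * (1 / (q $ k - real i * h) - 1 / q $ k)"
    and "g \<equiv> \<lambda>m. u j m q"
  assumes "i \<le> N"
  shows "real i * h * (m $ k + x) + g (m + x *\<^sub>R axis k 1)
      + \<Theta> i * (second_diff g (b *\<^sub>R axis k 1) m / b\<^sup>2) / 2
      - \<Lambda> * \<Theta> i * (2 * b + C + (x\<^sup>2 + \<Theta> i) / b) / 2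
     \<le> u (j + i) (m + x *\<^sub>R axis k 1) (q - (real i * h) *\<^sub>R axis k 1)"
  using \<open>i \<le> N\<close>
proof (induction i arbitrary: x)
  case 0
  then show ?case by (simp add: \<Theta>_def g_def)
next
  case (Suc i)
  define D where "D = second_diff g (b *\<^sub>R axis k 1) m / b\<^sup>2"
  \<comment> \<open>The precision is counted backwards from its value \<open>q\<close> at the end of
    the block: \<open>y\<close> is the precision of arm \<open>k\<close> when \<open>Suc i\<close>
    pulls are still to come.\<close>
  define y where "y = q $ k - real (Suc i) * h"
  define c where "c = step_size \<sigma> h y"
  define B where "B = 2 * b + C"
  let ?e = "axis k 1 :: real^'k"
  let ?p = "q - (real (Suc i) * h) *\<^sub>R ?e"
  have "real (Suc i) * h \<le> real N * h" using Suc.prems pos by (intro mult_right_mono) auto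
  then have "d \<le> y" using q(2) unfolding y_def by linarith
  then have y: "d \<le> y" "0 < y" using pos by auto
  have yh: "y + h = q $ k - real i * h" by (simp add: y_def algebra_simps)
  have pk: "?p $ k = y" by (simp add: y_def)
  have ppos: "0 < ?p $ l" for l
    using q(1)[of l] y pk by (cases "l = k") (auto simp: axis_def)
  have ph: "?p + h *\<^sub>R ?e = q - (real i * h) *\<^sub>R ?e" by (simp add: algebra_simps)
  have c0: "0 \<le> c" using pos y by (simp add: c_def)
  have cC: "c \<le> C" using step_size_le[of \<sigma> h d y] pos y C by (simp add: c_def)
  have c2: "\<Theta> (Suc i) = \<Theta> i + c\<^sup>2"
  proof -
    have "c\<^sup>2 = \<sigma>\<^sup>2 * (h / (y * (y + h)))" using pos y by (simp add: c_def step_size_power2)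
    also have "h / (y * (y + h)) = 1 / y - 1 / (y + h)" using pos y by (simp add: field_simps)
    finally show ?thesis
      unfolding \<Theta>_def yh y_def[symmetric] by (simp add: right_diff_distrib)
  qed
  have \<Theta>0: "0 \<le> \<Theta> i"
  proof -
    have "0 < q $ k - real i * h" using yh y pos by linarith
    then have "1 / q $ k \<le> 1 / (q $ k - real i * h)" using pos by (intro divide_left_mono) (use q in auto)
    then show ?thesis by (simp add: \<Theta>_def)
  qed
  have IH: "real i * h * (m $ k + z) + g (m + z *\<^sub>R ?e) + \<Theta> i * D / 2 - \<Lambda> * \<Theta> i * (B + (z\<^sup>2 + \<Theta> i) / b) / 2
     \<le> u (j + i) (m + z *\<^sub>R ?e) (q - (real i * h) *\<^sub>R ?e)" for z
    using Suc.IH[of z] Suc.prems by (simp add: D_def B_def)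
  \<comment> \<open>The modulus from the smoothness estimate is traded for a square, which averages
    exactly over a symmetric step.\<close>
  have xb: "\<bar>x\<bar> \<le> b + x\<^sup>2 / b"
  proof (cases "\<bar>x\<bar> \<le> b")
    case True
    moreover have "0 \<le> x\<^sup>2 / b" using pos by simp
    ultimately show ?thesis by linarith
  next
    case False
    then have "b * \<bar>x\<bar> \<le> \<bar>x\<bar> * \<bar>x\<bar>" by (intro mult_right_mono) auto
    then have "\<bar>x\<bar> \<le> x\<^sup>2 / b" using pos by (simp add: pos_le_divide_eq power2_eq_square mult.commute)
    then show ?thesis using pos by linarith
  qed
  have sd: "c\<^sup>2 * D - \<Lambda> * c\<^sup>2 * (B + x\<^sup>2 / b) \<le> second_diff g (c *\<^sub>R ?e) (m + x *\<^sub>R ?e)"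
  proof -
    have "\<Lambda> * c\<^sup>2 * (\<bar>x\<bar> + c + b) \<le> \<Lambda> * c\<^sup>2 * (B + x\<^sup>2 / b)"
      using xb cC pos by (intro mult_left_mono) (auto simp: B_def)
    then show ?thesis
      using second_diff_ge(1)[OF smooth c0 pos(2), of m x] by (simp add: D_def g_def)
  qed
  have sd_eq: "second_diff g (c *\<^sub>R ?e) (m + x *\<^sub>R ?e) = g (m + (x + c) *\<^sub>R ?e) + g (m + (x - c) *\<^sub>R ?e) - 2 * g (m + x *\<^sub>R ?e)"
    by (simp add: second_diff_def algebra_simps)
  let ?U = "\<lambda>z. u (j + i) (m + z *\<^sub>R ?e) (q - (real i * h) *\<^sub>R ?e)"
  have arm: "h * (m $ k + x) + (?U (x + c) + ?U (x - c)) / 2 \<le> u (j + Suc i) (m + x *\<^sub>R ?e) ?p"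
    using super[unfolded superscheme_def, rule_format, of ?p "m + x *\<^sub>R ?e" k "j + i", OF ppos]
    unfolding ph pk c_def[symmetric] by (simp add: algebra_simps)
  \<comment> \<open>Averaging \<open>(x + c)\<^sup>2\<close> and \<open>(x - c)\<^sup>2\<close> adds
    \<open>c\<^sup>2\<close>, which turns the \<open>\<Theta> i\<close> inside the bracket into
    \<open>\<Theta> (Suc i)\<close>. The two sides then differ by the nonnegative amount
    \<open>\<Lambda> * c\<^sup>2 * (\<Theta> (Suc i) / b)\<close>.\<close>
  have err: "\<Lambda> * \<Theta> i * (B + ((x + c)\<^sup>2 + \<Theta> i) / b) / 2 + \<Lambda> * \<Theta> i * (B + ((x - c)\<^sup>2 + \<Theta> i) / b) / 2
      + \<Lambda> * c\<^sup>2 * (B + x\<^sup>2 / b) \<le> \<Lambda> * \<Theta> (Suc i) * (B + (x\<^sup>2 + \<Theta> (Suc i)) / b)"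
  proof -
    have "\<Lambda> * \<Theta> (Suc i) * (B + (x\<^sup>2 + \<Theta> (Suc i)) / b) = \<Lambda> * \<Theta> i * (B + ((x + c)\<^sup>2 + \<Theta> i) / b) / 2
      + \<Lambda> * \<Theta> i * (B + ((x - c)\<^sup>2 + \<Theta> i) / b) / 2 + \<Lambda> * c\<^sup>2 * (B + x\<^sup>2 / b) + \<Lambda> * c\<^sup>2 * (\<Theta> (Suc i) / b)"
      unfolding c2 by (simp add: power2_eq_square algebra_simps add_divide_distrib diff_divide_distrib)
    moreover have "0 \<le> \<Lambda> * c\<^sup>2 * (\<Theta> (Suc i) / b)" using pos \<Theta>0 by (simp add: c2)
    ultimately show ?thesis by linarith
  qed
  define R where "R = real i * h"
  have R: "real (Suc i) * h = h + R" by (simp add: R_def algebra_simps)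
  have split: "R * (m $ k + (x + c)) = R * (m $ k + x) + R * c" "R * (m $ k + (x - c)) = R * (m $ k + x) - R * c"
    "(h + R) * (m $ k + x) = h * (m $ k + x) + R * (m $ k + x)" "(\<Theta> i + c\<^sup>2) * D = \<Theta> i * D + c\<^sup>2 * D"
    by (simp_all add: algebra_simps)
  have "(h + R) * (m $ k + x) + g (m + x *\<^sub>R ?e) + (\<Theta> i + c\<^sup>2) * D / 2
      - \<Lambda> * \<Theta> (Suc i) * (B + (x\<^sup>2 + \<Theta> (Suc i)) / b) / 2
      \<le> h * (m $ k + x) + (?U (x + c) + ?U (x - c)) / 2"
  proof -
    have combine: "a + r + g0 + (tD + cD) / 2 - e4 / 2 \<le> a + (U1 + U2) / 2"
      if "e1 / 2 + e2 / 2 + e3 \<le> e4" "r + rc + g1 + tD / 2 - e1 / 2 \<le> U1"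
        "r - rc + g2 + tD / 2 - e2 / 2 \<le> U2" "cD - e3 \<le> g1 + g2 - 2 * g0"
      for a r rc g0 g1 g2 tD cD e1 e2 e3 e4 U1 U2 :: real
      using that unfolding add_divide_distrib by linarith
    show ?thesis
      using err IH[of "x + c"] IH[of "x - c"] sd unfolding sd_eq R_def[symmetric] split
      by (rule combine)
  qed
  also note arm
  finally show ?case unfolding R B_def D_def c2[symmetric] by simp
qed

text \<open>One long step is compared with \<open>N\<close> short pulls of the same arm. The total
  variances coincide, so the second-order terms cancel and errors of order \<open>H * sqrt H\<close>
  remain. In units of \<open>\<Lambda> * \<kappa>\<^sup>2 * H * sqrt H / 2\<close>, the long step
  costs \<open>\<kappa> + 1\<close> and the block \<open>2 + \<kappa> + \<kappa>\<^sup>2\<close>,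
  which explains the factor \<open>\<kappa>\<^sup>2 + 2 * \<kappa> + 3\<close>.\<close>

lemma superscheme_block_arm:
  fixes p m :: "real^'k::finite" and \<sigma> :: real
  assumes super: "superscheme \<sigma> h u"
    and smooth: "smooth_along \<Lambda> k (\<lambda>m. u j m (p + (real N * h) *\<^sub>R axis k 1))"
    and pos: "0 \<le> \<Lambda>" "0 < h" "0 \<le> \<sigma>" "0 < d" "0 < N"
    and p: "\<And>i. d \<le> p $ i"
  defines "H \<equiv> real N * h" and "\<kappa> \<equiv> \<sigma> / d"
  shows "H * m $ k + (u j (m + step_size \<sigma> H (p $ k) *\<^sub>R axis k 1) (p + H *\<^sub>R axis k 1)
       + u j (m - step_size \<sigma> H (p $ k) *\<^sub>R axis k 1) (p + H *\<^sub>R axis k 1)) / 2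
     \<le> u (j + N) m p + \<Lambda> * \<kappa>\<^sup>2 * (\<kappa>\<^sup>2 + 2 * \<kappa> + 3) / 2 * H * sqrt H"
proof -
  let ?e = "axis k 1 :: real^'k"
  \<comment> \<open>The reference increment has the size of a typical long step, which balances the
    errors \<open>b\<close> and \<open>c\<^sup>2 / b\<close>.\<close>
  define b where "b = sqrt H"
  define q where "q = p + H *\<^sub>R ?e"
  define g where "g = (\<lambda>m. u j m q)"
  define c where "c = step_size \<sigma> H (p $ k)"
  define D where "D = second_diff g (b *\<^sub>R ?e) m / b\<^sup>2"
  have hH: "h \<le> H" using pos by (simp add: H_def)
  have H: "0 < H" using hH pos by simp
  have b: "0 < b" "b\<^sup>2 = H" using H by (auto simp: b_def)
  have ppos: "0 < p $ i" for i using p[of i] pos by linarith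
  have qpos: "0 < q $ i" for i using ppos[of i] H by (auto simp: q_def axis_def)
  have qk: "q $ k = p $ k + H" by (simp add: q_def)
  have \<kappa>: "0 \<le> \<kappa>" using pos by (simp add: \<kappa>_def)
  have C: "\<sigma> * sqrt h / d \<le> \<kappa> * b"
    using hH pos by (simp add: \<kappa>_def b_def divide_right_mono mult_left_mono)
  have smooth': "smooth_along \<Lambda> k g" using smooth by (simp add: g_def q_def H_def)
  have "H * (m $ k + 0) + g (m + 0 *\<^sub>R ?e)
      + \<sigma>\<^sup>2 * (1 / (q $ k - H) - 1 / q $ k) * (second_diff g (b *\<^sub>R ?e) m / b\<^sup>2) / 2
      - \<Lambda> * (\<sigma>\<^sup>2 * (1 / (q $ k - H) - 1 / q $ k)) * (2 * b + \<kappa> * b + (0\<^sup>2 + \<sigma>\<^sup>2 * (1 / (q $ k - H) - 1 / q $ k)) / b) / 2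
     \<le> u (j + N) (m + 0 *\<^sub>R ?e) (q - H *\<^sub>R ?e)"
    unfolding H_def g_def
    by (rule superscheme_block[OF super _ pos(1) b(1) pos(2,3,4) qpos _ C order_refl])
      (use smooth' p[of k] in \<open>simp_all add: g_def qk H_def\<close>)
  \<comment> \<open>The variances of the short steps telescope to the variance of the long
    one.\<close>
  moreover have "\<sigma>\<^sup>2 * (1 / (q $ k - H) - 1 / q $ k) = c\<^sup>2"
    using H ppos[of k] by (simp add: qk c_def step_size_power2 field_simps)
  ultimately have 1: "H * m $ k + g m + c\<^sup>2 * D / 2 - \<Lambda> * c\<^sup>2 * (2 * b + \<kappa> * b + c\<^sup>2 / b) / 2 \<le> u (j + N) m p"
    by (simp add: D_def q_def)
  have c0: "0 \<le> c" using pos H ppos by (simp add: c_def)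
  have cb: "c \<le> \<kappa> * b"
    using step_size_le[of \<sigma> H d "p $ k"] pos H p[of k] by (simp add: c_def \<kappa>_def b_def)
  have "c\<^sup>2 \<le> (\<kappa> * b)\<^sup>2" using c0 cb by (rule power_mono[rotated])
  then have c2: "c\<^sup>2 \<le> \<kappa>\<^sup>2 * H" using b(2) by (simp add: power_mult_distrib)
  have c2b: "c\<^sup>2 / b \<le> \<kappa>\<^sup>2 * b"
    using c2 b by (simp add: pos_divide_le_eq power2_eq_square mult.assoc)
  have 2: "second_diff g (c *\<^sub>R ?e) m \<le> c\<^sup>2 * D + \<Lambda> * c\<^sup>2 * (c + b)"
    using second_diff_ge(2)[OF smooth' c0 b(1), of m 0] by (simp add: D_def)
  have 3: "\<Lambda> * c\<^sup>2 * (c + b) + \<Lambda> * c\<^sup>2 * (2 * b + \<kappa> * b + c\<^sup>2 / b) \<le> \<Lambda> * \<kappa>\<^sup>2 * (\<kappa>\<^sup>2 + 2 * \<kappa> + 3) * H * b"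
  proof -
    have "\<Lambda> * c\<^sup>2 * (c + b) + \<Lambda> * c\<^sup>2 * (2 * b + \<kappa> * b + c\<^sup>2 / b) = \<Lambda> * (c\<^sup>2 * (c + b + (2 * b + \<kappa> * b + c\<^sup>2 / b)))"
      by (simp add: algebra_simps)
    also have "\<dots> \<le> \<Lambda> * ((\<kappa>\<^sup>2 * H) * (\<kappa> * b + b + (2 * b + \<kappa> * b + \<kappa>\<^sup>2 * b)))"
      using c2 c2b cb c0 b(1) \<kappa> pos H by (intro mult_left_mono mult_mono add_mono) auto
    also have "\<dots> = \<Lambda> * \<kappa>\<^sup>2 * (\<kappa>\<^sup>2 + 2 * \<kappa> + 3) * H * b" by (simp add: algebra_simps)
    finally show ?thesis .
  qed
  have "H * m $ k + (g (m + c *\<^sub>R ?e) + g (m - c *\<^sub>R ?e)) / 2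
      = H * m $ k + g m + second_diff g (c *\<^sub>R ?e) m / 2"
    by (simp add: second_diff_def field_simps)
  also have "\<dots> \<le> u (j + N) m p + \<Lambda> * \<kappa>\<^sup>2 * (\<kappa>\<^sup>2 + 2 * \<kappa> + 3) * H * b / 2"
  proof -
    have combine: "a + g0 + s / 2 \<le> v + K / 2"
      if "a + g0 + cD / 2 - e1 / 2 \<le> v" "s \<le> cD + e2" "e2 + e1 \<le> K" for a g0 s v K cD e1 e2 :: real
      using that by linarith
    show ?thesis using 1 2 3 by (rule combine)
  qed
  finally show ?thesis by (simp add: g_def q_def c_def b_def)
qed

text \<open>Holding the chosen arm during \<open>N\<close> short rounds reproduces a coarse round up
  to the error of one block. The errors add up over \<open>j\<close> blocks, because a constant
  passes through averages and maxima.\<close>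

lemma walk_value_le_mollify:
  fixes p m :: "real^'k::finite" and \<sigma> :: real
  assumes pos: "0 < \<epsilon>" "0 < h" "0 \<le> \<sigma>" "0 < d" "0 < N" "set ks = UNIV"
    and "\<And>i. d \<le> p $ i" and "real J * (real N * h) \<le> T"
  defines "H \<equiv> real N * h" and "\<kappa> \<equiv> \<sigma> / d"
  assumes "j \<le> J"
  shows "walk_value \<sigma> H j m p \<le> mollify \<epsilon> ks (\<lambda>m. walk_value \<sigma> h (j * N) m p) m
    + real j * (T / \<epsilon>\<^sup>2 * \<kappa>\<^sup>2 * (\<kappa>\<^sup>2 + 2 * \<kappa> + 3) / 2 * H * sqrt H)"
  using assms(7) \<open>j \<le> J\<close>
proof (induction j arbitrary: m p)
  case 0
  \<comment> \<open>The zero function is Lipschitz with constant 0, so mollification moves it by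
    0.\<close>
  have z: "mollify \<epsilon> ks (\<lambda>m. 0) m = 0"
    using mollify_close[of 0 "\<lambda>m. 0::real" \<epsilon> ks m] pos by (simp add: lipschitz_on_def)
  then show ?case by simp
next
  case (Suc j)
  let ?u = "\<lambda>j m p. mollify \<epsilon> ks (\<lambda>m. walk_value \<sigma> h j m p) m"
  define E where "E = T / \<epsilon>\<^sup>2 * \<kappa>\<^sup>2 * (\<kappa>\<^sup>2 + 2 * \<kappa> + 3) / 2 * H * sqrt H"
  have H: "0 < H" using pos by (simp add: H_def)
  have T: "0 \<le> T" using assms(8) pos by (meson mult_nonneg_nonneg of_nat_0_le_iff less_imp_le order_trans)
  show ?case unfolding E_def[symmetric]
  proof (rule walk_value_Suc_le)
    fix k
    let ?c = "step_size \<sigma> H (p $ k)" and ?p = "p + H *\<^sub>R axis k 1"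
    have p: "d \<le> ?p $ i" for i
      using Suc.prems(1)[of i] H by (auto simp: axis_def)
    have IH: "walk_value \<sigma> H j m' ?p \<le> ?u (j * N) m' ?p + real j * E" for m'
      using Suc.IH[OF p, of m'] Suc.prems by (simp add: E_def)
    \<comment> \<open>The Lipschitz constant of the fine value is its remaining time, at most
      \<open>T\<close>; this is the \<open>T\<close> in the smoothness constant
      \<open>T / \<epsilon>\<^sup>2\<close>.\<close>
    have T': "real (j * N) * h \<le> T"
    proof -
      have "real (j * N) * h = real j * (real N * h)" by simp
      also have "\<dots> \<le> real J * (real N * h)" using Suc.prems pos by (intro mult_right_mono) auto
      finally show ?thesis using assms(8) by simp
    qed
    have lip: "T-lipschitz_on UNIV (\<lambda>m. walk_value \<sigma> h (j * N) m ?p)"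
      by (rule lipschitz_on_le[OF walk_value_lipschitz_on T']) (use pos in simp)
    have "H * m $ k + (?u (j * N) (m + ?c *\<^sub>R axis k 1) ?p + ?u (j * N) (m - ?c *\<^sub>R axis k 1) ?p) / 2
        \<le> ?u (j * N + N) m p + E"
      unfolding H_def E_def \<kappa>_def
      by (rule superscheme_block_arm[OF superscheme_mollify _ _ pos(2-5) Suc.prems(1)])
        (use pos T mollify_smooth_along[OF lip pos(1), of k ks] in \<open>simp_all add: H_def\<close>)
    moreover have "H * m $ k + (walk_value \<sigma> H j (m + ?c *\<^sub>R axis k 1) ?p + walk_value \<sigma> H j (m - ?c *\<^sub>R axis k 1) ?p) / 2
        \<le> H * m $ k + ((?u (j * N) (m + ?c *\<^sub>R axis k 1) ?p + real j * E) + (?u (j * N) (m - ?c *\<^sub>R axis k 1) ?p + real j * E)) / 2"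
      by (intro arm_le order_refl IH)
    ultimately show "H * m $ k + (walk_value \<sigma> H j (m + ?c *\<^sub>R axis k 1) ?p + walk_value \<sigma> H j (m - ?c *\<^sub>R axis k 1) ?p) / 2
        \<le> ?u (Suc j * N) m p + real (Suc j) * E"
      by (simp add: algebra_simps add_divide_distrib)
  qed
qed

text \<open>There are at most \<open>T / H\<close> blocks, so the total error has order \<epsilon> +
  sqrt H / \<epsilon>^2: \<epsilon> is to be fixed before \<open>H\<close> becomes small.\<close>

lemma walk_value_refine:
  fixes p m :: "real^'k::finite" and \<sigma> :: real
  assumes pos: "0 < \<epsilon>" "0 < h" "0 \<le> \<sigma>" "0 < d" "0 < N"
    and p: "\<And>i. d \<le> p $ i" and T: "real j * (real N * h) \<le> T"
  defines "H \<equiv> real N * h" and "\<kappa> \<equiv> \<sigma> / d"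
  shows "walk_value \<sigma> H j m p \<le> walk_value \<sigma> h (j * N) m p + 2 * T * \<epsilon> * real CARD('k)
    + T * (T / \<epsilon>\<^sup>2 * \<kappa>\<^sup>2 * (\<kappa>\<^sup>2 + 2 * \<kappa> + 3) / 2 * sqrt H)"
proof -
  obtain ks :: "'k list" where ks: "set ks = UNIV" "distinct ks"
    using finite_distinct_list[of "UNIV::'k set"] by auto
  have len: "length ks = CARD('k)" using distinct_card[OF ks(2)] ks(1) by simp
  have H: "0 < H" using pos by (simp add: H_def)
  have T0: "0 \<le> T" using T pos by (meson mult_nonneg_nonneg of_nat_0_le_iff less_imp_le order_trans)
  have lip: "T-lipschitz_on UNIV (\<lambda>m. walk_value \<sigma> h (j * N) m p)"
    by (rule lipschitz_on_le[OF walk_value_lipschitz_on]) (use pos T in \<open>simp_all add: mult_ac\<close>)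
  define E where "E = T / \<epsilon>\<^sup>2 * \<kappa>\<^sup>2 * (\<kappa>\<^sup>2 + 2 * \<kappa> + 3) / 2 * sqrt H"
  have "0 \<le> \<kappa>" using pos by (simp add: \<kappa>_def)
  then have "0 \<le> E" using T0 H by (simp add: E_def)
  have "walk_value \<sigma> H j m p \<le> mollify \<epsilon> ks (\<lambda>m. walk_value \<sigma> h (j * N) m p) m + real j * (E * H)"
    using walk_value_le_mollify[OF pos ks(1) p T order_refl, of m] by (simp add: H_def \<kappa>_def E_def mult_ac)
  moreover have "real j * (E * H) \<le> T * E"
    using mult_right_mono[OF T \<open>0 \<le> E\<close>] by (simp add: H_def mult_ac)
  moreover have "mollify \<epsilon> ks (\<lambda>m. walk_value \<sigma> h (j * N) m p) m \<le> walk_value \<sigma> h (j * N) m p + 2 * T * \<epsilon> * real CARD('k)"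
    using mollify_close[OF lip pos(1), of ks m] by (simp add: len)
  ultimately show ?thesis by (simp add: E_def)
qed

section \<open>Convergence along all step sizes\<close>

text \<open>The limit is the supremum of the eventual lower bounds, that is, the lower limit. Almost
  monotonicity makes \<open>x m - \<eta>\<close> such a bound for all large \<open>m\<close>, so no
  later term exceeds the lower limit by much.\<close>

lemma almost_increasing_convergent:
  fixes x :: "nat \<Rightarrow> real"
  assumes bound: "\<And>n. \<bar>x n\<bar> \<le> C"
    and incr: "\<And>\<eta>. 0 < \<eta> \<Longrightarrow> \<forall>\<^sub>F m in sequentially. \<forall>\<^sub>F n in sequentially. x m \<le> x n + \<eta>"
  shows "convergent x"
proof -
  define S where "S = {y. \<forall>\<^sub>F n in sequentially. y \<le> x n}"
  have "- C \<le> x n" for n using bound[of n] by linarith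
  then have "- C \<in> S" unfolding S_def mem_Collect_eq by (intro always_eventually allI)
  then have ne: "S \<noteq> {}" by blast
  have "y \<le> C" if S: "y \<in> S" for y
  proof -
    obtain n where "\<forall>i\<ge>n. y \<le> x i" using S unfolding S_def eventually_sequentially mem_Collect_eq by blast
    then have "y \<le> x n" by simp
    then show ?thesis using bound[of n] by linarith
  qed
  then have bdd: "bdd_above S" by (rule bdd_aboveI)
  have "x \<longlonglongrightarrow> Sup S"
  proof (rule order_tendstoI)
    fix a assume "a < Sup S"
    then obtain y where y: "y \<in> S" "a < y" using less_cSupE[OF _ ne] by blast
    then have "\<forall>\<^sub>F n in sequentially. y \<le> x n" by (simp add: S_def)
    then show "\<forall>\<^sub>F n in sequentially. a < x n"
      by (rule eventually_mono) (use y(2) in linarith)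
  next
    fix a assume a: "Sup S < a"
    define \<eta> where "\<eta> = (a - Sup S) / 2"
    have "0 < \<eta>" using a by (simp add: \<eta>_def)
    from incr[OF this] show "\<forall>\<^sub>F n in sequentially. x n < a"
    proof eventually_elim
      case (elim m)
      then have "\<forall>\<^sub>F n in sequentially. x m - \<eta> \<le> x n"
        by (rule eventually_mono) linarith
      then have "x m - \<eta> \<in> S" by (simp add: S_def)
      then have "x m - \<eta> \<le> Sup S" by (rule cSup_upper[OF _ bdd])
      moreover have "Sup S + \<eta> < a" using a unfolding \<eta>_def by argo
      ultimately show "x m < a" by linarith
    qed
  qed
  then show ?thesis by (rule convergentI)
qed

lemma positive_vector_bounded_below:
  fixes p :: "real^'k::finite"
  assumes "\<And>k. 0 < p $ k"
  obtains d where "0 < d" "\<And>k. d \<le> p $ k"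
proof
  show "0 < Min (range (($) p))" using assms by (subst Min_gr_iff) auto
  show "Min (range (($) p)) \<le> p $ k" for k by (rule Min_le) auto
qed

lemma tendsto_div_over:
  assumes "0 < n0"
  shows "(\<lambda>n. real (n div n0) / real n) \<longlonglongrightarrow> 1 / real n0"
proof -
  have "(\<lambda>n. real (n div n0) / real n - 1 / real n0) \<longlonglongrightarrow> 0"
  proof (rule Lim_null_comparison)
    show "\<forall>\<^sub>F n in sequentially. norm (real (n div n0) / real n - 1 / real n0) \<le> 1 / real n"
      using eventually_gt_at_top[of 0]
    proof eventually_elim
      case (elim n)
      have "real n = real n0 * real (n div n0) + real (n mod n0)"
        by (metis mult_div_mod_eq of_nat_add of_nat_mult)
      then have "real (n div n0) / real n - 1 / real n0 = - (real (n mod n0) / real n0) / real n"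
        using assms elim by (simp add: field_simps)
      moreover have "real (n mod n0) / real n0 / real n \<le> 1 / real n"
        using assms by (intro divide_right_mono) (simp_all add: less_imp_le)
      ultimately show ?case by simp
    qed
    show "(\<lambda>n. 1 / real n) \<longlonglongrightarrow> 0" by (rule lim_1_over_n)
  qed
  then show ?thesis by (rule LIM_zero_cancel)
qed

text \<open>A coarse round of length \<open>1 / n0\<close> is cut into \<open>n div n0\<close>
  rounds of length \<open>1 / n\<close>. As \<open>n0\<close> need not divide \<open>n\<close>,
  three errors arise: from refining, from the slightly shorter coarse step and from the rounds left
  over at the end. The mollification, the part vanishing with \<open>n0\<close>, and two parts
  vanishing with \<open>n\<close> receive \<open>\<eta> / 4\<close> each.\<close>

lemma walk_value_almost_increasing:
  fixes m p :: "real^'k::finite"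
  assumes r: "0 \<le> r" and \<sigma>: "0 \<le> \<sigma>" and p: "\<And>k. 0 < p $ k" and \<eta>: "0 < \<eta>"
  defines "x \<equiv> \<lambda>n::nat. walk_value \<sigma> (1 / real n) (nat \<lfloor>r * real n\<rfloor>) m p"
  shows "\<forall>\<^sub>F n0 in sequentially. \<forall>\<^sub>F n in sequentially. x n0 \<le> x n + \<eta>"
proof -
  obtain d where d: "0 < d" "\<And>k. d \<le> p $ k" using positive_vector_bounded_below[OF p] by blast
  define K where "K = real CARD('k)"
  \<comment> \<open>Makes the mollification cost \<open>2 * r * \<epsilon> * K\<close> at most
    \<open>\<eta> / 4\<close>; the summand 1 covers \<open>r = 0\<close>.\<close>
  define \<epsilon> where "\<epsilon> = \<eta> / (4 * (2 * r * K + 1))"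
  have K: "0 \<le> 2 * r * K" using r by (simp add: K_def)
  have \<epsilon>: "0 < \<epsilon>" unfolding \<epsilon>_def using \<eta> K by (intro divide_pos_pos mult_pos_pos add_nonneg_pos) auto
  have "2 * r * K * \<epsilon> \<le> (2 * r * K + 1) * \<epsilon>" using \<epsilon> by (intro mult_right_mono) auto
  also have "\<dots> = \<eta> / 4"
  proof -
    have "A * (\<eta> / (4 * A)) = \<eta> / 4" if "0 < A" for A :: real using that by simp
    then show ?thesis unfolding \<epsilon>_def using K by (simp only: add_nonneg_pos zero_less_one)
  qed
  finally have \<epsilon>4: "2 * r * \<epsilon> * K \<le> \<eta> / 4" by (simp add: mult_ac)
  define \<kappa> where "\<kappa> = \<sigma> / d"
  define D where "D = r * (r / \<epsilon>\<^sup>2 * \<kappa>\<^sup>2 * (\<kappa>\<^sup>2 + 2 * \<kappa> + 3) / 2)"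
  have \<kappa>: "0 \<le> \<kappa>" using \<sigma> d by (simp add: \<kappa>_def)
  have D: "0 \<le> D" using r \<kappa> by (simp add: D_def)
  define B where "B = 1 + (norm m)\<^sup>2 + r * \<sigma>\<^sup>2 / d\<^sup>2"
  have B: "0 \<le> B" using r by (simp add: B_def)
  have "(\<lambda>n. D * sqrt (1 / real n) + B * (1 / real n)) \<longlonglongrightarrow> D * sqrt 0 + B * 0"
    by (intro tendsto_intros lim_1_over_n)
  then have "\<forall>\<^sub>F n0 in sequentially. D * sqrt (1 / real n0) + B * (1 / real n0) < \<eta> / 4"
    using \<eta> by (intro order_tendstoD(2)) auto
  then show ?thesis using eventually_gt_at_top[of 0]
  proof eventually_elim
    case (elim n0)
    note n0 = elim(2)
    define J where "J = nat \<lfloor>r * real n0\<rfloor>"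
    have x_n0: "x n0 = walk_value \<sigma> (1 / real n0) J m p" by (simp add: x_def J_def)
    have J: "real J \<le> r * real n0" "r * real n0 - 1 \<le> real J"
      using r by (simp_all add: J_def)
    \<comment> \<open>\<open>n0\<close> and hence \<open>J\<close> are fixed while \<open>n\<close>
      grows, so the coarse step \<open>(n div n0) / n\<close> may be replaced by
      \<open>1 / n0\<close>.\<close>
    have "(\<lambda>n. walk_value \<sigma> (real (n div n0) / real n) J m p) \<longlonglongrightarrow> walk_value \<sigma> (1 / real n0) J m p"
      by (intro tendsto_walk_value tendsto_div_over tendsto_const n0 p) auto
    then have "\<forall>\<^sub>F n in sequentially. walk_value \<sigma> (1 / real n0) J m p - \<eta> / 4 < walk_value \<sigma> (real (n div n0) / real n) J m p"
      using \<eta> by (intro order_tendstoD(1)) auto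
    moreover have "(\<lambda>n. r * real n0 * B * (1 / real n)) \<longlonglongrightarrow> r * real n0 * B * 0"
      by (intro tendsto_intros lim_1_over_n)
    then have "\<forall>\<^sub>F n in sequentially. r * real n0 * B * (1 / real n) < \<eta> / 4"
      using \<eta> by (intro order_tendstoD(2)) auto
    ultimately show ?case using eventually_ge_at_top[of n0]
    proof eventually_elim
      case (elim n)
      define N where "N = n div n0"
      have n: "0 < n" using elim n0 by simp
      have N: "0 < N" using elim n0 by (simp add: N_def div_greater_zero_iff)
      have Nn0: "real N * real n0 \<le> real n" "real n - real n0 \<le> real N * real n0"
      proof -
        have "real n = real n0 * real N + real (n mod n0)"
          unfolding N_def by (metis mult_div_mod_eq of_nat_add of_nat_mult)
        moreover have "real (n mod n0) \<le> real n0" using n0 by (simp add: less_imp_le)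
        ultimately show "real N * real n0 \<le> real n" "real n - real n0 \<le> real N * real n0"
          by (simp_all add: mult.commute)
      qed
      have H: "real N * (1 / real n) \<le> 1 / real n0"
        using Nn0(1) n n0 by (simp add: field_simps)
      have JN: "real J * real N \<le> r * real n"
      proof -
        have "real J * real N \<le> (r * real n0) * real N" using J(1) by (rule mult_right_mono) simp
        also have "\<dots> = r * (real N * real n0)" by (simp add: mult_ac)
        also have "\<dots> \<le> r * real n" using Nn0(1) r by (rule mult_left_mono)
        finally show ?thesis .
      qed
      have "walk_value \<sigma> (real N * (1 / real n)) J m p \<le> walk_value \<sigma> (1 / real n) (J * N) m p
          + 2 * r * \<epsilon> * K + r * (r / \<epsilon>\<^sup>2 * \<kappa>\<^sup>2 * (\<kappa>\<^sup>2 + 2 * \<kappa> + 3) / 2 * sqrt (real N * (1 / real n)))"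
        unfolding \<kappa>_def K_def
        by (rule walk_value_refine) (use \<epsilon> n \<sigma> d N JN in \<open>simp_all add: divide_simps\<close>)
      also have "r * (r / \<epsilon>\<^sup>2 * \<kappa>\<^sup>2 * (\<kappa>\<^sup>2 + 2 * \<kappa> + 3) / 2 * sqrt (real N * (1 / real n))) = D * sqrt (real N * (1 / real n))"
        by (simp add: D_def)
      also have "\<dots> \<le> D * sqrt (1 / real n0)" using H D by (intro mult_left_mono real_sqrt_le_mono)
      finally have 1: "walk_value \<sigma> (real N / real n) J m p \<le> walk_value \<sigma> (1 / real n) (J * N) m p
          + 2 * r * \<epsilon> * K + D * sqrt (1 / real n0)" by simp
      define I where "I = nat \<lfloor>r * real n\<rfloor>"
      have I: "real I \<le> r * real n" using r by (simp add: I_def)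
      have JI: "J * N \<le> I" using JN by (simp add: I_def le_nat_floor)
      \<comment> \<open>The \<open>J * N\<close> refined rounds stop short of the horizon. The
        missing time is at most \<open>r * n0 / n + 1 / n0\<close>, from the remainder of the
        division and from rounding \<open>r * n0\<close> down.\<close>
      have "\<bar>walk_value \<sigma> (1 / real n) I m p - walk_value \<sigma> (1 / real n) (J * N) m p\<bar>
         \<le> real (I - J * N) * (1 / real n) * (1 + (norm m)\<^sup>2 + real I * (1 / real n) * \<sigma>\<^sup>2 / d\<^sup>2)"
        by (rule walk_value_time_le) (use \<sigma> d JI in auto)
      also have "\<dots> \<le> (r * real n0 * (1 / real n) + 1 / real n0) * B"
      proof (rule mult_mono)
        have "r * real n - real J * real N \<le> r * real n0 + real N"
        proof -
          have "(r * real n0 - 1) * real N \<le> real J * real N" using J(2) by (rule mult_right_mono) simp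
          moreover have "r * (real n - real n0) \<le> r * (real N * real n0)" using Nn0(2) r by (rule mult_left_mono)
          ultimately show ?thesis by (simp add: algebra_simps)
        qed
        then have "real (I - J * N) \<le> r * real n0 + real N" using I JI by (simp add: of_nat_diff)
        then have "real (I - J * N) * (1 / real n) \<le> (r * real n0 + real N) * (1 / real n)"
          by (rule mult_right_mono) simp
        also have "\<dots> \<le> r * real n0 * (1 / real n) + 1 / real n0"
          using H by (simp add: add_divide_distrib)
        finally show "real (I - J * N) * (1 / real n) \<le> r * real n0 * (1 / real n) + 1 / real n0" .
        have "real I * (1 / real n) \<le> r" using I n by (simp add: divide_simps)
        then show "1 + (norm m)\<^sup>2 + real I * (1 / real n) * \<sigma>\<^sup>2 / d\<^sup>2 \<le> B"
          unfolding B_def by (intro add_left_mono divide_right_mono mult_right_mono) auto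
      qed (use r in auto)
      also have "\<dots> = r * real n0 * B * (1 / real n) + B * (1 / real n0)" by (simp add: algebra_simps)
      finally have "walk_value \<sigma> (1 / real n) (J * N) m p \<le> x n + (r * real n0 * B * (1 / real n) + B * (1 / real n0))"
        unfolding x_def I_def by linarith
      then show "x n0 \<le> x n + \<eta>"
        using 1 \<epsilon>4 elim(1,2) \<open>D * sqrt (1 / real n0) + B * (1 / real n0) < \<eta> / 4\<close>
        unfolding N_def[symmetric] x_n0 by linarith
    qed
  qed
qed

section \<open>The limit value\<close>

text \<open>The horizon \<open>r\<close> is rounded down to whole rounds of length
  \<open>1 / n\<close>. For \<open>r = 0\<close> the sequence is constantly 0 whatever
  \<open>p\<close> is, which yields the terminal condition.\<close>

definition lim_value :: "real \<Rightarrow> real \<Rightarrow> real^'k::finite \<Rightarrow> real^'k \<Rightarrow> real" where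
  "lim_value \<sigma> r m p = lim (\<lambda>n. walk_value \<sigma> (1 / real n) (nat \<lfloor>r * real n\<rfloor>) m p)"

lemma walk_value_abs_le':
  assumes "0 \<le> \<sigma>" "0 \<le> h" "0 < d" "\<And>k. d \<le> p $ k" "real j * h \<le> T"
  shows "\<bar>walk_value \<sigma> h j m p\<bar> \<le> T * (1 + (norm m)\<^sup>2 + T * \<sigma>\<^sup>2 / d\<^sup>2)"
proof -
  have "0 \<le> real j * h" using assms by simp
  then have "0 \<le> T" using assms(5) by linarith
  have "real j * h * (1 + (norm m)\<^sup>2 + real j * h * \<sigma>\<^sup>2 / d\<^sup>2) \<le> T * (1 + (norm m)\<^sup>2 + T * \<sigma>\<^sup>2 / d\<^sup>2)"
    using assms \<open>0 \<le> T\<close> by (intro mult_mono add_left_mono divide_right_mono mult_right_mono) auto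
  then show ?thesis using walk_value_abs_le[OF assms(1-4), of j m] by linarith
qed

lemma floor_mult_over_le: "0 \<le> r \<Longrightarrow> real (nat \<lfloor>r * real n\<rfloor>) * (1 / real n) \<le> r"
  by (cases "n = 0") (auto simp: divide_simps)

lemma lim_value_LIMSEQ:
  fixes m p :: "real^'k::finite"
  assumes "0 \<le> r" "0 \<le> \<sigma>" "\<And>k. 0 < p $ k"
  shows "(\<lambda>n. walk_value \<sigma> (1 / real n) (nat \<lfloor>r * real n\<rfloor>) m p) \<longlonglongrightarrow> lim_value \<sigma> r m p"
proof -
  obtain d where d: "0 < d" "\<And>k. d \<le> p $ k" using positive_vector_bounded_below[OF assms(3)] by blast
  have "convergent (\<lambda>n. walk_value \<sigma> (1 / real n) (nat \<lfloor>r * real n\<rfloor>) m p)"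
  proof (rule almost_increasing_convergent)
    show "\<bar>walk_value \<sigma> (1 / real n) (nat \<lfloor>r * real n\<rfloor>) m p\<bar> \<le> r * (1 + (norm m)\<^sup>2 + r * \<sigma>\<^sup>2 / d\<^sup>2)" for n
      by (rule walk_value_abs_le') (use assms d floor_mult_over_le in auto)
  qed (rule walk_value_almost_increasing[OF assms])
  then show ?thesis unfolding lim_value_def by (simp add: convergent_LIMSEQ_iff)
qed

text \<open>By homogeneity, the value at \<open>l *\<^sub>R m\<close> is \<open>l\<close> times the
  value at \<open>m\<close> with volatility \<open>\<sigma> / l\<close>. This reduction of the
  volatility compensates for a precision smaller by a factor of at most \<open>l\<close>, and the
  Lipschitz bound leads back from \<open>l *\<^sub>R m\<close> to \<open>m\<close>.\<close>

lemma walk_value_precision_le: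
  fixes p p' :: "real^'k::finite"
  assumes "0 \<le> \<sigma>" "0 < h" "1 \<le> l"
    and "\<And>k. 0 < p $ k" "\<And>k. 0 < p' $ k" "\<And>k. p $ k \<le> l * p' $ k" "\<And>k. p' $ k \<le> l * p $ k"
  shows "\<bar>walk_value \<sigma> h j m p' - walk_value \<sigma> h j m p\<bar> \<le> (l - 1) * (\<bar>walk_value \<sigma> h j m p\<bar> + real j * h * norm m)"
proof -
  let ?w = "walk_value \<sigma> h j"
  have scale: "?w (l *\<^sub>R y) p1 \<le> l * ?w y p2"
    if "\<And>k. 0 < p1 $ k" "\<And>k. 0 < p2 $ k" "\<And>k. p2 $ k \<le> l * p1 $ k" for y and p1 p2 :: "real^'k"
  proof -
    have "walk_value (1 / l * \<sigma>) h j ((1 / l) *\<^sub>R (l *\<^sub>R y)) p1 \<le> ?w y p2"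
      using assms(3) by (simp, intro walk_value_mono[of _ _ l]) (use that assms in auto)
    then have "(1 / l) * ?w (l *\<^sub>R y) p1 \<le> ?w y p2"
      using walk_value_homogeneous[of "1 / l" \<sigma> h j "l *\<^sub>R y" p1] assms(3) by simp
    then show ?thesis using assms(3) by (simp add: field_simps)
  qed
  have lip: "?w m p1 \<le> ?w (l *\<^sub>R m) p1 + (l - 1) * (real j * h * norm m)" "?w (l *\<^sub>R m) p1 \<ge> ?w m p1 - (l - 1) * (real j * h * norm m)" for p1
  proof -
    have "norm (m - l *\<^sub>R m) = (l - 1) * norm m"
    proof -
      have "m - l *\<^sub>R m = (1 - l) *\<^sub>R m" by (simp add: algebra_simps)
      then show ?thesis using assms(3) by simp
    qed
    then show "?w m p1 \<le> ?w (l *\<^sub>R m) p1 + (l - 1) * (real j * h * norm m)"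
      using walk_value_lipschitz_le[of h \<sigma> j m p1 "l *\<^sub>R m"] assms(2) by (simp add: mult_ac)
    then show "?w (l *\<^sub>R m) p1 \<ge> ?w m p1 - (l - 1) * (real j * h * norm m)" by linarith
  qed
  have "(l - 1) * ?w m p \<le> (l - 1) * \<bar>?w m p\<bar>" using assms(3) by (intro mult_left_mono) auto
  moreover have "?w (l *\<^sub>R m) p' \<le> l * ?w m p" by (rule scale) (use assms in auto)
  ultimately have up: "?w m p' - ?w m p \<le> (l - 1) * (\<bar>?w m p\<bar> + real j * h * norm m)"
    using lip(1)[of p'] unfolding distrib_left left_diff_distrib by linarith
  have "- ((l - 1) * (\<bar>?w m p\<bar> + real j * h * norm m)) \<le> ?w m p' - ?w m p"
  proof -
    define X Y where "X = ?w m p' - ?w m p" and "Y = \<bar>?w m p\<bar> + real j * h * norm m"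
    have "?w m p - (l - 1) * (real j * h * norm m) \<le> l * ?w m p'"
    proof -
      have "?w (l *\<^sub>R m) p \<le> l * ?w m p'" by (rule scale) (use assms in auto)
      then show ?thesis using lip(2)[of p] by linarith
    qed
    then have "l * X \<ge> - ((l - 1) * ?w m p) - (l - 1) * (real j * h * norm m)"
      by (simp add: X_def algebra_simps)
    moreover have "(l - 1) * ?w m p \<le> (l - 1) * \<bar>?w m p\<bar>" using assms(3) by (intro mult_left_mono) auto
    ultimately have lX: "- ((l - 1) * Y) \<le> l * X" by (simp add: Y_def distrib_left)
    have Y: "0 \<le> (l - 1) * Y" using assms by (simp add: Y_def)
    show ?thesis
    proof (cases "X \<ge> 0")
      case True
      then show ?thesis using Y by (simp add: X_def Y_def)
    next
      case False
      then have "l * X \<le> 1 * X" using assms(3) by (intro mult_right_mono_neg) auto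
      then show ?thesis using lX by (simp add: X_def Y_def)
    qed
  qed
  then show ?thesis using up by linarith
qed

lemma tendsto_floor_mult_over:
  assumes "0 \<le> r"
  shows "(\<lambda>n. real (nat \<lfloor>r * real n\<rfloor>) / real n) \<longlonglongrightarrow> r"
proof (rule LIM_zero_cancel, rule Lim_null_comparison)
  show "\<forall>\<^sub>F n in sequentially. norm (real (nat \<lfloor>r * real n\<rfloor>) / real n - r) \<le> 1 / real n"
    using eventually_gt_at_top[of 0]
  proof eventually_elim
    case (elim n)
    have "real (nat \<lfloor>r * real n\<rfloor>) / real n - r = (of_int \<lfloor>r * real n\<rfloor> - r * real n) / real n"
      using elim assms by (simp add: field_simps)
    moreover have "\<bar>of_int \<lfloor>r * real n\<rfloor> - r * real n\<bar> \<le> 1" by linarith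
    ultimately show ?case using elim by (simp add: divide_right_mono)
  qed
qed (rule lim_1_over_n)

text \<open>The mean, the precision and the number of rounds are replaced by their limits one after
  the other, each at a cost uniform in the step. The filter is arbitrary because this is used along
  sequences of bandit states and along a product of \<open>sequentially\<close> with a neighbourhood
  filter.\<close>

lemma tendsto_lim_value:
  fixes m p :: "real^'k::finite" and N :: "'i \<Rightarrow> nat"
  assumes N: "filterlim N at_top F" and j: "((\<lambda>i. real (j i) / real (N i)) \<longlongrightarrow> r) F"
    and m: "(m' \<longlongrightarrow> m) F" and p: "(p' \<longlongrightarrow> p) F"
    and r: "0 \<le> r" and \<sigma>: "0 \<le> \<sigma>" and p0: "\<And>k. 0 < p $ k"
  shows "((\<lambda>i. walk_value \<sigma> (1 / real (N i)) (j i) (m' i) (p' i)) \<longlongrightarrow> lim_value \<sigma> r m p) F"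
proof -
  obtain d where d: "0 < d" "\<And>k. d \<le> p $ k" using positive_vector_bounded_below[OF p0] by blast
  define y where "y i = walk_value \<sigma> (1 / real (N i)) (nat \<lfloor>r * real (N i)\<rfloor>) m p" for i
  have y: "(y \<longlongrightarrow> lim_value \<sigma> r m p) F"
    unfolding y_def using filterlim_compose[OF lim_value_LIMSEQ[OF r \<sigma> p0] N] .
  \<comment> \<open>The largest ratio between the two precisions, in either direction and over all
    arms.\<close>
  define l where "l i = (MAX k\<in>UNIV. max (p' i $ k / p $ k) (p $ k / p' i $ k))" for i
  have "(l \<longlongrightarrow> (MAX k\<in>UNIV. max (p $ k / p $ k) (p $ k / p $ k))) F"
    unfolding l_def
    by (intro tendsto_max_arm tendsto_max tendsto_divide tendsto_vec_nth p tendsto_const) (use p0 in \<open>auto simp: less_le\<close>)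
  moreover have "(MAX k\<in>UNIV. max (p $ k / p $ k) (p $ k / p $ k)) = (1::real)"
  proof -
    have "p $ k / p $ k = 1" for k using p0[of k] by simp
    then show ?thesis by simp
  qed
  ultimately have l: "(l \<longlongrightarrow> 1) F" by simp
  define T where "T = r + 1"
  define B where "B = 1 + (norm m)\<^sup>2 + T * \<sigma>\<^sup>2 / d\<^sup>2"
  have T0: "0 \<le> T" using r by (simp add: T_def)
  have B0: "0 \<le> B" using T0 by (simp add: B_def)
  have evT: "\<forall>\<^sub>F i in F. real (j i) / real (N i) < T"
    using j by (rule order_tendstoD) (simp add: T_def)
  have evp: "\<forall>\<^sub>F i in F. \<forall>k. 0 < p' i $ k"
    by (intro eventually_all_finite order_tendstoD(1)[OF tendsto_vec_nth[OF p]] p0)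
  have evN: "\<forall>\<^sub>F i in F. 0 < N i"
    using N eventually_gt_at_top[of "0::nat"] unfolding filterlim_iff by auto
  have "((\<lambda>i. walk_value \<sigma> (1 / real (N i)) (j i) (m' i) (p' i) - y i) \<longlongrightarrow> 0) F"
  proof (rule Lim_null_comparison)
    show "\<forall>\<^sub>F i in F. norm (walk_value \<sigma> (1 / real (N i)) (j i) (m' i) (p' i) - y i)
      \<le> T * norm (m' i - m) + (l i - 1) * (T * B + T * norm m)
        + \<bar>real (j i) / real (N i) - real (nat \<lfloor>r * real (N i)\<rfloor>) / real (N i)\<bar> * B"
      using evT evp evN
    proof eventually_elim
      case (elim i)
      let ?h = "1 / real (N i)" and ?J = "nat \<lfloor>r * real (N i)\<rfloor>"
      have jT: "real (j i) * ?h \<le> T" using elim(1) by simp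
      have JT: "real ?J * ?h \<le> T" using floor_mult_over_le[OF r, of "N i"] by (simp add: T_def)
      have "\<bar>walk_value \<sigma> ?h (j i) (m' i) (p' i) - walk_value \<sigma> ?h (j i) m (p' i)\<bar> \<le> real (j i) * ?h * norm (m' i - m)"
        by (rule walk_value_lipschitz) simp
      also have "\<dots> \<le> T * norm (m' i - m)" using jT by (intro mult_right_mono) auto
      finally have 1: "\<bar>walk_value \<sigma> ?h (j i) (m' i) (p' i) - walk_value \<sigma> ?h (j i) m (p' i)\<bar> \<le> T * norm (m' i - m)" .
      have lk: "p' i $ k / p $ k \<le> l i" "p $ k / p' i $ k \<le> l i" for k
      proof -
        have "max (p' i $ k / p $ k) (p $ k / p' i $ k) \<le> l i" unfolding l_def by (rule max_arm_ge)
        then show "p' i $ k / p $ k \<le> l i" "p $ k / p' i $ k \<le> l i" by auto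
      qed
      \<comment> \<open>For any arm, a ratio and its inverse cannot both be below 1.\<close>
      have l1: "1 \<le> l i"
      proof (rule ccontr)
        fix k assume "\<not> 1 \<le> l i"
        then have "p' i $ k / p $ k < 1" "p $ k / p' i $ k < 1" using lk[of k] by linarith+
        then show False using p0[of k] elim(2) by (simp add: pos_divide_less_eq)
      qed
      have "\<bar>walk_value \<sigma> ?h (j i) m (p' i) - walk_value \<sigma> ?h (j i) m p\<bar>
          \<le> (l i - 1) * (\<bar>walk_value \<sigma> ?h (j i) m p\<bar> + real (j i) * ?h * norm m)"
        using lk elim p0
        by (intro walk_value_precision_le \<sigma> l1) (auto simp: pos_divide_le_eq)
      also have "\<dots> \<le> (l i - 1) * (T * B + T * norm m)"
        using l1 walk_value_abs_le'[OF \<sigma> _ d jT, of m] jT unfolding B_def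
        by (intro mult_left_mono add_mono mult_right_mono) auto
      finally have 2: "\<bar>walk_value \<sigma> ?h (j i) m (p' i) - walk_value \<sigma> ?h (j i) m p\<bar> \<le> (l i - 1) * (T * B + T * norm m)" .
      have time: "\<bar>walk_value \<sigma> ?h b m p - walk_value \<sigma> ?h a m p\<bar> \<le> \<bar>real b / real (N i) - real a / real (N i)\<bar> * B"
        if "a \<le> b" "real b * ?h \<le> T" for a b
      proof -
        have "\<bar>walk_value \<sigma> ?h b m p - walk_value \<sigma> ?h a m p\<bar> \<le> real (b - a) * ?h * (1 + (norm m)\<^sup>2 + real b * ?h * \<sigma>\<^sup>2 / d\<^sup>2)"
          by (rule walk_value_time_le) (use \<sigma> d that in auto)
        also have "\<dots> \<le> real (b - a) * ?h * B"
          unfolding B_def using that by (intro mult_left_mono add_left_mono divide_right_mono mult_right_mono) auto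
        also have "real (b - a) * ?h = \<bar>real b / real (N i) - real a / real (N i)\<bar>"
          using that by (simp add: of_nat_diff flip: diff_divide_distrib)
        finally show ?thesis .
      qed
      have 3: "\<bar>walk_value \<sigma> ?h (j i) m p - y i\<bar>
          \<le> \<bar>real (j i) / real (N i) - real (nat \<lfloor>r * real (N i)\<rfloor>) / real (N i)\<bar> * B"
      proof (cases "?J \<le> j i")
        case True
        then show ?thesis unfolding y_def using time jT by blast
      next
        case False
        then show ?thesis unfolding y_def using time[of "j i" ?J] JT by (simp add: abs_minus_commute)
      qed
      show ?case unfolding real_norm_def using 1 2 3 by linarith
    qed
    have "((\<lambda>i. T * norm (m' i - m) + (l i - 1) * (T * B + T * norm m)
        + \<bar>real (j i) / real (N i) - real (nat \<lfloor>r * real (N i)\<rfloor>) / real (N i)\<bar> * B)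
        \<longlongrightarrow> T * norm (m - m) + (1 - 1) * (T * B + T * norm m) + \<bar>r - r\<bar> * B) F"
      by (intro tendsto_intros m l j filterlim_compose[OF tendsto_floor_mult_over[OF r] N])
    then show "((\<lambda>i. T * norm (m' i - m) + (l i - 1) * (T * B + T * norm m)
        + \<bar>real (j i) / real (N i) - real (nat \<lfloor>r * real (N i)\<rfloor>) / real (N i)\<bar> * B) \<longlongrightarrow> 0) F"
      by simp
  qed
  from tendsto_add[OF this y] show ?thesis by simp
qed

section \<open>The posterior law of a reward\<close>

text \<open>The normalisation \<open>c\<close> is separate from the exponents: the first moment
  combines the exponents of \<open>a + 1\<close> with the constant of \<open>a\<close>.\<close>

lemma nn_integral_beta_density:
  assumes "0 < a" "0 < b" "0 < c"
  shows "(\<integral>\<^sup>+x. ennreal (indicator {0..1} x * (x powr (a - 1) * (1 - x) powr (b - 1) / c)) \<partial>lborel) = ennreal (Beta a b / c)"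
  by (rule nn_integral_has_integral_lebesgue)
    (use assms in \<open>auto intro!: has_integral_divide has_integral_Beta_real divide_nonneg_nonneg\<close>)

lemma Beta_real_pos: "0 < a \<Longrightarrow> 0 < b \<Longrightarrow> 0 < Beta a (b::real)"
  by (simp add: Beta_def)

lemma prob_space_beta_distr:
  assumes "0 < a" "0 < b"
  shows "prob_space (beta_distr a b)"
proof
  have "emeasure (beta_distr a b) (space (beta_distr a b))
     = (\<integral>\<^sup>+x. ennreal (indicator {0..1} x * (x powr (a - 1) * (1 - x) powr (b - 1) / Beta a b)) \<partial>lborel)"
    unfolding beta_distr_def by (subst emeasure_density) auto
  then show "emeasure (beta_distr a b) (space (beta_distr a b)) = 1"
    unfolding nn_integral_beta_density[OF assms Beta_real_pos[OF assms]]
    using Beta_real_pos[OF assms] by simp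
qed

lemma AE_beta_distr: "AE x in beta_distr a b. x \<in> {0..1}"
  unfolding beta_distr_def by (subst AE_density) (auto intro!: AE_I2 split: split_indicator_asm)

text \<open>Multiplication by \<open>x\<close> raises the first parameter by one, and the functional
  equation of the Beta function evaluates the quotient of the two constants.\<close>

lemma has_bochner_integral_beta_distr:
  assumes "0 < a" "0 < b"
  shows "has_bochner_integral (beta_distr a b) (\<lambda>x. x) (a / (a + b))"
proof (rule has_bochner_integral_nn_integral)
  show "(\<lambda>x. x) \<in> borel_measurable (beta_distr a b)" by (simp add: beta_distr_def)
  show "AE x in beta_distr a b. 0 \<le> x" using AE_beta_distr by eventually_elim auto
  have B: "0 < Beta a b" using Beta_real_pos[OF assms] .
  have "(\<integral>\<^sup>+x. ennreal x \<partial>beta_distr a b) =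
     (\<integral>\<^sup>+x. ennreal (indicator {0..1} x * (x powr (a + 1 - 1) * (1 - x) powr (b - 1) / Beta a b)) \<partial>lborel)"
    unfolding beta_distr_def
  proof (subst nn_integral_density; (intro nn_integral_cong)?)
    fix x :: real
    show "ennreal (indicator {0..1} x * (x powr (a - 1) * (1 - x) powr (b - 1) / Beta a b)) * ennreal x
       = ennreal (indicator {0..1} x * (x powr (a + 1 - 1) * (1 - x) powr (b - 1) / Beta a b))"
    \<comment> \<open>At \<open>x = 0\<close> both sides vanish because powers of 0 under
      \<open>powr\<close> are 0; outside the unit interval the indicator vanishes.\<close>
    proof (cases "0 < x \<and> x \<le> 1")
      case True
      then have "x powr a = x powr (a - 1) * x" by (simp add: powr_diff)
      then show ?thesis using True B
        by (simp add: mult_ac flip: ennreal_mult'')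
    qed (auto simp: not_less split: split_indicator)
  qed simp_all
  also have "\<dots> = ennreal (Beta (a + 1) b / Beta a b)"
    by (rule nn_integral_beta_density) (use assms B in auto)
  also have "Beta (a + 1) b / Beta a b = a / (a + b)"
  proof -
    have "(a + b) * Beta (a + 1) b = a * Beta a b"
      by (rule Beta_plus1_left) (use assms in \<open>auto elim!: nonpos_Ints_cases\<close>)
    then show ?thesis using assms B by (simp add: field_simps)
  qed
  finally show "(\<integral>\<^sup>+x. ennreal x \<partial>beta_distr a b) = ennreal (a / (a + b))" .
  show "0 \<le> a / (a + b)" using assms by simp
qed

text \<open>\<open>bernoulli_pmf\<close> clips its parameter to the unit interval. Keeping the
  clipping gives a formula on the whole line, continuous in \<open>p\<close> and hence measurable;
  under a Beta law it disappears almost everywhere.\<close>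

lemma expectation_bernoulli:
  fixes f :: "bool \<Rightarrow> real"
  shows "measure_pmf.expectation (bernoulli_pmf p) f = min 1 (max 0 p) * f True + (1 - min 1 (max 0 p)) * f False"
proof -
  have "pmf (bernoulli_pmf p) b = (if b then min 1 (max 0 p) else 1 - min 1 (max 0 p))" for b
    by (simp add: bernoulli_pmf.rep_eq)
  then show ?thesis by (subst integral_measure_pmf[of UNIV]) (auto simp: UNIV_bool)
qed

text \<open>The integrand depends on the environment only through \<open>\<nu> k\<close>, so the
  product measure reduces to one Beta marginal. On the unit interval it is affine in
  \<open>\<nu> k\<close>, so only the mean \<open>a k / (a k + b k)\<close> enters.\<close>

lemma integral_posterior_reward:
  fixes \<alpha> \<beta> s :: "real^'k::finite" and q :: "nat^'k" and g :: "real \<Rightarrow> real" and \<gamma> :: real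
  defines "a \<equiv> \<lambda>k. \<alpha> $ k + s $ k / (2 * \<gamma>) + real (q $ k) / 2"
    and "b \<equiv> \<lambda>k. \<beta> $ k - s $ k / (2 * \<gamma>) + real (q $ k) / 2"
  assumes pos: "\<And>k. 0 < a k" "\<And>k. 0 < b k"
  shows "(\<integral>\<nu>. measure_pmf.expectation (reward_law \<gamma> \<nu> k) g \<partial>posterior \<gamma> \<alpha> \<beta> s q)
    = a k / (a k + b k) * g \<gamma> + (1 - a k / (a k + b k)) * g (- \<gamma>)"
proof -
  define \<phi> where "\<phi> x = min 1 (max 0 x) * g \<gamma> + (1 - min 1 (max 0 x)) * g (- \<gamma>)" for x
  have prob: "prob_space (beta_distr (a i) (b i))" for i
    by (rule prob_space_beta_distr) (rule pos)+
  interpret prob_space "beta_distr (a k) (b k)" by (rule prob)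
  have post: "posterior \<gamma> \<alpha> \<beta> s q = (\<Pi>\<^sub>M k\<in>UNIV. beta_distr (a k) (b k))"
    by (simp add: posterior_def a_def b_def)
  have \<phi>: "\<phi> \<in> borel_measurable (beta_distr (a k) (b k))"
    unfolding \<phi>_def beta_distr_def by measurable
  have "(\<integral>\<nu>. measure_pmf.expectation (reward_law \<gamma> \<nu> k) g \<partial>posterior \<gamma> \<alpha> \<beta> s q)
     = (\<integral>\<nu>. \<phi> (\<nu> k) \<partial>(\<Pi>\<^sub>M k\<in>UNIV. beta_distr (a k) (b k)))"
    by (simp add: reward_law_def expectation_bernoulli \<phi>_def post)
  also have "\<dots> = (\<integral>x. \<phi> x \<partial>distr (\<Pi>\<^sub>M k\<in>UNIV. beta_distr (a k) (b k)) (beta_distr (a k) (b k)) (\<lambda>\<nu>. \<nu> k))"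
    by (rule integral_distr[symmetric]) (use \<phi> in simp_all)
  also have "\<dots> = (\<integral>x. \<phi> x \<partial>beta_distr (a k) (b k))"
    by (subst distr_PiM_component) (auto intro: prob)
  also have "\<dots> = (\<integral>x. x * (g \<gamma> - g (- \<gamma>)) + g (- \<gamma>) \<partial>beta_distr (a k) (b k))"
  proof (rule integral_cong_AE[OF \<phi>])
    show "AE x in beta_distr (a k) (b k). \<phi> x = x * (g \<gamma> - g (- \<gamma>)) + g (- \<gamma>)"
      using AE_beta_distr by eventually_elim (auto simp: \<phi>_def algebra_simps)
  qed (simp add: beta_distr_def)
  also have "\<dots> = a k / (a k + b k) * (g \<gamma> - g (- \<gamma>)) + g (- \<gamma>)"
    using has_bochner_integral_beta_distr[OF pos, of k]
    by (simp add: has_bochner_integral_iff prob_space)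
  also have "t * (x - y) + y = t * x + (1 - t) * y" for t x y :: real
    by (simp add: algebra_simps)
  finally show ?thesis .
qed

text \<open>If \<open>j\<close> of the \<open>q $ k\<close> pulls were successes, then the two
  parameters are \<open>\<alpha> $ k + j\<close> and \<open>\<beta> $ k + q $ k - j\<close>, the
  usual conjugate update.\<close>

lemma admissible_posterior_pos:
  fixes \<alpha> \<beta> s :: "real^'k::finite"
  assumes "0 < \<gamma>" "0 < \<alpha> $ k" "0 < \<beta> $ k" "admissible \<gamma> i s q"
  shows "0 < \<alpha> $ k + s $ k / (2 * \<gamma>) + real (q $ k) / 2" "0 < \<beta> $ k - s $ k / (2 * \<gamma>) + real (q $ k) / 2"
proof -
  obtain j where j: "j \<le> q $ k" "s $ k = - \<gamma> * real (q $ k) + 2 * \<gamma> * real j"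
    using assms(4) unfolding admissible_def by blast
  have eq: "s $ k / (2 * \<gamma>) = real j - real (q $ k) / 2"
    using assms(1) by (simp add: j(2) field_simps)
  show "0 < \<alpha> $ k + s $ k / (2 * \<gamma>) + real (q $ k) / 2" "0 < \<beta> $ k - s $ k / (2 * \<gamma>) + real (q $ k) / 2"
    unfolding eq using assms(2,3) j(1) by simp_all
qed

lemma admissible_step:
  fixes s :: "real^'k::finite"
  assumes "admissible \<gamma> i s q" "x = \<gamma> \<or> x = - \<gamma>"
  shows "admissible \<gamma> (Suc i) (s + x *\<^sub>R axis k 1) (q + axis k 1)"
  unfolding admissible_def
proof
  fix l
  obtain j where j: "q $ l < i" "j \<le> q $ l" "s $ l = - \<gamma> * real (q $ l) + 2 * \<gamma> * real j"
    using assms(1) unfolding admissible_def by blast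
  show "(q + axis k 1) $ l < Suc i \<and>
     (\<exists>j\<le>(q + axis k 1) $ l. (s + x *\<^sub>R axis k 1) $ l = - \<gamma> * real ((q + axis k 1) $ l) + 2 * \<gamma> * real j)"
  proof (cases "l = k")
    case False
    then show ?thesis using j by (auto simp: axis_def)
  next
    case True
    show ?thesis using assms(2)
    proof
      assume "x = \<gamma>"
      then show ?thesis using j True by (auto simp: algebra_simps intro!: exI[of _ "Suc j"])
    next
      assume "x = - \<gamma>"
      then show ?thesis using j True by (auto simp: algebra_simps intro!: exI[of _ j])
    qed
  qed
qed

text \<open>Given the state, a round has two outcomes, and averaging over the posterior replaces the
  unknown success probability by its posterior mean \<open>\<theta> k\<close>.\<close>

lemma opt_reward_Suc:
  fixes \<alpha> \<beta> s :: "real^'k::finite" and q :: "nat^'k" and \<gamma> :: real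
  assumes "i \<le> n" "0 < \<gamma>" "\<And>k. 0 < \<alpha> $ k" "\<And>k. 0 < \<beta> $ k" "admissible \<gamma> i s q"
  defines "\<theta> \<equiv> \<lambda>k. (\<alpha> $ k + s $ k / (2 * \<gamma>) + real (q $ k) / 2) / (\<alpha> $ k + \<beta> $ k + real (q $ k))"
  shows "opt_reward \<gamma> \<alpha> \<beta> n i s q = (MAX k\<in>UNIV.
    \<theta> k * (\<gamma> + opt_reward \<gamma> \<alpha> \<beta> n (Suc i) (s + \<gamma> *\<^sub>R axis k 1) (q + axis k 1))
    + (1 - \<theta> k) * (- \<gamma> + opt_reward \<gamma> \<alpha> \<beta> n (Suc i) (s - \<gamma> *\<^sub>R axis k 1) (q + axis k 1)))"
proof -
  note pos = admissible_posterior_pos[OF assms(2,3,4,5)]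
  have sum: "(\<alpha> $ k + s $ k / (2 * \<gamma>) + real (q $ k) / 2) + (\<beta> $ k - s $ k / (2 * \<gamma>) + real (q $ k) / 2)
     = \<alpha> $ k + \<beta> $ k + real (q $ k)" for k by (simp add: field_simps)
  have int: "(\<integral>\<nu>. measure_pmf.expectation (reward_law \<gamma> \<nu> k) g \<partial>posterior \<gamma> \<alpha> \<beta> s q)
    = \<theta> k * g \<gamma> + (1 - \<theta> k) * g (- \<gamma>)" for k g
    unfolding integral_posterior_reward[OF pos] \<theta>_def sum ..
  have "(\<integral>\<nu>. mean_reward \<gamma> \<nu> k \<partial>posterior \<gamma> \<alpha> \<beta> s q) +
          (\<integral>\<nu>. measure_pmf.expectation (reward_law \<gamma> \<nu> k)
                 (\<lambda>X. opt_reward \<gamma> \<alpha> \<beta> n (Suc i) (s + X *\<^sub>R axis k 1) (q + axis k 1)) \<partial>posterior \<gamma> \<alpha> \<beta> s q)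
    = \<theta> k * (\<gamma> + opt_reward \<gamma> \<alpha> \<beta> n (Suc i) (s + \<gamma> *\<^sub>R axis k 1) (q + axis k 1))
    + (1 - \<theta> k) * (- \<gamma> + opt_reward \<gamma> \<alpha> \<beta> n (Suc i) (s - \<gamma> *\<^sub>R axis k 1) (q + axis k 1))" for k
    unfolding mean_reward_def int by (simp add: algebra_simps)
  then show ?thesis using assms(1) by (subst opt_reward.simps) simp
qed

section \<open>Dependence on the volatility\<close>

lemma lim_value_homogeneous:
  fixes m p :: "real^'k::finite"
  assumes "0 \<le> r" "0 \<le> \<sigma>" "\<And>k. 0 < p $ k" "0 \<le> l"
  shows "lim_value (l * \<sigma>) r (l *\<^sub>R m) p = l * lim_value \<sigma> r m p"
proof (rule LIMSEQ_unique)
  show "(\<lambda>n. walk_value (l * \<sigma>) (1 / real n) (nat \<lfloor>r * real n\<rfloor>) (l *\<^sub>R m) p) \<longlonglongrightarrow> lim_value (l * \<sigma>) r (l *\<^sub>R m) p"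
    by (rule lim_value_LIMSEQ) (use assms in auto)
  show "(\<lambda>n. walk_value (l * \<sigma>) (1 / real n) (nat \<lfloor>r * real n\<rfloor>) (l *\<^sub>R m) p) \<longlonglongrightarrow> l * lim_value \<sigma> r m p"
    unfolding walk_value_homogeneous[OF assms(4)]
    by (intro tendsto_mult_left lim_value_LIMSEQ) (use assms in auto)
qed

lemma lim_value_lipschitz:
  fixes m m' p :: "real^'k::finite"
  assumes "0 \<le> r" "0 \<le> \<sigma>" "\<And>k. 0 < p $ k"
  shows "\<bar>lim_value \<sigma> r m p - lim_value \<sigma> r m' p\<bar> \<le> r * norm (m - m')"
proof (rule LIMSEQ_le_const2)
  show "(\<lambda>n. \<bar>walk_value \<sigma> (1 / real n) (nat \<lfloor>r * real n\<rfloor>) m p - walk_value \<sigma> (1 / real n) (nat \<lfloor>r * real n\<rfloor>) m' p\<bar>)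
    \<longlonglongrightarrow> \<bar>lim_value \<sigma> r m p - lim_value \<sigma> r m' p\<bar>"
    by (intro tendsto_rabs tendsto_diff lim_value_LIMSEQ) (use assms in auto)
  have "\<bar>walk_value \<sigma> (1 / real n) (nat \<lfloor>r * real n\<rfloor>) m p - walk_value \<sigma> (1 / real n) (nat \<lfloor>r * real n\<rfloor>) m' p\<bar>
    \<le> r * norm (m - m')" for n
    using walk_value_lipschitz[of "1 / real n" \<sigma> "nat \<lfloor>r * real n\<rfloor>" m p m']
      mult_right_mono[OF floor_mult_over_le[OF assms(1), of n], of "norm (m - m')"] by simp
  then show "\<exists>N. \<forall>n\<ge>N. \<bar>walk_value \<sigma> (1 / real n) (nat \<lfloor>r * real n\<rfloor>) m p - walk_value \<sigma> (1 / real n) (nat \<lfloor>r * real n\<rfloor>) m' p\<bar>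
    \<le> r * norm (m - m')" by blast
qed

lemma lim_value_ge:
  fixes m p :: "real^'k::finite"
  assumes "0 \<le> r" "0 \<le> \<sigma>" "\<And>k. 0 < p $ k"
  shows "r * m $ k \<le> lim_value \<sigma> r m p"
proof (rule LIMSEQ_le)
  show "(\<lambda>n. walk_value \<sigma> (1 / real n) (nat \<lfloor>r * real n\<rfloor>) m p) \<longlonglongrightarrow> lim_value \<sigma> r m p"
    by (rule lim_value_LIMSEQ) (use assms in auto)
  show "(\<lambda>n. real (nat \<lfloor>r * real n\<rfloor>) / real n * m $ k) \<longlonglongrightarrow> r * m $ k"
    by (intro tendsto_mult_right tendsto_floor_mult_over assms)
  have "real (nat \<lfloor>r * real n\<rfloor>) / real n * m $ k \<le> walk_value \<sigma> (1 / real n) (nat \<lfloor>r * real n\<rfloor>) m p" for n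
    using walk_value_ge[where h="1 / real n" and j="nat \<lfloor>r * real n\<rfloor>"] by simp
  then show "\<exists>N. \<forall>n\<ge>N. real (nat \<lfloor>r * real n\<rfloor>) / real n * m $ k \<le> walk_value \<sigma> (1 / real n) (nat \<lfloor>r * real n\<rfloor>) m p"
    by blast
qed

text \<open>Centring the growth bound at \<open>m\<close> itself leaves only the largest coordinate,
  linearly. This matters when \<open>m\<close> is divided by a small volatility.\<close>

lemma lim_value_le:
  fixes m p :: "real^'k::finite"
  assumes "0 \<le> r" "0 \<le> \<sigma>" "0 < d" "\<And>k. d \<le> p $ k" "\<And>k. m $ k \<le> x"
  shows "lim_value \<sigma> r m p \<le> r * (x + 1 + r * \<sigma>\<^sup>2 / d\<^sup>2)"
proof (rule LIMSEQ_le)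
  have "0 < p $ k" for k using assms(3) assms(4)[of k] by linarith
  then show "(\<lambda>n. walk_value \<sigma> (1 / real n) (nat \<lfloor>r * real n\<rfloor>) m p) \<longlonglongrightarrow> lim_value \<sigma> r m p"
    by (intro lim_value_LIMSEQ) (use assms in auto)
  let ?j = "\<lambda>n. real (nat \<lfloor>r * real n\<rfloor>) / real n"
  show "(\<lambda>n. ?j n * (x + 1 + ?j n * \<sigma>\<^sup>2 / d\<^sup>2)) \<longlonglongrightarrow> r * (x + 1 + r * \<sigma>\<^sup>2 / d\<^sup>2)"
    by (intro tendsto_intros tendsto_floor_mult_over assms) (use assms in auto)
  have "walk_value \<sigma> (1 / real n) (nat \<lfloor>r * real n\<rfloor>) m p \<le> ?j n * (x + 1 + ?j n * \<sigma>\<^sup>2 / d\<^sup>2)" for n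
    using walk_value_le[of \<sigma> "1 / real n" d p m x "nat \<lfloor>r * real n\<rfloor>" m] assms by simp
  then show "\<exists>N. \<forall>n\<ge>N. walk_value \<sigma> (1 / real n) (nat \<lfloor>r * real n\<rfloor>) m p \<le> ?j n * (x + 1 + ?j n * \<sigma>\<^sup>2 / d\<^sup>2)"
    by blast
qed

text \<open>The value for volatility \<open>l * \<sigma>\<close> at \<open>m\<close> is
  \<open>l\<close> times the value for \<sigma> at \<open>m\<close> divided by \<open>l\<close>, and
  the Lipschitz bound in \<open>m\<close> applies.\<close>

lemma tendsto_lim_value_scale:
  fixes m p :: "real^'k::finite"
  assumes "0 \<le> r" "0 \<le> \<sigma>" "\<And>k. 0 < p $ k"
  shows "((\<lambda>l. lim_value (l * \<sigma>) r m p) \<longlongrightarrow> lim_value \<sigma> r m p) (at 1)"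
proof -
  have "((\<lambda>l. lim_value \<sigma> r ((1 / l) *\<^sub>R m) p - lim_value \<sigma> r m p) \<longlongrightarrow> 0) (at 1)"
  proof (rule Lim_null_comparison)
    show "\<forall>\<^sub>F l in at 1. norm (lim_value \<sigma> r ((1 / l) *\<^sub>R m) p - lim_value \<sigma> r m p) \<le> r * norm ((1 / l) *\<^sub>R m - m)"
      using lim_value_lipschitz[OF assms] by (intro always_eventually) auto
    have "((\<lambda>l. r * norm ((1 / l) *\<^sub>R m - m)) \<longlongrightarrow> r * norm ((1 / 1) *\<^sub>R m - m)) (at 1)"
      by (intro tendsto_intros) auto
    then show "((\<lambda>l. r * norm ((1 / l) *\<^sub>R m - m)) \<longlongrightarrow> 0) (at 1)" by simp
  qed
  then have "((\<lambda>l. l * lim_value \<sigma> r ((1 / l) *\<^sub>R m) p) \<longlongrightarrow> 1 * lim_value \<sigma> r m p) (at 1)"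
    by (intro tendsto_mult tendsto_ident_at) (rule LIM_zero_cancel)
  moreover have "\<forall>\<^sub>F l in at 1. l * lim_value \<sigma> r ((1 / l) *\<^sub>R m) p = lim_value (l * \<sigma>) r m p"
  proof -
    have "\<forall>\<^sub>F l in at (1::real). 0 < l" by (rule order_tendstoD(1)[OF tendsto_ident_at]) simp
    then show ?thesis
    proof eventually_elim
      case (elim l)
      then show ?case using lim_value_homogeneous[OF assms, of l "(1 / l) *\<^sub>R m"] by simp
    qed
  qed
  ultimately show ?thesis using Lim_transform_eventually by fastforce
qed

text \<open>Scaling cannot enlarge \<sigma> = 0. In that case a small volatility \<open>s\<close> is
  scaled to 1, and the linear growth bound gives at most \<open>r * x + s * C\<close>, where
  \<open>r * x\<close> is the payoff of always pulling the best arm.\<close>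

lemma lim_value_upper_volatility:
  fixes m p :: "real^'k::finite"
  assumes "0 \<le> r" "0 \<le> \<sigma>" "\<And>k. 0 < p $ k" "lim_value \<sigma> r m p < y"
  shows "\<exists>\<sigma>'>\<sigma>. lim_value \<sigma>' r m p < y"
proof (cases "\<sigma> = 0")
  case False
  have "\<forall>\<^sub>F l in at_right 1. lim_value (l * \<sigma>) r m p < y"
    using order_tendstoD(2)[OF tendsto_lim_value_scale[OF assms(1-3)] assms(4)]
    by (simp add: eventually_at_split)
  then have "\<forall>\<^sub>F l in at_right 1. lim_value (l * \<sigma>) r m p < y \<and> 1 < l"
    by (intro eventually_conj eventually_at_right_less)
  then obtain l where "lim_value (l * \<sigma>) r m p < y" "1 < l"
    using eventually_happens trivial_limit_at_right_real by blast
  then show ?thesis using False assms(2) by (intro exI[of _ "l * \<sigma>"]) auto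
next
  case True
  obtain d where d: "0 < d" "\<And>k. d \<le> p $ k" using positive_vector_bounded_below[OF assms(3)] by blast
  define x where "x = (MAX k\<in>UNIV. m $ k)"
  have x: "m $ k \<le> x" for k unfolding x_def by (rule max_arm_ge)
  obtain k where "x = m $ k" unfolding x_def by (rule max_arm_attained)
  then have rx: "r * x < y" using lim_value_ge[OF assms(1-3), of m k] assms(4) by simp
  define C where "C = r * (1 + r / d\<^sup>2)"
  have C: "0 \<le> C" using assms(1) by (simp add: C_def)
  \<comment> \<open>Chosen so that \<open>s * C\<close> stays below the gap
    \<open>y - r * x\<close>.\<close>
  define s where "s = (y - r * x) / (C + 1)"
  have s: "0 < s" using rx C by (simp add: s_def)
  have sC: "s * C < y - r * x"
  proof -
    have "s * C < s * (C + 1)" using s by simp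
    also have "\<dots> = y - r * x" using C by (simp add: s_def)
    finally show ?thesis .
  qed
  have "lim_value s r m p = s * lim_value 1 r ((1 / s) *\<^sub>R m) p"
    using lim_value_homogeneous[OF assms(1) _ assms(3), of 1 s "(1 / s) *\<^sub>R m"] s by simp
  also have "lim_value 1 r ((1 / s) *\<^sub>R m) p \<le> r * (x / s + 1 + r * 1\<^sup>2 / d\<^sup>2)"
    by (rule lim_value_le) (use assms d x s in \<open>auto intro: divide_right_mono\<close>)
  then have "s * lim_value 1 r ((1 / s) *\<^sub>R m) p \<le> s * (r * (x / s + 1 + r * 1\<^sup>2 / d\<^sup>2))"
    using s by (intro mult_left_mono) auto
  also have "\<dots> = r * x + s * C" using s by (simp add: C_def field_simps)
  also have "\<dots> < y" using sC by simp
  finally show ?thesis using s True by auto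
qed

text \<open>The alternative \<open>\<sigma>' = 0\<close> accounts for a volatility that is already
  zero, where the value itself serves and no strict decrease is possible.\<close>

lemma lim_value_lower_volatility:
  fixes m p :: "real^'k::finite"
  assumes "0 \<le> r" "0 \<le> \<sigma>" "\<And>k. 0 < p $ k" "y < lim_value \<sigma> r m p"
  shows "\<exists>\<sigma>'\<ge>0. (\<sigma>' < \<sigma> \<or> \<sigma>' = 0) \<and> y < lim_value \<sigma>' r m p"
proof (cases "\<sigma> = 0")
  case False
  have "\<forall>\<^sub>F l in at_left 1. y < lim_value (l * \<sigma>) r m p"
    using order_tendstoD(1)[OF tendsto_lim_value_scale[OF assms(1-3)] assms(4)]
    by (simp add: eventually_at_split)
  then have "\<forall>\<^sub>F l in at_left 1. y < lim_value (l * \<sigma>) r m p \<and> l \<in> {0<..<1::real}"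
    by (intro eventually_conj eventually_at_left_real) auto
  then have "\<exists>l. y < lim_value (l * \<sigma>) r m p \<and> l \<in> {0<..<1::real}"
    by (rule eventually_happens'[OF trivial_limit_at_left_real])
  then obtain l where "y < lim_value (l * \<sigma>) r m p" "0 < l" "l < 1" by auto
  then show ?thesis using False assms(2) by (intro exI[of _ "l * \<sigma>"]) auto
qed (use assms in auto)

section \<open>The bandit in posterior coordinates\<close>

text \<open>The bandit in rescaled coordinates: \<open>m\<close> is the posterior mean, \<open>p\<close> the posterior precision
  and \<open>\<Gamma>\<close> the rescaled reward. The posterior mean is a martingale with two-point increments.\<close>

primrec bandit_value :: "real \<Rightarrow> real \<Rightarrow> nat \<Rightarrow> real^'k::finite \<Rightarrow> real^'k \<Rightarrow> real" where
  "bandit_value \<Gamma> h 0 m p = 0"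
| "bandit_value \<Gamma> h (Suc j) m p = (MAX k\<in>UNIV. h * m $ k +
    ((\<Gamma> + m $ k) * bandit_value \<Gamma> h j (m + (h * (\<Gamma> - m $ k) / (p $ k + h)) *\<^sub>R axis k 1) (p + h *\<^sub>R axis k 1)
    + (\<Gamma> - m $ k) * bandit_value \<Gamma> h j (m - (h * (\<Gamma> + m $ k) / (p $ k + h)) *\<^sub>R axis k 1) (p + h *\<^sub>R axis k 1)) / (2 * \<Gamma>))"

declare bandit_value.simps(2) [simp del]

lemma norm_plus_axis_power2:
  fixes m :: "real^'k::finite"
  shows "(norm (m + a *\<^sub>R axis k 1))\<^sup>2 = (norm m)\<^sup>2 + 2 * a * m $ k + a\<^sup>2"
proof -
  have "m \<bullet> axis k 1 = m $ k" by (simp add: inner_axis)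
  moreover have "(norm (a *\<^sub>R axis k 1 :: real^'k))\<^sup>2 = a\<^sup>2" by simp
  ultimately show ?thesis
    unfolding power2_norm_eq_inner by (simp add: inner_simps inner_commute)
qed

text \<open>Bounds the expected total of the costs \<open>\<kappa> * (m $ k)\<^sup>2\<close> over
  \<open>j\<close> rounds under any policy: the expected squared norm grows by at most
  \<open>h\<^sup>2 * \<Gamma>\<^sup>2 / d\<^sup>2\<close> per round.\<close>

definition penalty :: "real \<Rightarrow> real \<Rightarrow> real \<Rightarrow> real \<Rightarrow> nat \<Rightarrow> real^'k::finite \<Rightarrow> real" where
  "penalty h \<Gamma> d \<kappa> j m = real j * \<kappa> * ((norm m)\<^sup>2 + real j * (h\<^sup>2 * \<Gamma>\<^sup>2 / d\<^sup>2))"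

context
  fixes h \<Gamma> d T \<kappa> \<sigma> :: real
  assumes h: "0 < h" and \<Gamma>: "0 < \<Gamma>" and d: "0 < d" and \<kappa>: "0 \<le> \<kappa>" and \<sigma>: "0 \<le> \<sigma>"
begin

text \<open>With \<open>w = h / (p $ k + h)\<close> the increment is centred with variance
  \<open>w\<^sup>2 * (\<Gamma>\<^sup>2 - (m $ k)\<^sup>2)\<close>, at most
  \<open>h\<^sup>2 * \<Gamma>\<^sup>2 / d\<^sup>2\<close>, and the present cost is covered by
  \<kappa> times the squared norm.\<close>

lemma penalty_step:
  fixes m p :: "real^'k::finite"
  assumes "\<bar>m $ k\<bar> \<le> \<Gamma>" "d \<le> p $ k"
  shows "\<kappa> * (m $ k)\<^sup>2 + ((\<Gamma> + m $ k) * penalty h \<Gamma> d \<kappa> j (m + (h * (\<Gamma> - m $ k) / (p $ k + h)) *\<^sub>R axis k 1)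
    + (\<Gamma> - m $ k) * penalty h \<Gamma> d \<kappa> j (m - (h * (\<Gamma> + m $ k) / (p $ k + h)) *\<^sub>R axis k 1)) / (2 * \<Gamma>)
    \<le> penalty h \<Gamma> d \<kappa> (Suc j) m"
proof -
  define x where "x = m $ k"
  define w where "w = h / (p $ k + h)"
  define v where "v = h\<^sup>2 * \<Gamma>\<^sup>2 / d\<^sup>2"
  define N where "N = (norm m)\<^sup>2"
  have w: "0 \<le> w" "w \<le> h / d" using assms h d by (auto simp: w_def intro!: divide_left_mono)
  have "w\<^sup>2 * (\<Gamma>\<^sup>2 - x\<^sup>2) \<le> (h / d)\<^sup>2 * \<Gamma>\<^sup>2"
    using w assms(1) h d by (intro mult_mono power_mono) (auto simp: x_def abs_le_square_iff[symmetric])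
  then have wv: "w\<^sup>2 * (\<Gamma>\<^sup>2 - x\<^sup>2) \<le> v" by (simp add: v_def power_divide)
  have xN: "x\<^sup>2 \<le> N" using component_le_norm_cart[of m k] by (simp add: x_def N_def abs_le_square_iff[symmetric])
  have up: "(norm (m + (h * (\<Gamma> - m $ k) / (p $ k + h)) *\<^sub>R axis k 1))\<^sup>2 = N + 2 * (w * (\<Gamma> - x)) * x + (w * (\<Gamma> - x))\<^sup>2"
    unfolding norm_plus_axis_power2 by (simp add: w_def x_def N_def)
  have down: "(norm (m - (h * (\<Gamma> + m $ k) / (p $ k + h)) *\<^sub>R axis k 1))\<^sup>2 = N - 2 * (w * (\<Gamma> + x)) * x + (w * (\<Gamma> + x))\<^sup>2"
    using norm_plus_axis_power2[of m "- (h * (\<Gamma> + m $ k) / (p $ k + h))" k] by (simp add: w_def x_def N_def)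
  have "((\<Gamma> + x) * penalty h \<Gamma> d \<kappa> j (m + (h * (\<Gamma> - m $ k) / (p $ k + h)) *\<^sub>R axis k 1)
    + (\<Gamma> - x) * penalty h \<Gamma> d \<kappa> j (m - (h * (\<Gamma> + m $ k) / (p $ k + h)) *\<^sub>R axis k 1))
    = (2 * \<Gamma>) * (real j * \<kappa> * (N + w\<^sup>2 * (\<Gamma>\<^sup>2 - x\<^sup>2) + real j * v))"
    unfolding penalty_def up down v_def[symmetric] by (simp add: power2_eq_square algebra_simps)
  then have "((\<Gamma> + x) * penalty h \<Gamma> d \<kappa> j (m + (h * (\<Gamma> - m $ k) / (p $ k + h)) *\<^sub>R axis k 1)
    + (\<Gamma> - x) * penalty h \<Gamma> d \<kappa> j (m - (h * (\<Gamma> + m $ k) / (p $ k + h)) *\<^sub>R axis k 1)) / (2 * \<Gamma>)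
    = real j * \<kappa> * (N + w\<^sup>2 * (\<Gamma>\<^sup>2 - x\<^sup>2) + real j * v)"
    using \<Gamma> by simp
  also have "\<dots> \<le> real j * \<kappa> * (N + v + real j * v)"
    using wv \<kappa> by (intro mult_left_mono) auto
  finally have 1: "((\<Gamma> + x) * penalty h \<Gamma> d \<kappa> j (m + (h * (\<Gamma> - m $ k) / (p $ k + h)) *\<^sub>R axis k 1)
    + (\<Gamma> - x) * penalty h \<Gamma> d \<kappa> j (m - (h * (\<Gamma> + m $ k) / (p $ k + h)) *\<^sub>R axis k 1)) / (2 * \<Gamma>)
    \<le> real j * \<kappa> * (N + v + real j * v)" .
  have v: "0 \<le> v" by (simp add: v_def)
  have "\<kappa> * x\<^sup>2 \<le> \<kappa> * (N + (v + real j * v))"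
    using xN v \<kappa> by (intro mult_left_mono add_increasing2) auto
  then have "\<kappa> * x\<^sup>2 + real j * \<kappa> * (N + v + real j * v) \<le> penalty h \<Gamma> d \<kappa> (Suc j) m"
    unfolding penalty_def v_def[symmetric] N_def[symmetric] by (simp add: algebra_simps)
  then show ?thesis using 1 unfolding x_def by linarith
qed

text \<open>The new coordinate is a convex combination of the old one and \<Gamma> or its negative.
  This keeps both success and failure probabilities nonnegative along the recursion.\<close>

lemma posterior_mean_bound:
  fixes m p :: "real^'k::finite"
  assumes "\<And>i. \<bar>m $ i\<bar> \<le> \<Gamma>" "d \<le> p $ k"
  shows "\<bar>(m + (h * (\<Gamma> - m $ k) / (p $ k + h)) *\<^sub>R axis k 1) $ i\<bar> \<le> \<Gamma>"
    and "\<bar>(m - (h * (\<Gamma> + m $ k) / (p $ k + h)) *\<^sub>R axis k 1) $ i\<bar> \<le> \<Gamma>"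
proof -
  define w where "w = h / (p $ k + h)"
  have w: "0 \<le> w" "w \<le> 1" using assms(2) h d by (auto simp: w_def)
  have le: "w * (\<Gamma> - m $ k) \<le> 1 * (\<Gamma> - m $ k)" "w * (\<Gamma> + m $ k) \<le> 1 * (\<Gamma> + m $ k)"
    "0 \<le> w * (\<Gamma> - m $ k)" "0 \<le> w * (\<Gamma> + m $ k)"
  proof -
    have "0 \<le> \<Gamma> - m $ k" "0 \<le> \<Gamma> + m $ k" using assms(1)[of k] by linarith+
    then show "w * (\<Gamma> - m $ k) \<le> 1 * (\<Gamma> - m $ k)" "w * (\<Gamma> + m $ k) \<le> 1 * (\<Gamma> + m $ k)"
      "0 \<le> w * (\<Gamma> - m $ k)" "0 \<le> w * (\<Gamma> + m $ k)"
      using w by (intro mult_right_mono mult_nonneg_nonneg; simp)+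
  qed
  have eq: "h * (\<Gamma> - m $ k) / (p $ k + h) = w * (\<Gamma> - m $ k)" "h * (\<Gamma> + m $ k) / (p $ k + h) = w * (\<Gamma> + m $ k)"
    by (simp_all add: w_def)
  show "\<bar>(m + (h * (\<Gamma> - m $ k) / (p $ k + h)) *\<^sub>R axis k 1) $ i\<bar> \<le> \<Gamma>"
    using le assms(1)[of i] unfolding eq by (cases "i = k") (auto simp: axis_def)
  show "\<bar>(m - (h * (\<Gamma> + m $ k) / (p $ k + h)) *\<^sub>R axis k 1) $ i\<bar> \<le> \<Gamma>"
    using le assms(1)[of i] unfolding eq by (cases "i = k") (auto simp: axis_def)
qed

text \<open>The success and failure probabilities are exactly the weights of the centred law on the
  two increments, as the convex order estimates require.\<close>

lemma two_point_weights:
  fixes x y P M :: real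
  assumes "0 < y"
  shows "(h * (\<Gamma> + x) / (y + h) * P + h * (\<Gamma> - x) / (y + h) * M) / (h * (\<Gamma> - x) / (y + h) + h * (\<Gamma> + x) / (y + h))
    = ((\<Gamma> + x) * P + (\<Gamma> - x) * M) / (2 * \<Gamma>)"
    and "h * (\<Gamma> - x) / (y + h) + h * (\<Gamma> + x) / (y + h) = 2 * (h * \<Gamma> / (y + h))"
proof -
  define w where "w = h / (y + h)"
  have w: "w \<noteq> 0" using assms h by (simp add: w_def)
  have eq: "h * z / (y + h) = w * z" for z by (simp add: w_def)
  show 2: "h * (\<Gamma> - x) / (y + h) + h * (\<Gamma> + x) / (y + h) = 2 * (h * \<Gamma> / (y + h))"
    unfolding eq by (simp add: algebra_simps)
  have "h * (\<Gamma> + x) / (y + h) * P + h * (\<Gamma> - x) / (y + h) * M = w * ((\<Gamma> + x) * P + (\<Gamma> - x) * M)"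
    unfolding eq by (simp add: algebra_simps)
  then show "(h * (\<Gamma> + x) / (y + h) * P + h * (\<Gamma> - x) / (y + h) * M) / (h * (\<Gamma> - x) / (y + h) + h * (\<Gamma> + x) / (y + h))
    = ((\<Gamma> + x) * P + (\<Gamma> - x) * M) / (2 * \<Gamma>)"
    unfolding 2 using w by (simp add: eq)
qed

text \<open>If the step sizes are ordered, the convex order of two-point laws decides. Otherwise the
  average to be bounded exceeds \<open>\<phi> m\<close> by at most \<open>T\<close> times the length
  of its step, which the penalty pays for, and by convexity \<open>\<phi> m\<close> is below the
  other average.\<close>

lemma arm_compare:
  fixes \<phi> :: "real^'k::finite \<Rightarrow> real" and m :: "real^'k"
  assumes conv: "convex_on UNIV \<phi>" and lip: "\<And>x y. \<bar>\<phi> x - \<phi> y\<bar> \<le> T * norm (x - y)" and "0 \<le> T"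
    and m: "\<bar>m $ k\<bar> \<le> \<Gamma>" and y: "d \<le> y"
  defines "E \<equiv> ((\<Gamma> + m $ k) * \<phi> (m + (h * (\<Gamma> - m $ k) / (y + h)) *\<^sub>R axis k 1)
    + (\<Gamma> - m $ k) * \<phi> (m - (h * (\<Gamma> + m $ k) / (y + h)) *\<^sub>R axis k 1)) / (2 * \<Gamma>)"
    and "c \<equiv> step_size \<sigma> h y"
  defines "S \<equiv> (\<phi> (m + c *\<^sub>R axis k 1) + \<phi> (m - c *\<^sub>R axis k 1)) / 2"
  shows "h * (\<Gamma> + \<bar>m $ k\<bar>) / (y + h) \<le> c \<or> T * (h * \<Gamma> / d) \<le> \<kappa> * (m $ k)\<^sup>2 \<Longrightarrow> E \<le> S + \<kappa> * (m $ k)\<^sup>2"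
    and "c \<le> h * (\<Gamma> - \<bar>m $ k\<bar>) / (y + h) \<or> T * c \<le> \<kappa> * (m $ k)\<^sup>2 \<Longrightarrow> S \<le> E + \<kappa> * (m $ k)\<^sup>2"
proof -
  define a b where "a = h * (\<Gamma> - m $ k) / (y + h)" and "b = h * (\<Gamma> + m $ k) / (y + h)"
  let ?e = "axis k 1 :: real^'k"
  have y0: "0 < y" using y d by simp
  have a: "0 \<le> a" and b: "0 \<le> b"
    using m y0 h unfolding a_def b_def by (auto intro!: divide_nonneg_nonneg mult_nonneg_nonneg)
  have ab: "a + b = 2 * (h * \<Gamma> / (y + h))"
    unfolding a_def b_def by (rule two_point_weights(2)[OF y0])
  have ab0: "0 < a + b" unfolding ab using h \<Gamma> y0 by simp
  have E: "E = (b * \<phi> (m + a *\<^sub>R ?e) + a * \<phi> (m - b *\<^sub>R ?e)) / (a + b)"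
    unfolding E_def a_def b_def by (rule two_point_weights(1)[OF y0, symmetric])
  have c: "0 \<le> c" using \<sigma> h y0 by (simp add: c_def)
  have pen: "0 \<le> \<kappa> * (m $ k)\<^sup>2" using \<kappa> by simp
  have mid: "\<phi> m \<le> S"
    using symmetric_mono[OF conv order_refl c, of m ?e] unfolding S_def by simp
  have midE: "\<phi> m \<le> E"
    using symmetric_le_two_point[OF conv order_refl a b, of m ?e] ab0
    by (simp add: E pos_le_divide_eq mult.commute)
  { assume "h * (\<Gamma> + \<bar>m $ k\<bar>) / (y + h) \<le> c \<or> T * (h * \<Gamma> / d) \<le> \<kappa> * (m $ k)\<^sup>2"
    then show "E \<le> S + \<kappa> * (m $ k)\<^sup>2"
    proof
      assume "h * (\<Gamma> + \<bar>m $ k\<bar>) / (y + h) \<le> c"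
      moreover have "a \<le> h * (\<Gamma> + \<bar>m $ k\<bar>) / (y + h)" "b \<le> h * (\<Gamma> + \<bar>m $ k\<bar>) / (y + h)"
        using h y0 unfolding a_def b_def by (auto intro!: divide_right_mono mult_left_mono)
      ultimately have "a \<le> c" "b \<le> c" by auto
      from two_point_le_symmetric[OF conv a b this, of m ?e]
      have "E \<le> S" using ab0 by (simp add: E S_def pos_divide_le_eq mult.commute)
      then show ?thesis using pen by linarith
    next
      assume bad: "T * (h * \<Gamma> / d) \<le> \<kappa> * (m $ k)\<^sup>2"
      have 1: "\<phi> (m + a *\<^sub>R ?e) \<le> \<phi> m + T * a" using lip[of "m + a *\<^sub>R ?e" m] a by simp
      have 2: "\<phi> (m - b *\<^sub>R ?e) \<le> \<phi> m + T * b" using lip[of "m - b *\<^sub>R ?e" m] b by simp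
      have "b * \<phi> (m + a *\<^sub>R ?e) + a * \<phi> (m - b *\<^sub>R ?e) \<le> b * (\<phi> m + T * a) + a * (\<phi> m + T * b)"
        using 1 2 a b by (intro add_mono mult_left_mono)
      also have "\<dots> = (a + b) * \<phi> m + T * (2 * a * b)" by (simp add: algebra_simps)
      \<comment> \<open>The mean length \<open>2 * a * b / (a + b)\<close> of the asymmetric step is
        at most \<open>(a + b) / 2\<close>.\<close>
      also have "\<dots> \<le> (a + b) * \<phi> m + T * ((a + b) * (a + b) / 2)"
      proof -
        have "0 \<le> (a - b)\<^sup>2" "0 \<le> a * a + b * b" by simp_all
        then have "2 * a * b \<le> (a + b) * (a + b) / 2"
          by (simp add: power2_eq_square algebra_simps)
        then show ?thesis using \<open>0 \<le> T\<close> by (intro add_left_mono mult_left_mono)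
      qed
      also have "\<dots> = (a + b) * (\<phi> m + T * ((a + b) / 2))" by (simp add: algebra_simps)
      finally have E\<phi>: "E \<le> \<phi> m + T * ((a + b) / 2)"
        using ab0 by (simp add: E pos_divide_le_eq mult.commute)
      have "h * \<Gamma> / (y + h) \<le> h * \<Gamma> / d"
        using h \<Gamma> d y by (intro divide_left_mono) auto
      moreover have "(a + b) / 2 = h * \<Gamma> / (y + h)"
        unfolding ab by (rule nonzero_mult_div_cancel_left) simp
      ultimately have mean: "(a + b) / 2 \<le> h * \<Gamma> / d" by (simp only:)
      have "T * ((a + b) / 2) \<le> T * (h * \<Gamma> / d)" using mean \<open>0 \<le> T\<close> by (rule mult_left_mono)
      then show ?thesis using mid bad E\<phi> by linarith
    qed }
  { assume "c \<le> h * (\<Gamma> - \<bar>m $ k\<bar>) / (y + h) \<or> T * c \<le> \<kappa> * (m $ k)\<^sup>2"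
    then show "S \<le> E + \<kappa> * (m $ k)\<^sup>2"
    proof
      assume "c \<le> h * (\<Gamma> - \<bar>m $ k\<bar>) / (y + h)"
      moreover have "h * (\<Gamma> - \<bar>m $ k\<bar>) / (y + h) \<le> a" "h * (\<Gamma> - \<bar>m $ k\<bar>) / (y + h) \<le> b"
        using h y0 unfolding a_def b_def by (intro divide_right_mono mult_left_mono; simp)+
      ultimately have "c \<le> a" "c \<le> b" by auto
      from symmetric_le_two_point[OF conv c this, of m ?e]
      have "S \<le> E" using ab0 by (simp add: E S_def pos_le_divide_eq mult.commute)
      then show ?thesis using pen by linarith
    next
      assume bad: "T * c \<le> \<kappa> * (m $ k)\<^sup>2"
      have "\<phi> (m + c *\<^sub>R ?e) \<le> \<phi> m + T * c" using lip[of "m + c *\<^sub>R ?e" m] c by simp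
      moreover have "\<phi> (m - c *\<^sub>R ?e) \<le> \<phi> m + T * c" using lip[of "m - c *\<^sub>R ?e" m] c by simp
      ultimately have "S \<le> \<phi> m + T * c" unfolding S_def add_divide_distrib by linarith
      then show ?thesis using midE bad by linarith
    qed }
qed

lemma walk_value_arm_hyps:
  assumes "real j * h \<le> T"
  shows "\<bar>walk_value \<sigma> h j x p - walk_value \<sigma> h j y p\<bar> \<le> T * norm (x - y)" "0 \<le> T"
proof -
  show "\<bar>walk_value \<sigma> h j x p - walk_value \<sigma> h j y p\<bar> \<le> T * norm (x - y)"
    using walk_value_lipschitz[of h \<sigma> j x p y] h mult_right_mono[OF assms, of "norm (x - y)"] by simp
  have "0 \<le> real j * h" using h by simp
  then show "0 \<le> T" using assms by linarith
qed

lemma two_point_average_mono: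
  assumes "\<bar>x\<bar> \<le> \<Gamma>" "P \<le> P'" "M \<le> M'"
  shows "((\<Gamma> + x) * P + (\<Gamma> - x) * M) / (2 * \<Gamma>) \<le> ((\<Gamma> + x) * P' + (\<Gamma> - x) * M') / (2 * \<Gamma>)"
  using assms \<Gamma> by (intro divide_right_mono add_mono mult_left_mono) auto

lemma two_point_average_add:
  "((\<Gamma> + x) * (P + P') + (\<Gamma> - x) * (M + M')) / (2 * \<Gamma>)
    = ((\<Gamma> + x) * P + (\<Gamma> - x) * M) / (2 * \<Gamma>) + ((\<Gamma> + x) * P' + (\<Gamma> - x) * M') / (2 * \<Gamma>)"
  unfolding distrib_left add_divide_distrib by simp

text \<open>The induction hypothesis first replaces the bandit values inside the round by walk
  values, so that the arm comparison needs convexity only of the walk value, whose weights do not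
  depend on \<open>m\<close>.\<close>

lemma bandit_value_le_walk_value:
  fixes m p :: "real^'k::finite"
  assumes step: "\<And>x y. \<bar>x\<bar> \<le> \<Gamma> \<Longrightarrow> d \<le> y \<Longrightarrow>
      h * (\<Gamma> + \<bar>x\<bar>) / (y + h) \<le> step_size \<sigma> h y \<or> T * (h * \<Gamma> / d) \<le> \<kappa> * x\<^sup>2"
    and "real j * h \<le> T" "\<And>k. \<bar>m $ k\<bar> \<le> \<Gamma>" "\<And>k. d \<le> p $ k"
  shows "bandit_value \<Gamma> h j m p \<le> walk_value \<sigma> h j m p + penalty h \<Gamma> d \<kappa> j m"
  using assms(2-)
proof (induction j arbitrary: m p)
  case 0
  then show ?case by (simp add: penalty_def)
next
  case (Suc j)
  have jT: "real j * h \<le> T" using Suc.prems(1) h by (simp add: algebra_simps)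
  show ?case unfolding bandit_value.simps(2)
  proof (rule max_arm_le)
    fix k
    let ?q = "p + h *\<^sub>R axis k 1"
    let ?P = "m + (h * (\<Gamma> - m $ k) / (p $ k + h)) *\<^sub>R axis k 1" and ?M = "m - (h * (\<Gamma> + m $ k) / (p $ k + h)) *\<^sub>R axis k 1"
    have q: "d \<le> ?q $ i" for i using Suc.prems(3)[of i] h by (auto simp: axis_def)
    note IH = Suc.IH[OF jT posterior_mean_bound(1)[OF Suc.prems(2,3)] q]
      Suc.IH[OF jT posterior_mean_bound(2)[OF Suc.prems(2,3)] q]
    have "((\<Gamma> + m $ k) * bandit_value \<Gamma> h j ?P ?q + (\<Gamma> - m $ k) * bandit_value \<Gamma> h j ?M ?q) / (2 * \<Gamma>)
      \<le> ((\<Gamma> + m $ k) * (walk_value \<sigma> h j ?P ?q + penalty h \<Gamma> d \<kappa> j ?P) + (\<Gamma> - m $ k) * (walk_value \<sigma> h j ?M ?q + penalty h \<Gamma> d \<kappa> j ?M)) / (2 * \<Gamma>)"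
      by (rule two_point_average_mono[OF Suc.prems(2) IH])
    moreover have "((\<Gamma> + m $ k) * walk_value \<sigma> h j ?P ?q + (\<Gamma> - m $ k) * walk_value \<sigma> h j ?M ?q) / (2 * \<Gamma>)
      \<le> (walk_value \<sigma> h j (m + step_size \<sigma> h (p $ k) *\<^sub>R axis k 1) ?q
        + walk_value \<sigma> h j (m - step_size \<sigma> h (p $ k) *\<^sub>R axis k 1) ?q) / 2 + \<kappa> * (m $ k)\<^sup>2"
      by (rule arm_compare(1)[OF walk_value_convex walk_value_arm_hyps[OF jT] Suc.prems(2,3) step[OF Suc.prems(2,3)]])
    moreover note penalty_step[OF Suc.prems(2,3), of k j]
    moreover note walk_value_Suc_ge[of h m k \<sigma> j p]
    ultimately show "h * m $ k + ((\<Gamma> + m $ k) * bandit_value \<Gamma> h j ?P ?q + (\<Gamma> - m $ k) * bandit_value \<Gamma> h j ?M ?q) / (2 * \<Gamma>)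
      \<le> walk_value \<sigma> h (Suc j) m p + penalty h \<Gamma> d \<kappa> (Suc j) m"
      unfolding two_point_average_add add_divide_distrib[of "walk_value _ _ _ _ _"] by linarith
  qed
qed

lemma walk_value_le_bandit_value:
  fixes m p :: "real^'k::finite"
  assumes step: "\<And>x y. \<bar>x\<bar> \<le> \<Gamma> \<Longrightarrow> d \<le> y \<Longrightarrow>
      step_size \<sigma> h y \<le> h * (\<Gamma> - \<bar>x\<bar>) / (y + h) \<or> T * step_size \<sigma> h y \<le> \<kappa> * x\<^sup>2"
    and "real j * h \<le> T" "\<And>k. \<bar>m $ k\<bar> \<le> \<Gamma>" "\<And>k. d \<le> p $ k"
  shows "walk_value \<sigma> h j m p \<le> bandit_value \<Gamma> h j m p + penalty h \<Gamma> d \<kappa> j m"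
  using assms(2-)
proof (induction j arbitrary: m p)
  case 0
  then show ?case by (simp add: penalty_def)
next
  case (Suc j)
  have jT: "real j * h \<le> T" using Suc.prems(1) h by (simp add: algebra_simps)
  show ?case
  proof (rule walk_value_Suc_le)
    fix k
    let ?q = "p + h *\<^sub>R axis k 1"
    let ?P = "m + (h * (\<Gamma> - m $ k) / (p $ k + h)) *\<^sub>R axis k 1" and ?M = "m - (h * (\<Gamma> + m $ k) / (p $ k + h)) *\<^sub>R axis k 1"
    have q: "d \<le> ?q $ i" for i using Suc.prems(3)[of i] h by (auto simp: axis_def)
    note IH = Suc.IH[OF jT posterior_mean_bound(1)[OF Suc.prems(2,3)] q]
      Suc.IH[OF jT posterior_mean_bound(2)[OF Suc.prems(2,3)] q]
    have "((\<Gamma> + m $ k) * walk_value \<sigma> h j ?P ?q + (\<Gamma> - m $ k) * walk_value \<sigma> h j ?M ?q) / (2 * \<Gamma>)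
      \<le> ((\<Gamma> + m $ k) * (bandit_value \<Gamma> h j ?P ?q + penalty h \<Gamma> d \<kappa> j ?P) + (\<Gamma> - m $ k) * (bandit_value \<Gamma> h j ?M ?q + penalty h \<Gamma> d \<kappa> j ?M)) / (2 * \<Gamma>)"
      by (rule two_point_average_mono[OF Suc.prems(2) IH])
    moreover have "(walk_value \<sigma> h j (m + step_size \<sigma> h (p $ k) *\<^sub>R axis k 1) ?q
        + walk_value \<sigma> h j (m - step_size \<sigma> h (p $ k) *\<^sub>R axis k 1) ?q) / 2
       \<le> ((\<Gamma> + m $ k) * walk_value \<sigma> h j ?P ?q + (\<Gamma> - m $ k) * walk_value \<sigma> h j ?M ?q) / (2 * \<Gamma>) + \<kappa> * (m $ k)\<^sup>2"
      by (rule arm_compare(2)[OF walk_value_convex walk_value_arm_hyps[OF jT] Suc.prems(2,3) step[OF Suc.prems(2,3)]])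
    moreover note penalty_step[OF Suc.prems(2,3), of k j]
    moreover have "h * m $ k + ((\<Gamma> + m $ k) * bandit_value \<Gamma> h j ?P ?q + (\<Gamma> - m $ k) * bandit_value \<Gamma> h j ?M ?q) / (2 * \<Gamma>)
      \<le> bandit_value \<Gamma> h (Suc j) m p"
      unfolding bandit_value.simps(2) by (rule max_arm_ge)
    ultimately show "h * m $ k + (walk_value \<sigma> h j (m + step_size \<sigma> h (p $ k) *\<^sub>R axis k 1) ?q
        + walk_value \<sigma> h j (m - step_size \<sigma> h (p $ k) *\<^sub>R axis k 1) ?q) / 2
      \<le> bandit_value \<Gamma> h (Suc j) m p + penalty h \<Gamma> d \<kappa> (Suc j) m"
      unfolding two_point_average_add add_divide_distrib[of "walk_value _ _ _ _ _"] by linarith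
  qed
qed

end

section \<open>Comparison of the step sizes of bandit and walk\<close>

text \<open>For \<open>x\<close> with |x| sqrt h \<le> \<delta>, the longer increment fits into a
  step of volatility \<open>\<sigma> + \<delta>\<close>. For other \<open>x\<close> the factor
  \<open>x\<^sup>2 * h / \<delta>\<^sup>2\<close> is at least 1; inserting it into the crude size
  \<open>\<sigma> * sqrt h / d\<close> gives the coefficient of \<open>x\<^sup>2\<close>. The
  literal 1 is the Lipschitz constant \<open>T\<close>.\<close>

lemma volatility_step_upper:
  fixes \<Gamma> \<sigma> :: real
  assumes "0 < h" "0 < d" "d \<le> y" "0 < \<Gamma>" "\<Gamma> * sqrt h \<le> \<sigma>" "0 < \<delta>"
  shows "h * (\<Gamma> + \<bar>x\<bar>) / (y + h) \<le> step_size (\<sigma> + \<delta>) h y \<or> 1 * (h * \<Gamma> / d) \<le> (\<sigma> / (d * \<delta>\<^sup>2) * (h * sqrt h)) * x\<^sup>2"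
proof (cases "\<bar>x\<bar> * sqrt h \<le> \<delta>")
  case True
  have y: "0 < y" using assms by simp
  have hh: "h = sqrt h * sqrt h" using assms by simp
  have "h * (\<Gamma> + \<bar>x\<bar>) = sqrt h * (\<Gamma> * sqrt h + \<bar>x\<bar> * sqrt h)"
    by (subst hh) (simp only: distrib_left distrib_right mult_ac)
  also have "\<dots> \<le> sqrt h * (\<sigma> + \<delta>)" using assms True by (intro mult_left_mono add_mono) auto
  finally have "h * (\<Gamma> + \<bar>x\<bar>) / (y + h) \<le> sqrt h * (\<sigma> + \<delta>) / (y + h)"
    using assms y by (intro divide_right_mono) auto
  also have "\<dots> \<le> sqrt h * (\<sigma> + \<delta>) / sqrt (y * (y + h))"
  proof (rule divide_left_mono)
    have "y * (y + h) \<le> (y + h) * (y + h)" using assms y by (intro mult_right_mono) auto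
    then have "sqrt (y * (y + h)) \<le> sqrt ((y + h) * (y + h))" by (rule real_sqrt_le_mono)
    also have "\<dots> = y + h" using y assms by (simp only: real_sqrt_abs2)
    finally show "sqrt (y * (y + h)) \<le> y + h" .
    have "0 \<le> \<Gamma> * sqrt h" using assms by simp
    then have "0 \<le> \<sigma>" using assms(5) by linarith
    then show "0 \<le> sqrt h * (\<sigma> + \<delta>)" using assms by simp
  qed (use assms y in auto)
  also have "\<dots> = step_size (\<sigma> + \<delta>) h y" by (simp add: step_size_def real_sqrt_divide)
  finally show ?thesis by blast
next
  case False
  then have "\<delta>\<^sup>2 \<le> (\<bar>x\<bar> * sqrt h)\<^sup>2" using assms by (intro power_mono) auto
  then have "\<delta>\<^sup>2 \<le> x\<^sup>2 * h" using assms by (simp add: power_mult_distrib)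
  then have 1: "1 \<le> x\<^sup>2 * h / \<delta>\<^sup>2" using assms by simp
  have "0 \<le> \<Gamma> * sqrt h" using assms by simp
  then have s: "0 \<le> \<sigma>" using assms(5) by linarith
  have "sqrt h * (\<Gamma> * sqrt h) = (sqrt h * sqrt h) * \<Gamma>" by (simp only: mult_ac)
  then have "h * \<Gamma> / d = sqrt h * (\<Gamma> * sqrt h) / d" using assms by simp
  also have "\<dots> \<le> sqrt h * \<sigma> / d" using assms by (intro divide_right_mono mult_left_mono) auto
  also have "\<dots> \<le> (sqrt h * \<sigma> / d) * (x\<^sup>2 * h / \<delta>\<^sup>2)"
    using mult_left_mono[OF 1, of "sqrt h * \<sigma> / d"] s assms by simp
  also have "\<dots> = (\<sigma> / (d * \<delta>\<^sup>2) * (h * sqrt h)) * x\<^sup>2" by (simp add: mult_ac)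
  finally show ?thesis by simp
qed

text \<open>Now the shorter increment must exceed the symmetric step. The factor
  \<open>1 + h / d\<close> bounds \<open>(y + h) / y\<close>, the loss between the denominator
  \<open>y + h\<close> of the bandit and the lower bound \<open>y\<close> for the denominator of the
  walk.\<close>

lemma volatility_step_lower:
  fixes \<Gamma> \<sigma> :: real
  assumes "0 < h" "0 < d" "d \<le> y" "0 < \<Gamma>" "0 \<le> \<sigma>" "\<sigma> * (1 + h / d) + \<delta> \<le> \<Gamma> * sqrt h" "0 < \<delta>"
  shows "step_size \<sigma> h y \<le> h * (\<Gamma> - \<bar>x\<bar>) / (y + h) \<or> 1 * step_size \<sigma> h y \<le> (\<sigma> / (d * \<delta>\<^sup>2) * (h * sqrt h)) * x\<^sup>2"
proof (cases "\<bar>x\<bar> * sqrt h \<le> \<delta>")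
  case True
  have y: "0 < y" using assms by simp
  have hh: "h = sqrt h * sqrt h" using assms by simp
  have "\<sigma> * ((y + h) / y) \<le> \<sigma> * (1 + h / d)"
  proof (rule mult_left_mono)
    have "(y + h) / y = 1 + h / y" using y by (simp add: add_divide_distrib)
    then show "(y + h) / y \<le> 1 + h / d" using assms by (simp add: divide_left_mono)
  qed (rule assms)
  then have le: "\<sigma> * ((y + h) / y) \<le> (\<Gamma> - \<bar>x\<bar>) * sqrt h" using assms True by (simp add: left_diff_distrib)
  have "step_size \<sigma> h y = \<sigma> * sqrt h / sqrt (y * (y + h))" by (simp add: step_size_def real_sqrt_divide)
  also have "\<dots> \<le> \<sigma> * sqrt h / y"
  proof (rule divide_left_mono)
    have "y * y \<le> y * (y + h)" using assms y by (intro mult_left_mono) auto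
    then show "y \<le> sqrt (y * (y + h))" using y real_le_rsqrt[of y] by (simp add: power2_eq_square)
  qed (use assms y in auto)
  also have "\<dots> = \<sigma> * ((y + h) / y) * sqrt h / (y + h)"
    using y assms by simp
  also have "\<dots> \<le> (\<Gamma> - \<bar>x\<bar>) * sqrt h * sqrt h / (y + h)"
    using le y assms by (intro divide_right_mono mult_right_mono) auto
  also have "\<dots> = h * (\<Gamma> - \<bar>x\<bar>) / (y + h)" using assms by simp
  finally show ?thesis by blast
next
  case False
  then have "\<delta>\<^sup>2 \<le> (\<bar>x\<bar> * sqrt h)\<^sup>2" using assms by (intro power_mono) auto
  then have "\<delta>\<^sup>2 \<le> x\<^sup>2 * h" using assms by (simp add: power_mult_distrib)
  then have 1: "1 \<le> x\<^sup>2 * h / \<delta>\<^sup>2" using assms by simp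
  have "step_size \<sigma> h y \<le> \<sigma> * sqrt h / d" by (rule step_size_le) (use assms in auto)
  also have "\<dots> \<le> (\<sigma> * sqrt h / d) * (x\<^sup>2 * h / \<delta>\<^sup>2)"
    using mult_left_mono[OF 1, of "\<sigma> * sqrt h / d"] assms by simp
  also have "\<dots> = (\<sigma> / (d * \<delta>\<^sup>2) * (h * sqrt h)) * x\<^sup>2" by (simp add: mult_ac)
  finally show ?thesis by simp
qed

section \<open>Exact reduction of the bandit to posterior coordinates\<close>

text \<open>The posterior mean reward of each arm times \<open>n / f\<close>. The factor
  \<open>n\<close> compensates for the round length \<open>h = 1 / n\<close>, so
  \<open>h * m $ k\<close> is the expected reward in units of \<open>f\<close>.\<close>

definition scaled_mean :: "nat \<Rightarrow> real \<Rightarrow> real \<Rightarrow> real^'k \<Rightarrow> real^'k \<Rightarrow> real^'k \<Rightarrow> nat^'k \<Rightarrow> real^'k::finite" where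
  "scaled_mean n f \<gamma> \<alpha> \<beta> s q =
     (\<chi> k. real n / f * (\<gamma> * (\<alpha> $ k - \<beta> $ k) + s $ k) / (\<alpha> $ k + \<beta> $ k + real (q $ k)))"

definition scaled_precision :: "nat \<Rightarrow> real^'k \<Rightarrow> real^'k \<Rightarrow> nat^'k \<Rightarrow> real^'k::finite" where
  "scaled_precision n \<alpha> \<beta> q = (\<chi> k. (\<alpha> $ k + \<beta> $ k + real (q $ k)) / real n)"

text \<open>A pull adds one to the total count \<open>B\<close> and plus or minus \<gamma> to the
  numerator, so the mean becomes \<open>(m $ k * B + \<Gamma>) / (B + 1)\<close> or
  \<open>(m $ k * B - \<Gamma>) / (B + 1)\<close>.\<close>

lemma scaled_state_step:
  fixes \<alpha> \<beta> s :: "real^'k::finite" and q :: "nat^'k" and \<gamma> f :: real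
  assumes "0 < n" "0 < f" "\<And>k. 0 < \<alpha> $ k" "\<And>k. 0 < \<beta> $ k"
  defines "h \<equiv> 1 / real n" and "\<Gamma> \<equiv> real n * \<gamma> / f" and "m \<equiv> scaled_mean n f \<gamma> \<alpha> \<beta> s q" and "p \<equiv> scaled_precision n \<alpha> \<beta> q"
  shows "scaled_precision n \<alpha> \<beta> (q + axis k 1) = p + h *\<^sub>R axis k 1"
    and "scaled_mean n f \<gamma> \<alpha> \<beta> (s + \<gamma> *\<^sub>R axis k 1) (q + axis k 1) = m + (h * (\<Gamma> - m $ k) / (p $ k + h)) *\<^sub>R axis k 1"
    and "scaled_mean n f \<gamma> \<alpha> \<beta> (s - \<gamma> *\<^sub>R axis k 1) (q + axis k 1) = m - (h * (\<Gamma> + m $ k) / (p $ k + h)) *\<^sub>R axis k 1"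
proof -
  show "scaled_precision n \<alpha> \<beta> (q + axis k 1) = p + h *\<^sub>R axis k 1"
    by (simp add: vec_eq_iff scaled_precision_def p_def h_def axis_def add_divide_distrib)
  define B where "B = \<alpha> $ k + \<beta> $ k + real (q $ k)"
  define G where "G = \<gamma> * (\<alpha> $ k - \<beta> $ k) + s $ k"
  have B: "0 < B" using assms(3)[of k] assms(4)[of k] by (simp add: B_def)
  have ph: "p $ k + h = (B + 1) / real n"
    by (simp add: p_def h_def scaled_precision_def B_def add_divide_distrib)
  have mk: "m $ k = real n / f * G / B" by (simp add: m_def scaled_mean_def G_def B_def)
  have up: "real n / f * (G + \<gamma>) / (B + 1) = m $ k + h * (\<Gamma> - m $ k) / (p $ k + h)"
  proof -
    have "h * (\<Gamma> - m $ k) / (p $ k + h) = (\<Gamma> - m $ k) / (B + 1)"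
      unfolding ph unfolding h_def using assms(1) by simp
    moreover have "x + (G - x) / (B + 1) = (x * B + G) / (B + 1)" for x G
      using B by (simp add: field_simps)
    ultimately have "m $ k + h * (\<Gamma> - m $ k) / (p $ k + h) = (m $ k * B + \<Gamma>) / (B + 1)"
      by simp
    also have "m $ k * B = real n / f * G" using B by (simp add: mk)
    also have "real n / f * G + \<Gamma> = real n / f * (G + \<gamma>)" by (simp add: \<Gamma>_def distrib_left)
    finally show ?thesis by simp
  qed
  have down: "real n / f * (G - \<gamma>) / (B + 1) = m $ k - h * (\<Gamma> + m $ k) / (p $ k + h)"
  proof -
    have "h * (\<Gamma> + m $ k) / (p $ k + h) = (\<Gamma> + m $ k) / (B + 1)"
      unfolding ph unfolding h_def using assms(1) by simp
    moreover have "x - (G + x) / (B + 1) = (x * B - G) / (B + 1)" for x G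
      using B by (simp add: field_simps)
    ultimately have "m $ k - h * (\<Gamma> + m $ k) / (p $ k + h) = (m $ k * B - \<Gamma>) / (B + 1)"
      by simp
    also have "m $ k * B = real n / f * G" using B by (simp add: mk)
    also have "real n / f * G - \<Gamma> = real n / f * (G - \<gamma>)" by (simp add: \<Gamma>_def right_diff_distrib)
    finally show ?thesis by simp
  qed
  show "scaled_mean n f \<gamma> \<alpha> \<beta> (s + \<gamma> *\<^sub>R axis k 1) (q + axis k 1) = m + (h * (\<Gamma> - m $ k) / (p $ k + h)) *\<^sub>R axis k 1"
  proof (subst vec_eq_iff, rule allI)
    fix i
    show "scaled_mean n f \<gamma> \<alpha> \<beta> (s + \<gamma> *\<^sub>R axis k 1) (q + axis k 1) $ i = (m + (h * (\<Gamma> - m $ k) / (p $ k + h)) *\<^sub>R axis k 1) $ i"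
    proof (cases "i = k")
      case True
      have "scaled_mean n f \<gamma> \<alpha> \<beta> (s + \<gamma> *\<^sub>R axis k 1) (q + axis k 1) $ k = real n / f * (G + \<gamma>) / (B + 1)"
        by (simp add: scaled_mean_def G_def B_def add_ac)
      then show ?thesis using True up by simp
    qed (simp add: m_def scaled_mean_def axis_def)
  qed
  show "scaled_mean n f \<gamma> \<alpha> \<beta> (s - \<gamma> *\<^sub>R axis k 1) (q + axis k 1) = m - (h * (\<Gamma> + m $ k) / (p $ k + h)) *\<^sub>R axis k 1"
  proof (subst vec_eq_iff, rule allI)
    fix i
    show "scaled_mean n f \<gamma> \<alpha> \<beta> (s - \<gamma> *\<^sub>R axis k 1) (q + axis k 1) $ i = (m - (h * (\<Gamma> + m $ k) / (p $ k + h)) *\<^sub>R axis k 1) $ i"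
    proof (cases "i = k")
      case True
      have "scaled_mean n f \<gamma> \<alpha> \<beta> (s - \<gamma> *\<^sub>R axis k 1) (q + axis k 1) $ k = real n / f * (G - \<gamma>) / (B + 1)"
        by (simp add: scaled_mean_def G_def B_def add_ac add_diff_eq)
      then show ?thesis using True down by simp
    qed (simp add: m_def scaled_mean_def axis_def)
  qed
qed

text \<open>The identity is exact for each \<open>n\<close>. Admissibility is carried along because
  it makes all Beta parameters positive.\<close>

lemma opt_reward_eq_bandit_value:
  fixes \<alpha> \<beta> s :: "real^'k::finite" and q :: "nat^'k" and \<gamma> f :: real
  assumes n: "0 < n" and pos: "0 < \<gamma>" "0 < f" "\<And>k. 0 < \<alpha> $ k" "\<And>k. 0 < \<beta> $ k"
    and "i \<le> Suc n" "admissible \<gamma> i s q"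
  shows "opt_reward \<gamma> \<alpha> \<beta> n i s q / f = bandit_value (real n * \<gamma> / f) (1 / real n) (Suc n - i)
     (scaled_mean n f \<gamma> \<alpha> \<beta> s q) (scaled_precision n \<alpha> \<beta> q)"
  using assms(6,7)
proof (induction "Suc n - i" arbitrary: i s q)
  case 0
  then show ?case by (simp add: opt_reward.simps)
next
  case (Suc j)
  define h \<Gamma> where "h = 1 / real n" and "\<Gamma> = real n * \<gamma> / f"
  let ?m = "scaled_mean n f \<gamma> \<alpha> \<beta> s q" and ?p = "scaled_precision n \<alpha> \<beta> q"
  have i: "i \<le> n" and j: "j = Suc n - Suc i" using Suc.hyps(2) by auto
  define \<theta> where "\<theta> k = (\<alpha> $ k + s $ k / (2 * \<gamma>) + real (q $ k) / 2) / (\<alpha> $ k + \<beta> $ k + real (q $ k))" for k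
  define Wp where "Wp k = opt_reward \<gamma> \<alpha> \<beta> n (Suc i) (s + \<gamma> *\<^sub>R axis k 1) (q + axis k 1)" for k
  define Wm where "Wm k = opt_reward \<gamma> \<alpha> \<beta> n (Suc i) (s - \<gamma> *\<^sub>R axis k 1) (q + axis k 1)" for k
  have \<Gamma>: "0 < \<Gamma>" using n pos by (simp add: \<Gamma>_def)
  \<comment> \<open>The success probability in the rescaled coordinates is
    \<open>(\<Gamma> + m $ k) / (2 * \<Gamma>)\<close>.\<close>
  have \<theta>: "2 * \<Gamma> * \<theta> k = \<Gamma> + ?m $ k" for k
  proof -
    define B where "B = \<alpha> $ k + \<beta> $ k + real (q $ k)"
    have B: "0 < B" using pos(3)[of k] pos(4)[of k] by (simp add: B_def)
    have "\<theta> k = (\<alpha> $ k + s $ k / (2 * \<gamma>) + real (q $ k) / 2) / B" by (simp add: \<theta>_def B_def)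
    then have "2 * \<Gamma> * \<theta> k = real n / f * (2 * \<gamma> * (\<alpha> $ k + s $ k / (2 * \<gamma>) + real (q $ k) / 2)) / B"
      by (simp add: \<Gamma>_def)
    also have "2 * \<gamma> * (\<alpha> $ k + s $ k / (2 * \<gamma>) + real (q $ k) / 2) = \<gamma> * B + (\<gamma> * (\<alpha> $ k - \<beta> $ k) + s $ k)"
      using pos(1) by (simp add: B_def distrib_left right_diff_distrib)
    also have "real n / f * (\<gamma> * B + G) / B = \<Gamma> + real n / f * G / B" for G
      using B by (simp add: \<Gamma>_def distrib_left add_divide_distrib)
    also have "real n / f * (\<gamma> * (\<alpha> $ k - \<beta> $ k) + s $ k) / B = ?m $ k"
      by (simp add: scaled_mean_def B_def)
    finally show ?thesis .
  qed
  have Wp: "Wp k / f = bandit_value \<Gamma> h j (?m + (h * (\<Gamma> - ?m $ k) / (?p $ k + h)) *\<^sub>R axis k 1) (?p + h *\<^sub>R axis k 1)" for k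
  proof -
    have "admissible \<gamma> (Suc i) (s + \<gamma> *\<^sub>R axis k 1) (q + axis k 1)"
      using admissible_step[OF Suc.prems(2), of \<gamma> k] by simp
    from Suc.hyps(1)[OF j _ this] i show ?thesis
      unfolding Wp_def h_def \<Gamma>_def j scaled_state_step(1,2)[OF n pos(2-4)] by simp
  qed
  have Wm: "Wm k / f = bandit_value \<Gamma> h j (?m - (h * (\<Gamma> + ?m $ k) / (?p $ k + h)) *\<^sub>R axis k 1) (?p + h *\<^sub>R axis k 1)" for k
  proof -
    have "admissible \<gamma> (Suc i) (s - \<gamma> *\<^sub>R axis k 1) (q + axis k 1)"
      using admissible_step[OF Suc.prems(2), of "- \<gamma>" k] by simp
    from Suc.hyps(1)[OF j _ this] i show ?thesis
      unfolding Wm_def h_def \<Gamma>_def j scaled_state_step(1,3)[OF n pos(2-4)] by simp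
  qed
  have arm: "(\<theta> k * (\<gamma> + Wp k) + (1 - \<theta> k) * (- \<gamma> + Wm k)) / f
     = h * ?m $ k + ((\<Gamma> + ?m $ k) * (Wp k / f) + (\<Gamma> - ?m $ k) * (Wm k / f)) / (2 * \<Gamma>)" for k
  proof -
    have 1: "\<Gamma> - ?m $ k = 2 * \<Gamma> * (1 - \<theta> k)" "?m $ k = \<Gamma> * (2 * \<theta> k - 1)"
      using \<theta>[of k] by (simp_all add: algebra_simps)
    have "((\<Gamma> + ?m $ k) * (Wp k / f) + (\<Gamma> - ?m $ k) * (Wm k / f)) / (2 * \<Gamma>) = \<theta> k * (Wp k / f) + (1 - \<theta> k) * (Wm k / f)"
      unfolding 1(1) \<theta>[symmetric] add_divide_distrib using \<Gamma> by simp
    moreover have "h * ?m $ k = (\<gamma> * (2 * \<theta> k - 1)) / f"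
      unfolding 1(2) using n by (simp add: h_def \<Gamma>_def)
    ultimately show ?thesis
      by (simp add: distrib_left add_divide_distrib algebra_simps diff_divide_distrib)
  qed
  have "opt_reward \<gamma> \<alpha> \<beta> n i s q / f = (MAX k\<in>UNIV. \<theta> k * (\<gamma> + Wp k) + (1 - \<theta> k) * (- \<gamma> + Wm k)) / f"
    unfolding opt_reward_Suc[OF i pos(1,3,4) Suc.prems(2)] \<theta>_def Wp_def Wm_def ..
  also have "\<dots> = (MAX k\<in>UNIV. (\<theta> k * (\<gamma> + Wp k) + (1 - \<theta> k) * (- \<gamma> + Wm k)) / f)"
    using mono_Max_commute[of "\<lambda>x. x / f" "range (\<lambda>k. \<theta> k * (\<gamma> + Wp k) + (1 - \<theta> k) * (- \<gamma> + Wm k))"] pos(2)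
    by (simp add: monoI divide_right_mono image_image)
  also have "\<dots> = bandit_value \<Gamma> h (Suc j) ?m ?p"
    unfolding arm bandit_value.simps(2) Wp Wm ..
  finally show ?case unfolding Suc.hyps(2) h_def \<Gamma>_def .
qed

text \<open>With \<open>j\<close> successes the numerator is \<gamma> times
  \<open>(\<alpha> $ k + j) - (\<beta> $ k + q $ k - j)\<close>, a difference of positive numbers
  whose sum is the denominator.\<close>

lemma scaled_mean_bound:
  fixes \<alpha> \<beta> s :: "real^'k::finite" and q :: "nat^'k" and \<gamma> f :: real
  assumes "0 < \<gamma>" "0 < f" "\<And>k. 0 < \<alpha> $ k" "\<And>k. 0 < \<beta> $ k" "admissible \<gamma> i s q"
  shows "\<bar>scaled_mean n f \<gamma> \<alpha> \<beta> s q $ k\<bar> \<le> real n * \<gamma> / f"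
proof -
  obtain j where j: "j \<le> q $ k" "s $ k = - \<gamma> * real (q $ k) + 2 * \<gamma> * real j"
    using assms(5) unfolding admissible_def by blast
  define B where "B = \<alpha> $ k + \<beta> $ k + real (q $ k)"
  have B: "0 < B" using assms(3)[of k] assms(4)[of k] by (simp add: B_def)
  have G: "\<gamma> * (\<alpha> $ k - \<beta> $ k) + s $ k = \<gamma> * (\<alpha> $ k - \<beta> $ k - real (q $ k) + 2 * real j)"
    unfolding j(2) by (simp add: algebra_simps)
  have "\<bar>\<alpha> $ k - \<beta> $ k - real (q $ k) + 2 * real j\<bar> \<le> B"
    using j(1) assms(3)[of k] assms(4)[of k] unfolding B_def by (intro abs_leI) auto
  then have "\<bar>\<gamma> * (\<alpha> $ k - \<beta> $ k) + s $ k\<bar> \<le> \<gamma> * B"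
    unfolding G using assms(1) by (simp add: abs_mult)
  then have "real n / f * \<bar>\<gamma> * (\<alpha> $ k - \<beta> $ k) + s $ k\<bar> / B \<le> real n / f * (\<gamma> * B) / B"
    using B assms(2) by (intro divide_right_mono mult_left_mono) auto
  then show ?thesis
    using B assms(2) by (simp add: scaled_mean_def B_def[symmetric] abs_mult)
qed

section \<open>Convergence of the rescaled bandit value\<close>

text \<open>A cost of order h^(3/2) over about \<open>r / h\<close> rounds leaves sqrt h. The growth
  term stays bounded because \<open>j * h\<^sup>2 * \<Gamma>\<^sup>2\<close> is \<open>j / n\<close>
  times the square of the converging volatility.\<close>

lemma penalty_tendsto_0:
  assumes "(\<lambda>n. real (j n) / real n) \<longlonglongrightarrow> r" "m \<longlonglongrightarrow> m0" "(\<lambda>n. sqrt (real n) / f n * \<gamma> n) \<longlonglongrightarrow> \<sigma>" "0 < d" "\<And>n. 0 < n \<Longrightarrow> 0 < f n"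
  shows "(\<lambda>n. penalty (1 / real n) (real n * \<gamma> n / f n) d (c * (1 / real n * sqrt (1 / real n))) (j n) (m n)) \<longlonglongrightarrow> 0"
proof (rule Lim_transform_eventually)
  show "(\<lambda>n. real (j n) / real n * (c * sqrt (1 / real n)) * ((norm (m n))\<^sup>2 + real (j n) / real n * (sqrt (real n) / f n * \<gamma> n)\<^sup>2 / d\<^sup>2)) \<longlonglongrightarrow> 0"
  proof -
    have "(\<lambda>n. real (j n) / real n * (c * sqrt (1 / real n)) * ((norm (m n))\<^sup>2 + real (j n) / real n * (sqrt (real n) / f n * \<gamma> n)\<^sup>2 / d\<^sup>2))
      \<longlonglongrightarrow> r * (c * sqrt 0) * ((norm m0)\<^sup>2 + r * \<sigma>\<^sup>2 / d\<^sup>2)"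
      by (intro tendsto_intros assms lim_1_over_n) (use assms(4) in auto)
    then show ?thesis by simp
  qed
  show "\<forall>\<^sub>F n in sequentially. real (j n) / real n * (c * sqrt (1 / real n)) * ((norm (m n))\<^sup>2 + real (j n) / real n * (sqrt (real n) / f n * \<gamma> n)\<^sup>2 / d\<^sup>2)
     = penalty (1 / real n) (real n * \<gamma> n / f n) d (c * (1 / real n * sqrt (1 / real n))) (j n) (m n)"
    using eventually_gt_at_top[of 0]
  proof eventually_elim
    case (elim n)
    have "(sqrt (real n) / f n * \<gamma> n)\<^sup>2 = real n * (\<gamma> n / f n)\<^sup>2"
      by (simp add: power_mult_distrib power_divide)
    moreover have "(1 / real n)\<^sup>2 * (real n * \<gamma> n / f n)\<^sup>2 = (\<gamma> n / f n)\<^sup>2"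
      using elim by (simp add: power_mult_distrib power_divide)
    moreover have "real (j n) / real n * (real n * (\<gamma> n / f n)\<^sup>2) / d\<^sup>2 = real (j n) * ((\<gamma> n / f n)\<^sup>2 / d\<^sup>2)"
      using elim by simp
    ultimately show ?case
      unfolding penalty_def by (simp add: mult_ac)
  qed
qed

text \<open>A strict inequality for the limit persists at a volatility \<sigma>' slightly above or
  below \<sigma>. The gap between \<sigma> and \<sigma>' orders the steps of bandit and walk away
  from large means, and the penalty for large means vanishes.\<close>

lemma opt_reward_tendsto:
  fixes \<gamma> f :: "nat \<Rightarrow> real" and \<alpha> \<beta> sn :: "nat \<Rightarrow> real^'k::finite" and qn :: "nat \<Rightarrow> nat^'k"
  assumes pos: "\<And>n. n > 0 \<Longrightarrow> \<gamma> n > 0" "\<And>n k. n > 0 \<Longrightarrow> \<alpha> n $ k > 0" "\<And>n k. n > 0 \<Longrightarrow> \<beta> n $ k > 0" "\<And>n. n > 0 \<Longrightarrow> f n > 0"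
    and vol: "(\<lambda>n. sqrt (real n) / f n * \<gamma> n) \<longlonglongrightarrow> \<sigma>"
    and i: "\<And>n. n > 0 \<Longrightarrow> i n \<in> {1..n + 1}" and adm: "\<And>n. n > 0 \<Longrightarrow> admissible (\<gamma> n) (i n) (sn n) (qn n)"
    and j: "(\<lambda>n. real (Suc n - i n) / real n) \<longlonglongrightarrow> r"
    and m: "(\<lambda>n. scaled_mean n (f n) (\<gamma> n) (\<alpha> n) (\<beta> n) (sn n) (qn n)) \<longlonglongrightarrow> m"
    and p: "(\<lambda>n. scaled_precision n (\<alpha> n) (\<beta> n) (qn n)) \<longlonglongrightarrow> p"
    and p0: "\<And>k. 0 < p $ k"
  shows "(\<lambda>n. opt_reward (\<gamma> n) (\<alpha> n) (\<beta> n) n (i n) (sn n) (qn n) / f n) \<longlonglongrightarrow> lim_value \<sigma> r m p"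
proof -
  let ?W = "\<lambda>n. opt_reward (\<gamma> n) (\<alpha> n) (\<beta> n) n (i n) (sn n) (qn n) / f n"
  let ?j = "\<lambda>n. Suc n - i n"
  let ?m = "\<lambda>n. scaled_mean n (f n) (\<gamma> n) (\<alpha> n) (\<beta> n) (sn n) (qn n)"
  let ?p = "\<lambda>n. scaled_precision n (\<alpha> n) (\<beta> n) (qn n)"
  let ?\<Gamma> = "\<lambda>n. real n * \<gamma> n / f n"
  let ?\<sigma> = "\<lambda>n. sqrt (real n) / f n * \<gamma> n"
  let ?pen = "\<lambda>d c n. penalty (1 / real n) (?\<Gamma> n) d (c * (1 / real n * sqrt (1 / real n))) (?j n) (?m n)"
  obtain d' where d': "0 < d'" "\<And>k. d' \<le> p $ k" using positive_vector_bounded_below[OF p0] by blast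
  \<comment> \<open>Half of the lower bound for the limit bounds all the precisions from below for
    large \<open>n\<close>.\<close>
  define d where "d = d' / 2"
  have d: "0 < d" using d' by (simp add: d_def)
  have "d < p $ k" for k using d'(1) d'(2)[of k] unfolding d_def by linarith
  then have evp: "\<forall>\<^sub>F n in sequentially. \<forall>k. d < ?p n $ k"
    by (intro eventually_all_finite order_tendstoD(1)[OF tendsto_vec_nth[OF p]])
  have r: "0 \<le> r" by (rule LIMSEQ_le_const[OF j]) auto
  have \<sigma>: "0 \<le> \<sigma>"
  proof (rule LIMSEQ_le_const[OF vol])
    have "0 \<le> ?\<sigma> n" if "1 \<le> n" for n using pos(1)[of n] pos(4)[of n] that by simp
    then show "\<exists>N. \<forall>n\<ge>N. 0 \<le> ?\<sigma> n" by blast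
  qed
  have W: "?W n = bandit_value (?\<Gamma> n) (1 / real n) (?j n) (?m n) (?p n)" if "0 < n" for n
    by (rule opt_reward_eq_bandit_value) (use that pos i[OF that] adm[OF that] in auto)
  have \<Gamma>\<sigma>: "?\<Gamma> n * sqrt (1 / real n) = ?\<sigma> n" if "0 < n" for n
  proof -
    have "real n * sqrt (1 / real n) = sqrt (real n)"
      using real_div_sqrt[of "real n"] by (simp add: real_sqrt_divide)
    moreover have "?\<Gamma> n * sqrt (1 / real n) = real n * sqrt (1 / real n) / f n * \<gamma> n" by simp
    ultimately show ?thesis by (simp only:)
  qed
  have walk: "(\<lambda>n. walk_value s (1 / real n) (?j n) (?m n) (?p n)) \<longlonglongrightarrow> lim_value s r m p" if "0 \<le> s" for s
    by (rule tendsto_lim_value[OF filterlim_ident j m p r that p0])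
  show ?thesis
  proof (rule order_tendstoI)
    fix y assume "lim_value \<sigma> r m p < y"
    then obtain \<sigma>' where \<sigma>': "\<sigma> < \<sigma>'" "lim_value \<sigma>' r m p < y"
      using lim_value_upper_volatility[OF r \<sigma> p0] by blast
    \<comment> \<open>One \<delta> absorbs the convergence of the volatilities to \<sigma>, the
      other the asymmetry of the increments.\<close>
    define \<delta> where "\<delta> = (\<sigma>' - \<sigma>) / 2"
    have \<delta>: "0 < \<delta>" "\<sigma>' = (\<sigma> + \<delta>) + \<delta>" using \<sigma>' by (auto simp: \<delta>_def field_simps)
    define c where "c = (\<sigma> + \<delta>) / (d * \<delta>\<^sup>2)"
    have "(\<lambda>n. walk_value \<sigma>' (1 / real n) (?j n) (?m n) (?p n) + ?pen d c n) \<longlonglongrightarrow> lim_value \<sigma>' r m p + 0"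
      by (intro tendsto_add walk penalty_tendsto_0[OF j m vol d pos(4)]) (use \<sigma> \<sigma>' in auto)
    then have "\<forall>\<^sub>F n in sequentially. walk_value \<sigma>' (1 / real n) (?j n) (?m n) (?p n) + ?pen d c n < y"
      using \<sigma>'(2) by (intro order_tendstoD(2)) auto
    moreover have "\<forall>\<^sub>F n in sequentially. ?\<sigma> n < \<sigma> + \<delta>" using \<delta> by (intro order_tendstoD(2)[OF vol]) auto
    ultimately show "\<forall>\<^sub>F n in sequentially. ?W n < y" using evp eventually_gt_at_top[of 0]
    proof eventually_elim
      case (elim n)
      note n = elim(4)
      have \<Gamma>0: "0 < ?\<Gamma> n" using n pos by simp
      have vol_le: "?\<Gamma> n * sqrt (1 / real n) \<le> \<sigma> + \<delta>" unfolding \<Gamma>\<sigma>[OF n] using elim(2) by (rule less_imp_le)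
      have "bandit_value (?\<Gamma> n) (1 / real n) (?j n) (?m n) (?p n)
         \<le> walk_value \<sigma>' (1 / real n) (?j n) (?m n) (?p n) + ?pen d c n"
      proof (rule bandit_value_le_walk_value)
        show "0 \<le> c * (1 / real n * sqrt (1 / real n))" using \<sigma> \<delta> d by (simp add: c_def)
        show "1 / real n * (?\<Gamma> n + \<bar>x\<bar>) / (y + 1 / real n) \<le> step_size \<sigma>' (1 / real n) y \<or>
           1 * (1 / real n * ?\<Gamma> n / d) \<le> c * (1 / real n * sqrt (1 / real n)) * x\<^sup>2" if "\<bar>x\<bar> \<le> ?\<Gamma> n" "d \<le> y" for x y
          unfolding \<delta>(2) c_def
          by (rule volatility_step_upper[OF _ d that(2) \<Gamma>0 vol_le \<delta>(1)]) (use n in simp)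
        \<comment> \<open>At most \<open>n\<close> rounds remain, whence the Lipschitz constant
          \<open>T = 1\<close> in the step conditions.\<close>
        show "real (?j n) * (1 / real n) \<le> 1" using i[OF n] n by auto
        show "\<bar>?m n $ k\<bar> \<le> ?\<Gamma> n" for k by (rule scaled_mean_bound) (use pos n adm in auto)
      qed (use n pos d \<sigma> \<sigma>' elim in \<open>auto intro: less_imp_le\<close>)
      then show ?case using elim(1) W[OF n] by simp
    qed
  next
    fix y assume "y < lim_value \<sigma> r m p"
    then obtain \<sigma>' where \<sigma>': "0 \<le> \<sigma>'" "\<sigma>' < \<sigma> \<or> \<sigma>' = 0" "y < lim_value \<sigma>' r m p"
      using lim_value_lower_volatility[OF r \<sigma> p0] by blast
    \<comment> \<open>If \<sigma>' is not below \<sigma>, then \<sigma>' = 0, all steps of the walk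
      vanish, and any positive number will do.\<close>
    define \<delta> where "\<delta> = (if \<sigma>' < \<sigma> then (\<sigma> - \<sigma>') / 2 else 1)"
    have \<delta>: "0 < \<delta>" by (auto simp: \<delta>_def)
    define c where "c = \<sigma>' / (d * \<delta>\<^sup>2)"
    have "(\<lambda>n. walk_value \<sigma>' (1 / real n) (?j n) (?m n) (?p n) - ?pen d c n) \<longlonglongrightarrow> lim_value \<sigma>' r m p - 0"
      by (intro tendsto_diff walk penalty_tendsto_0[OF j m vol d pos(4)]) (use \<sigma>' in auto)
    then have "\<forall>\<^sub>F n in sequentially. y < walk_value \<sigma>' (1 / real n) (?j n) (?m n) (?p n) - ?pen d c n"
      using \<sigma>'(3) by (intro order_tendstoD(1)) auto
    moreover have "\<forall>\<^sub>F n in sequentially. \<sigma>' < \<sigma> \<longrightarrow> \<sigma>' * (1 + 1 / real n / d) + \<delta> < ?\<sigma> n"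
    proof (cases "\<sigma>' < \<sigma>")
      case True
      have "(\<lambda>n. ?\<sigma> n - (\<sigma>' * (1 + 1 / real n / d) + \<delta>)) \<longlonglongrightarrow> \<sigma> - (\<sigma>' * (1 + 0 / d) + \<delta>)"
        by (intro tendsto_intros vol lim_1_over_n) (use d in auto)
      moreover have "0 < \<sigma> - (\<sigma>' * (1 + 0 / d) + \<delta>)" using True by (simp add: \<delta>_def field_simps)
      ultimately have "\<forall>\<^sub>F n in sequentially. 0 < ?\<sigma> n - (\<sigma>' * (1 + 1 / real n / d) + \<delta>)" by (rule order_tendstoD(1))
      then show ?thesis by (rule eventually_mono) linarith
    qed simp
    ultimately show "\<forall>\<^sub>F n in sequentially. y < ?W n" using evp eventually_gt_at_top[of 0]
    proof eventually_elim
      case (elim n)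
      note n = elim(4)
      have \<Gamma>0: "0 < ?\<Gamma> n" using n pos by simp
      have "walk_value \<sigma>' (1 / real n) (?j n) (?m n) (?p n)
         \<le> bandit_value (?\<Gamma> n) (1 / real n) (?j n) (?m n) (?p n) + ?pen d c n"
      proof (rule walk_value_le_bandit_value)
        show \<kappa>: "0 \<le> c * (1 / real n * sqrt (1 / real n))" using \<sigma>' d by (simp add: c_def)
        show "step_size \<sigma>' (1 / real n) y \<le> 1 / real n * (?\<Gamma> n - \<bar>x\<bar>) / (y + 1 / real n) \<or>
           1 * step_size \<sigma>' (1 / real n) y \<le> c * (1 / real n * sqrt (1 / real n)) * x\<^sup>2" if "\<bar>x\<bar> \<le> ?\<Gamma> n" "d \<le> y" for x y
        proof (cases "\<sigma>' < \<sigma>")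
          case True
          then have vol_ge: "\<sigma>' * (1 + 1 / real n / d) + \<delta> \<le> ?\<Gamma> n * sqrt (1 / real n)"
            unfolding \<Gamma>\<sigma>[OF n] using elim(2) by (intro less_imp_le) blast
          show ?thesis unfolding c_def
            by (rule volatility_step_lower[OF _ d that(2) \<Gamma>0 \<sigma>'(1) vol_ge \<delta>]) (use n in simp)
        next
          case False
          then have "\<sigma>' = 0" using \<sigma>' by simp
          then show ?thesis by (simp add: step_size_def c_def)
        qed
        show "real (?j n) * (1 / real n) \<le> 1" using i[OF n] n by auto
        show "\<bar>?m n $ k\<bar> \<le> ?\<Gamma> n" for k by (rule scaled_mean_bound) (use pos n adm in auto)
      qed (use n pos d \<sigma>' elim in \<open>auto intro: less_imp_le\<close>)
      then show ?case using elim(1) W[OF n] by simp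
    qed
  qed
qed

section \<open>The viscosity property\<close>

lemma second_order_taylor:
  fixes \<phi> :: "'a::real_normed_vector \<Rightarrow> real" and D :: "'a \<Rightarrow> 'a \<Rightarrow>\<^sub>L real" and D2 :: "'a \<Rightarrow> 'a \<Rightarrow>\<^sub>L 'a \<Rightarrow>\<^sub>L real"
  assumes "\<And>t. t \<in> {0..1} \<Longrightarrow> x + t *\<^sub>R y \<in> S"
    and D: "\<And>z. z \<in> S \<Longrightarrow> (\<phi> has_derivative D z) (at z)" "\<And>z. z \<in> S \<Longrightarrow> (D has_derivative D2 z) (at z)"
  shows "\<exists>t\<in>{0..1}. \<phi> (x + y) = \<phi> x + D x y + D2 (x + t *\<^sub>R y) y y / 2"
proof -
  define diff where "diff n = (\<lambda>t. if n = 0 then \<phi> (x + t *\<^sub>R y)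
    else if n = 1 then D (x + t *\<^sub>R y) y else D2 (x + t *\<^sub>R y) y y)" for n :: nat
  have line: "((\<lambda>t. x + t *\<^sub>R y) has_derivative (\<lambda>t. t *\<^sub>R y)) (at t)" for t
    by (auto intro!: derivative_eq_intros)
  have "\<exists>t>0. t < 1 \<and> diff 0 1 = (\<Sum>m<2. diff m 0 / fact m * 1 ^ m) + diff 2 t / fact 2 * 1 ^ 2"
  proof (rule Maclaurin)
    show "\<forall>m t. m < 2 \<and> 0 \<le> t \<and> t \<le> (1::real) \<longrightarrow> (diff m has_real_derivative diff (Suc m) t) (at t)"
    proof (intro allI impI)
      fix m :: nat and t :: real assume *: "m < 2 \<and> 0 \<le> t \<and> t \<le> 1"
      then have S: "x + t *\<^sub>R y \<in> S" by (intro assms(1)) auto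
      consider "m = 0" | "m = 1" using * by linarith
      then show "(diff m has_real_derivative diff (Suc m) t) (at t)"
      proof cases
        case 1
        have "((\<lambda>t. \<phi> (x + t *\<^sub>R y)) has_derivative (\<lambda>h. D (x + t *\<^sub>R y) (h *\<^sub>R y))) (at t)"
          using has_derivative_compose[OF line D(1)[OF S]] .
        then show ?thesis unfolding 1 diff_def
          by (intro has_derivative_imp_has_field_derivative) (auto simp: blinfun.scaleR_right)
      next
        case 2
        have "((\<lambda>t. D (x + t *\<^sub>R y)) has_derivative (\<lambda>h. D2 (x + t *\<^sub>R y) (h *\<^sub>R y))) (at t)"
          using has_derivative_compose[OF line D(2)[OF S]] .
        then have "((\<lambda>t. D (x + t *\<^sub>R y) y) has_derivative (\<lambda>h. D2 (x + t *\<^sub>R y) (h *\<^sub>R y) y)) (at t)"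
          by (auto intro!: derivative_eq_intros)
        then show ?thesis unfolding 2 diff_def
          by (intro has_derivative_imp_has_field_derivative) (auto simp: blinfun.scaleR_right blinfun.scaleR_left)
      qed
    qed
  qed auto
  then obtain t where "0 < t" "t < 1" "\<phi> (x + y) = \<phi> x + D x y + D2 (x + t *\<^sub>R y) y y / 2"
    by (auto simp: diff_def numeral_2_eq_2)
  then show ?thesis by (intro bexI[of _ t]) auto
qed

text \<open>The noise enters with both signs, so its first-order term cancels; of the quadratic
  terms only the one in the noise survives division by \<open>h\<close>. The base point moves as
  well, which continuity of both derivatives allows.\<close>

lemma second_order_limit:
  fixes \<phi> :: "'a::real_normed_vector \<Rightarrow> real" and D :: "'a \<Rightarrow> 'a \<Rightarrow>\<^sub>L real" and D2 :: "'a \<Rightarrow> 'a \<Rightarrow>\<^sub>L 'a \<Rightarrow>\<^sub>L real"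
  assumes U: "open U" "x0 \<in> U" and D: "\<And>z. z \<in> U \<Longrightarrow> (\<phi> has_derivative D z) (at z)" "\<And>z. z \<in> U \<Longrightarrow> (D has_derivative D2 z) (at z)"
    and D2: "continuous_on U D2"
    and x: "(x \<longlongrightarrow> x0) F" and u: "(u \<longlongrightarrow> u0) F" and z: "(z \<longlongrightarrow> z0) F" and h: "(h \<longlongrightarrow> 0) F" "\<forall>\<^sub>F i in F. (0::real) < h i"
  shows "((\<lambda>i. ((\<phi> (x i + (h i *\<^sub>R u i + sqrt (h i) *\<^sub>R z i)) + \<phi> (x i + (h i *\<^sub>R u i - sqrt (h i) *\<^sub>R z i))) / 2 - \<phi> (x i)) / h i)
     \<longlongrightarrow> D x0 u0 + D2 x0 z0 z0 / 2) F"
proof -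
  obtain \<rho> where \<rho>: "0 < \<rho>" "ball x0 \<rho> \<subseteq> U" using U openE by blast
  define y where "y s i = h i *\<^sub>R u i + (s * sqrt (h i)) *\<^sub>R z i" for s i
  have y0: "((\<lambda>i. y s i) \<longlongrightarrow> 0) F" for s
  proof -
    have "((\<lambda>i. y s i) \<longlongrightarrow> 0 *\<^sub>R u0 + (s * sqrt 0) *\<^sub>R z0) F"
      unfolding y_def by (intro tendsto_intros h u z)
    then show ?thesis by simp
  qed
  \<comment> \<open>An intermediate point is available only when both endpoints lie in the ball; the
    implication allows a choice for every index.\<close>
  define taylor where "taylor s i \<xi> \<longleftrightarrow> (x i \<in> ball x0 \<rho> \<and> x i + y s i \<in> ball x0 \<rho> \<longrightarrow> (norm (\<xi> - x i) \<le> norm (y s i) \<and>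
      \<phi> (x i + y s i) = \<phi> (x i) + D (x i) (y s i) + D2 \<xi> (y s i) (y s i) / 2))" for s i \<xi>
  have ex: "\<exists>\<xi>. taylor s i \<xi>" for s i
  proof (cases "x i \<in> ball x0 \<rho> \<and> x i + y s i \<in> ball x0 \<rho>")
    case True
    have seg: "x i + t *\<^sub>R y s i \<in> ball x0 \<rho>" if "t \<in> {0..1}" for t
    proof -
      have "(1 - t) *\<^sub>R x i + t *\<^sub>R (x i + y s i) \<in> ball x0 \<rho>"
        using convexD_alt[OF convex_ball, of "x i" x0 \<rho> "x i + y s i" t] True that by auto
      then show ?thesis by (simp add: algebra_simps)
    qed
    obtain t where t: "t \<in> {0..1}" "\<phi> (x i + y s i) = \<phi> (x i) + D (x i) (y s i) + D2 (x i + t *\<^sub>R y s i) (y s i) (y s i) / 2"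
      using second_order_taylor[of "x i" "y s i" "ball x0 \<rho>" \<phi> D D2, OF seg] D \<rho>(2) by blast
    have "norm (t *\<^sub>R y s i) \<le> norm (y s i)" using t(1) by (simp add: mult_left_le_one_le)
    then show ?thesis unfolding taylor_def using t by (intro exI[of _ "x i + t *\<^sub>R y s i"]) auto
  qed (auto simp: taylor_def)
  define \<xi> where "\<xi> s i = (SOME \<xi>. taylor s i \<xi>)" for s i
  have \<xi>: "x i \<in> ball x0 \<rho> \<and> x i + y s i \<in> ball x0 \<rho> \<longrightarrow> (norm (\<xi> s i - x i) \<le> norm (y s i) \<and>
      \<phi> (x i + y s i) = \<phi> (x i) + D (x i) (y s i) + D2 (\<xi> s i) (y s i) (y s i) / 2)" for s i
    using someI_ex[OF ex[of s i]] unfolding \<xi>_def[symmetric] unfolding taylor_def .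
  have evx: "\<forall>\<^sub>F i in F. x i \<in> ball x0 \<rho>"
    by (rule topological_tendstoD[OF x]) (use \<rho> in auto)
  have evy: "\<forall>\<^sub>F i in F. x i + y s i \<in> ball x0 \<rho>" for s
  proof (rule topological_tendstoD)
    show "((\<lambda>i. x i + y s i) \<longlongrightarrow> x0) F" using tendsto_add[OF x y0[of s]] by simp
  qed (use \<rho> in auto)
  have \<xi>0: "((\<lambda>i. \<xi> s i) \<longlongrightarrow> x0) F" for s
  proof -
    have "((\<lambda>i. \<xi> s i - x i) \<longlongrightarrow> 0) F"
    proof (rule Lim_null_comparison)
      show "\<forall>\<^sub>F i in F. norm (\<xi> s i - x i) \<le> norm (y s i)"
        using evx evy[of s] by eventually_elim (use \<xi> in blast)
      show "((\<lambda>i. norm (y s i)) \<longlongrightarrow> 0) F" using tendsto_norm[OF y0[of s]] by simp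
    qed
    from tendsto_add[OF this x] show ?thesis by simp
  qed
  have "isCont D2 x0" using D2 U by (simp add: continuous_on_eq_continuous_at)
  then have D2\<xi>: "((\<lambda>i. D2 (\<xi> s i)) \<longlongrightarrow> D2 x0) F" for s
    using \<xi>0[of s] isCont_tendsto_compose by blast
  have "isCont D x0" using D(2)[OF U(2)] has_derivative_continuous by blast
  then have Dx: "((\<lambda>i. D (x i)) \<longlongrightarrow> D x0) F" using x isCont_tendsto_compose by blast
  \<comment> \<open>Since \<open>y s i = sqrt (h i) *\<^sub>R e s i\<close>, the quadratic form at
    \<open>y\<close> is \<open>h\<close> times the one at \<open>e\<close>, and \<open>e\<close>
    converges.\<close>
  define e where "e s i = sqrt (h i) *\<^sub>R u i + s *\<^sub>R z i" for s i
  have e: "((\<lambda>i. e s i) \<longlongrightarrow> s *\<^sub>R z0) F" for s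
  proof -
    have "((\<lambda>i. e s i) \<longlongrightarrow> sqrt 0 *\<^sub>R u0 + s *\<^sub>R z0) F"
      unfolding e_def by (intro tendsto_intros h u z)
    then show ?thesis by simp
  qed
  have "((\<lambda>i. D (x i) (u i) + (D2 (\<xi> 1 i) (e 1 i) (e 1 i) + D2 (\<xi> (- 1) i) (e (- 1) i) (e (- 1) i)) / 4)
    \<longlongrightarrow> D x0 u0 + (D2 x0 (1 *\<^sub>R z0) (1 *\<^sub>R z0) + D2 x0 ((- 1) *\<^sub>R z0) ((- 1) *\<^sub>R z0)) / 4) F"
    by (intro tendsto_intros Dx D2\<xi> e u) auto
  also have "D x0 u0 + (D2 x0 (1 *\<^sub>R z0) (1 *\<^sub>R z0) + D2 x0 ((- 1) *\<^sub>R z0) ((- 1) *\<^sub>R z0)) / 4 = D x0 u0 + D2 x0 z0 z0 / 2"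
    by (simp add: blinfun.minus_left blinfun.minus_right)
  finally show ?thesis
  proof (rule Lim_transform_eventually)
    show "\<forall>\<^sub>F i in F. D (x i) (u i) + (D2 (\<xi> 1 i) (e 1 i) (e 1 i) + D2 (\<xi> (- 1) i) (e (- 1) i) (e (- 1) i)) / 4
      = ((\<phi> (x i + (h i *\<^sub>R u i + sqrt (h i) *\<^sub>R z i)) + \<phi> (x i + (h i *\<^sub>R u i - sqrt (h i) *\<^sub>R z i))) / 2 - \<phi> (x i)) / h i"
      using evx evy[of 1] evy[of "-1"] h(2)
    proof eventually_elim
      case (elim i)
      have ye: "y s i = sqrt (h i) *\<^sub>R e s i" for s
        using elim(4) by (simp add: y_def e_def scaleR_add_right)
      have quad: "D2 (\<xi> s i) (y s i) (y s i) = h i * D2 (\<xi> s i) (e s i) (e s i)" for s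
        unfolding ye using elim(4) by (simp add: blinfun.scaleR_left blinfun.scaleR_right flip: mult.assoc)
      have T: "\<phi> (x i + y s i) = \<phi> (x i) + D (x i) (y s i) + h i * D2 (\<xi> s i) (e s i) (e s i) / 2" if "s = 1 \<or> s = -1" for s
        using \<xi>[of i s] elim that unfolding quad by auto
      have lin: "D (x i) (y 1 i) + D (x i) (y (- 1) i) = 2 * h i * D (x i) (u i)"
      proof -
        have "y 1 i + y (- 1) i = (2 * h i) *\<^sub>R u i" by (simp add: y_def flip: scaleR_add_left)
        then show ?thesis by (metis blinfun.add_right blinfun.scaleR_right real_scaleR_def)
      qed
      have "\<phi> (x i + y 1 i) + \<phi> (x i + y (- 1) i) - 2 * \<phi> (x i)
        = 2 * h i * (D (x i) (u i) + (D2 (\<xi> 1 i) (e 1 i) (e 1 i) + D2 (\<xi> (- 1) i) (e (- 1) i) (e (- 1) i)) / 4)"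
      proof -
        have combine: "P + M - 2 * f = 2 * k * (l + (A + B) / 4)"
          if "P = f + l1 + k * A / 2" "M = f + l2 + k * B / 2" "l1 + l2 = 2 * k * l"
          for P M f l l1 l2 k A B :: real
        proof -
          have "P + M - 2 * f = (l1 + l2) + k * A / 2 + k * B / 2" using that by simp
          then show ?thesis unfolding that(3) by (simp add: distrib_left add_divide_distrib mult_ac)
        qed
        show ?thesis by (rule combine[OF T T lin]) simp_all
      qed
      moreover have "y 1 i = h i *\<^sub>R u i + sqrt (h i) *\<^sub>R z i" "y (- 1) i = h i *\<^sub>R u i - sqrt (h i) *\<^sub>R z i"
        by (simp_all add: y_def)
      ultimately show ?case using elim(4) by (simp add: field_simps)
    qed
  qed
qed

text \<open>For the square of the distance to \<open>x0\<close> the expansion is exact, and the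
  gradient at \<open>x i\<close> vanishes in the limit.\<close>

lemma second_order_limit_norm:
  fixes x0 :: "'a::real_inner"
  assumes x: "(x \<longlongrightarrow> x0) F" and u: "(u \<longlongrightarrow> u0) F" and z: "(z \<longlongrightarrow> z0) F" and h: "(h \<longlongrightarrow> 0) F" "\<forall>\<^sub>F i in F. (0::real) < h i"
  shows "((\<lambda>i. (((norm (x i + (h i *\<^sub>R u i + sqrt (h i) *\<^sub>R z i) - x0))\<^sup>2 + (norm (x i + (h i *\<^sub>R u i - sqrt (h i) *\<^sub>R z i) - x0))\<^sup>2) / 2
      - (norm (x i - x0))\<^sup>2) / h i) \<longlongrightarrow> (norm z0)\<^sup>2) F"
proof (rule Lim_transform_eventually)
  have "((\<lambda>i. (norm (z i))\<^sup>2 + 2 * ((x i - x0) \<bullet> u i) + h i * (norm (u i))\<^sup>2) \<longlongrightarrow> (norm z0)\<^sup>2 + 2 * ((x0 - x0) \<bullet> u0) + 0 * (norm u0)\<^sup>2) F"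
    by (intro tendsto_intros x u z h)
  then show "((\<lambda>i. (norm (z i))\<^sup>2 + 2 * ((x i - x0) \<bullet> u i) + h i * (norm (u i))\<^sup>2) \<longlongrightarrow> (norm z0)\<^sup>2) F" by simp
  show "\<forall>\<^sub>F i in F. (norm (z i))\<^sup>2 + 2 * ((x i - x0) \<bullet> u i) + h i * (norm (u i))\<^sup>2
    = (((norm (x i + (h i *\<^sub>R u i + sqrt (h i) *\<^sub>R z i) - x0))\<^sup>2 + (norm (x i + (h i *\<^sub>R u i - sqrt (h i) *\<^sub>R z i) - x0))\<^sup>2) / 2
      - (norm (x i - x0))\<^sup>2) / h i"
    using h(2)
  proof eventually_elim
    case (elim i)
    define a where "a = x i - x0"
    define r where "r = sqrt (h i)"
    have r: "0 < r" "h i = r * r" using elim by (auto simp: r_def)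
    have eq: "x i + v - x0 = a + v" for v by (simp add: a_def)
    have "(norm (a + (h i *\<^sub>R u i + r *\<^sub>R z i)))\<^sup>2 + (norm (a + (h i *\<^sub>R u i - r *\<^sub>R z i)))\<^sup>2
      = 2 * ((norm a)\<^sup>2 + h i * ((norm (z i))\<^sup>2 + 2 * (a \<bullet> u i) + h i * (norm (u i))\<^sup>2))"
      unfolding power2_norm_eq_inner r(2) by (simp add: inner_simps inner_commute algebra_simps)
    then have "((norm (a + (h i *\<^sub>R u i + r *\<^sub>R z i)))\<^sup>2 + (norm (a + (h i *\<^sub>R u i - r *\<^sub>R z i)))\<^sup>2) / 2 - (norm a)\<^sup>2
      = h i * ((norm (z i))\<^sup>2 + 2 * (a \<bullet> u i) + h i * (norm (u i))\<^sup>2)"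
    proof -
      have "S / 2 - N = X" if "S = 2 * (N + X)" for S N X :: real using that by (simp add: field_simps)
      then show ?thesis using \<open>_ = 2 * ((norm a)\<^sup>2 + _)\<close> by blast
    qed
    then show ?case
      unfolding eq a_def[symmetric] r_def[symmetric] using elim by simp
  qed
qed

section \<open>Joint limits and their touching points\<close>

text \<open>Convergence joint in index and point controls \<open>F n y\<close> for all
  \<open>y\<close> near \<open>x\<close> at once; letting \<open>n\<close> grow at a fixed
  \<open>y\<close> transfers the bound to \<open>v y\<close>.\<close>

lemma continuous_convergence_continuous_on:
  fixes v :: "'a::metric_space \<Rightarrow> real"
  assumes "open U" and conv: "\<And>x. x \<in> U \<Longrightarrow> ((\<lambda>(n, y). F n y) \<longlongrightarrow> v x) (sequentially \<times>\<^sub>F nhds x)"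
  shows "continuous_on U v"
proof -
  have "(v \<longlongrightarrow> v x) (at x)" if x: "x \<in> U" for x
  proof (rule tendstoI)
    fix e :: real assume e: "0 < e"
    have "\<forall>\<^sub>F (n, y) in sequentially \<times>\<^sub>F nhds x. dist (F n y) (v x) < e / 2"
      using tendstoD[OF conv[OF x], of "e / 2"] e by (simp add: case_prod_unfold)
    then obtain P Q where P: "eventually P sequentially" and Q: "eventually Q (nhds x)"
      and PQ: "\<And>n y. P n \<Longrightarrow> Q y \<Longrightarrow> dist (F n y) (v x) < e / 2"
      unfolding eventually_prod_filter by auto
    have "\<forall>\<^sub>F y in nhds x. y \<in> U" using assms(1) x by (rule eventually_nhds_in_open)
    with Q have "\<forall>\<^sub>F y in nhds x. dist (v y) (v x) < e"
    proof eventually_elim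
      case (elim y)
      have "filterlim (\<lambda>n. (n, y)) (sequentially \<times>\<^sub>F nhds y) sequentially"
        by (intro filterlim_Pair filterlim_ident) simp
      from filterlim_compose[OF conv[OF elim(2)] this]
      have "(\<lambda>n. F n y) \<longlonglongrightarrow> v y" by simp
      then have "(\<lambda>n. dist (F n y) (v x)) \<longlonglongrightarrow> dist (v y) (v x)" by (intro tendsto_intros)
      then have "dist (v y) (v x) \<le> e / 2"
      proof (rule tendsto_upperbound)
        show "\<forall>\<^sub>F n in sequentially. dist (F n y) (v x) \<le> e / 2"
          using P by eventually_elim (use PQ elim in \<open>auto intro: less_imp_le\<close>)
      qed simp
      then show ?case using e by simp
    qed
    then show "\<forall>\<^sub>F y in at x. dist (v y) (v x) < e"
      by (simp add: eventually_at_filter eventually_mono)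
  qed
  then show ?thesis by (simp add: continuous_on_eq_continuous_at[OF assms(1)] isCont_def)
qed

text \<open>The Barles--Souganidis argument: near-maximisers of the penalised differences converge to the
  point where the limit touches the test function.\<close>

lemma near_maximizers:
  fixes v \<phi> :: "'a::euclidean_space \<Rightarrow> real" and F :: "nat \<Rightarrow> 'a \<Rightarrow> real"
  assumes U: "open U" "x0 \<in> U" and conv: "\<And>x. x \<in> U \<Longrightarrow> ((\<lambda>(n, y). F n y) \<longlongrightarrow> v x) (sequentially \<times>\<^sub>F nhds x)"
    and \<phi>: "continuous_on U \<phi>" and max: "\<forall>\<^sub>F y in nhds x0. v y - \<phi> y \<le> v x0 - \<phi> x0" and \<eta>: "0 < \<eta>"
  obtains \<rho> x and r :: "nat \<Rightarrow> nat" where "0 < \<rho>" "cball x0 \<rho> \<subseteq> U" "filterlim r at_top sequentially" "x \<longlonglongrightarrow> x0"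
    "\<forall>i. \<forall>y\<in>cball x0 \<rho>. F (r i) y - \<phi> y - \<eta> * (norm (y - x0))\<^sup>2
       \<le> F (r i) (x i) - \<phi> (x i) - \<eta> * (norm (x i - x0))\<^sup>2 + (1 / real (r i))\<^sup>2"
proof -
  \<comment> \<open>Joint convergence bounds \<open>F n\<close> near \<open>x0\<close> for large
    \<open>n\<close>, so that the suprema below are finite.\<close>
  have "\<forall>\<^sub>F (n, y) in sequentially \<times>\<^sub>F nhds x0. dist (F n y) (v x0) < 1"
    using tendstoD[OF conv[OF U(2)], of 1] by (simp add: case_prod_unfold)
  then obtain P Q where P: "eventually P sequentially" and Q: "eventually Q (nhds x0)"
    and PQ: "\<And>n y. P n \<Longrightarrow> Q y \<Longrightarrow> dist (F n y) (v x0) < 1"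
    unfolding eventually_prod_filter by auto
  have "\<forall>\<^sub>F y in nhds x0. y \<in> U \<and> Q y \<and> v y - \<phi> y \<le> v x0 - \<phi> x0"
    using eventually_nhds_in_open[OF U] Q max by eventually_elim simp
  then obtain e where e: "0 < e" "\<And>y. dist y x0 < e \<Longrightarrow> y \<in> U \<and> Q y \<and> v y - \<phi> y \<le> v x0 - \<phi> x0"
    unfolding eventually_nhds_metric by blast
  define \<rho> where "\<rho> = e / 2"
  let ?B = "cball x0 \<rho>"
  have \<rho>: "0 < \<rho>" using e by (simp add: \<rho>_def)
  have B: "y \<in> U" "Q y" "v y - \<phi> y \<le> v x0 - \<phi> x0" if "y \<in> ?B" for y
    using e(2)[of y] that e(1) by (auto simp: \<rho>_def dist_commute)
  have x0B: "x0 \<in> ?B" using \<rho> by simp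
  have "compact (\<phi> ` ?B)"
    by (intro compact_continuous_image continuous_on_subset[OF \<phi>] compact_cball) (use B in auto)
  then obtain C where C: "\<And>y. y \<in> ?B \<Longrightarrow> \<bar>\<phi> y\<bar> \<le> C"
    by (meson bounded_real compact_imp_bounded imageI)
  define G where "G n y = F n y - \<phi> y - \<eta> * (norm (y - x0))\<^sup>2" for n y
  obtain n0 where n0: "\<And>n. n \<ge> n0 \<Longrightarrow> P n" using P unfolding eventually_sequentially by blast
  \<comment> \<open>The schemes jump in time, so maximisers may fail to exist. The tolerance is the
    square of the step \<open>1 / n\<close> and remains negligible after division by the
    step.\<close>
  have near: "\<exists>x\<in>?B. \<forall>y\<in>?B. G n y \<le> G n x + (1 / real n)\<^sup>2" if n: "n \<ge> n0" "0 < n" for n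
  proof -
    have "G n y \<le> v x0 + 1 + C" if "y \<in> ?B" for y
    proof -
      have "F n y < v x0 + 1" using PQ[OF n0[OF n(1)] B(2)[OF that]] by (simp add: dist_real_def)
      moreover have "- \<phi> y \<le> C" using C[OF that] by linarith
      moreover have "0 \<le> \<eta> * (norm (y - x0))\<^sup>2" using \<eta> by simp
      ultimately show ?thesis unfolding G_def by linarith
    qed
    then have bdd: "bdd_above (G n ` ?B)" by (intro bdd_aboveI2)
    have "Sup (G n ` ?B) - (1 / real n)\<^sup>2 < Sup (G n ` ?B)" using n by simp
    moreover have "G n ` ?B \<noteq> {}" using x0B by blast
    ultimately obtain x where x: "x \<in> ?B" "Sup (G n ` ?B) - (1 / real n)\<^sup>2 < G n x"
      using less_cSupE by blast
    have "G n y \<le> G n x + (1 / real n)\<^sup>2" if "y \<in> ?B" for y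
      using cSUP_upper[OF that bdd] x(2) by linarith
    then show ?thesis using x(1) by blast
  qed
  have "\<exists>x\<in>?B. \<forall>y\<in>?B. G (Suc (n0 + i)) y \<le> G (Suc (n0 + i)) x + (1 / real (Suc (n0 + i)))\<^sup>2" for i
    by (rule near) simp_all
  then obtain x where xB: "\<And>i. x i \<in> ?B"
    and xmax: "\<And>i y. y \<in> ?B \<Longrightarrow> G (Suc (n0 + i)) y \<le> G (Suc (n0 + i)) (x i) + (1 / real (Suc (n0 + i)))\<^sup>2"
    by metis
  have "compact ?B" by (rule compact_cball)
  then obtain xs r where xs: "xs \<in> ?B" "strict_mono (r :: nat \<Rightarrow> nat)" "(x \<circ> r) \<longlonglongrightarrow> xs"
    using xB unfolding compact_def by metis
  define R where "R i = Suc (n0 + r i)" for i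
  have R: "filterlim R at_top sequentially"
  proof -
    have "strict_mono R" using xs(2) by (auto simp: R_def strict_mono_def)
    then show ?thesis by (rule filterlim_subseq)
  qed
  have lim: "(\<lambda>i. F (R i) (y i)) \<longlonglongrightarrow> v y'" if "y \<longlonglongrightarrow> y'" "y' \<in> ?B" for y y'
  proof -
    have "filterlim (\<lambda>i. (R i, y i)) (sequentially \<times>\<^sub>F nhds y') sequentially"
      using R that(1) by (intro filterlim_Pair)
    from filterlim_compose[OF conv[OF B(1)[OF that(2)]] this] show ?thesis by simp
  qed
  have \<phi>cont: "(\<lambda>i. \<phi> (y i)) \<longlonglongrightarrow> \<phi> y'" if "y \<longlonglongrightarrow> y'" "y' \<in> ?B" for y y'
  proof -
    have "isCont \<phi> y'" using \<phi> B(1)[OF that(2)] U(1) by (simp add: continuous_on_eq_continuous_at)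
    then show ?thesis using that(1) by (rule isCont_tendsto_compose)
  qed
  have xr: "(\<lambda>i. x (r i)) \<longlonglongrightarrow> xs" using xs(3) by (simp add: comp_def)
  have G1: "(\<lambda>i. G (R i) (x (r i)) + (1 / real (R i))\<^sup>2) \<longlonglongrightarrow> (v xs - \<phi> xs - \<eta> * (norm (xs - x0))\<^sup>2) + 0\<^sup>2"
    unfolding G_def by (intro tendsto_intros lim \<phi>cont xr xs filterlim_compose[OF lim_1_over_n R])
  have G2: "(\<lambda>i. G (R i) x0) \<longlonglongrightarrow> v x0 - \<phi> x0 - \<eta> * (norm (x0 - x0))\<^sup>2"
    unfolding G_def by (intro tendsto_intros lim \<phi>cont x0B)
  \<comment> \<open>Near-maximality passes to the limit; as \<open>x0\<close> maximises
    \<open>v - \<phi>\<close> on the ball, the penalty leaves no room for \<open>xs\<close> to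
    differ from it.\<close>
  have "v x0 - \<phi> x0 - \<eta> * (norm (x0 - x0))\<^sup>2 \<le> (v xs - \<phi> xs - \<eta> * (norm (xs - x0))\<^sup>2) + 0\<^sup>2"
  proof (rule LIMSEQ_le[OF G2 G1])
    show "\<exists>N. \<forall>i\<ge>N. G (R i) x0 \<le> G (R i) (x (r i)) + (1 / real (R i))\<^sup>2"
      using xmax[OF x0B] unfolding R_def by blast
  qed
  then have "\<eta> * (norm (xs - x0))\<^sup>2 \<le> 0" using B(3)[OF xs(1)] by simp
  then have "xs = x0" using \<eta> by (simp add: mult_le_0_iff)
  show ?thesis
  proof (rule that)
    show "0 < \<rho>" by (rule \<rho>)
    show "?B \<subseteq> U" using B(1) by blast
    show "filterlim R at_top sequentially" by (rule R)
    show "(\<lambda>i. x (r i)) \<longlonglongrightarrow> x0" using xr \<open>xs = x0\<close> by simp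
    show "\<forall>i. \<forall>y\<in>?B. F (R i) y - \<phi> y - \<eta> * (norm (y - x0))\<^sup>2
       \<le> F (R i) (x (r i)) - \<phi> (x (r i)) - \<eta> * (norm (x (r i) - x0))\<^sup>2 + (1 / real (R i))\<^sup>2"
      using xmax unfolding G_def R_def by blast
  qed
qed

section \<open>The symmetric scheme in the coordinates of the equation\<close>

definition post_mean :: "real^'k \<Rightarrow> real^'k \<Rightarrow> real^'k \<Rightarrow> real^'k \<Rightarrow> real^'k::finite" where
  "post_mean a b s q = (\<chi> k. (a $ k + s $ k) / (b $ k + q $ k))"

text \<open>Defined at every real point, not only on a grid, so that it can be evaluated at
  arbitrary near-maximisers; rounding down the remaining rounds makes it a step function of
  time.\<close>

definition hjb_scheme :: "real \<Rightarrow> real^'k \<Rightarrow> real^'k \<Rightarrow> nat \<Rightarrow> real \<times> (real^'k) \<times> (real^'k::finite) \<Rightarrow> real" where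
  "hjb_scheme \<sigma> a b n = (\<lambda>(t, s, q). walk_value \<sigma> (1 / real n) (nat \<lfloor>(1 - t) * real n\<rfloor>) (post_mean a b s q) (b + q))"

definition hjb_value :: "real \<Rightarrow> real^'k \<Rightarrow> real^'k \<Rightarrow> real \<times> (real^'k) \<times> (real^'k::finite) \<Rightarrow> real" where
  "hjb_value \<sigma> a b = (\<lambda>(t, s, q). lim_value \<sigma> (1 - t) (post_mean a b s q) (b + q))"

lemma tendsto_post_mean:
  assumes "(s \<longlongrightarrow> s0) F" "(q \<longlongrightarrow> q0) F" "\<And>k. 0 < b $ k + q0 $ k"
  shows "((\<lambda>i. post_mean a b (s i) (q i)) \<longlongrightarrow> post_mean a b s0 q0) F"
  unfolding post_mean_def
  by (intro tendsto_vec_lambda tendsto_intros assms) (use assms(3) in \<open>auto simp: less_le\<close>)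

lemma hjb_scheme_tendsto:
  fixes b q0 :: "real^'k::finite"
  assumes "0 \<le> \<sigma>" "t0 \<le> 1" "\<And>k. 0 < b $ k + q0 $ k"
  shows "((\<lambda>(n, y). hjb_scheme \<sigma> a b n y) \<longlongrightarrow> hjb_value \<sigma> a b (t0, s0, q0)) (sequentially \<times>\<^sub>F nhds (t0, s0, q0))"
proof -
  let ?F = "sequentially \<times>\<^sub>F nhds (t0, s0, q0)"
  have fst: "filterlim fst at_top ?F" by (rule filterlim_fst)
  have snd: "(snd \<longlongrightarrow> (t0, s0, q0)) ?F" by (rule filterlim_snd)
  have t: "((\<lambda>z. fst (snd z)) \<longlongrightarrow> t0) ?F" using tendsto_fst[OF snd] by simp
  have s: "((\<lambda>z. fst (snd (snd z))) \<longlongrightarrow> s0) ?F" using tendsto_fst[OF tendsto_snd[OF snd]] by simp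
  have q: "((\<lambda>z. snd (snd (snd z))) \<longlongrightarrow> q0) ?F" using tendsto_snd[OF tendsto_snd[OF snd]] by simp
  have j: "((\<lambda>z. real (nat \<lfloor>(1 - fst (snd z)) * real (fst z)\<rfloor>) / real (fst z)) \<longlongrightarrow> 1 - t0) ?F"
  proof -
    \<comment> \<open>Near \<open>t0 = 1\<close> points with \<open>t > 1\<close> occur;
      \<open>nat\<close> then yields 0 rounds, which the positive part of \<open>1 - t\<close>
      describes.\<close>
    have "((\<lambda>z. real (nat \<lfloor>(1 - fst (snd z)) * real (fst z)\<rfloor>) / real (fst z) - max 0 (1 - fst (snd z))) \<longlongrightarrow> 0) ?F"
    proof (rule Lim_null_comparison)
      show "\<forall>\<^sub>F z in ?F. norm (real (nat \<lfloor>(1 - fst (snd z)) * real (fst z)\<rfloor>) / real (fst z) - max 0 (1 - fst (snd z))) \<le> 1 / real (fst z)"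
        using eventually_compose_filterlim[OF eventually_gt_at_top[of "0::nat"] fst]
      proof eventually_elim
        case (elim z)
        define u n where "u = 1 - fst (snd z)" and "n = real (fst z)"
        have n: "0 < n" using elim by (simp add: n_def)
        have "real (nat \<lfloor>u * n\<rfloor>) / n - max 0 u = (real (nat \<lfloor>u * n\<rfloor>) - max 0 u * n) / n"
          using n by (simp add: field_simps)
        moreover have "\<bar>real (nat \<lfloor>u * n\<rfloor>) - max 0 u * n\<bar> \<le> 1"
        proof (cases "0 \<le> u")
          case True
          then have "real (nat \<lfloor>u * n\<rfloor>) = of_int \<lfloor>u * n\<rfloor>" using n by simp
          then show ?thesis using True by simp linarith
        next
          case False
          then have "u * n \<le> 0" using n by (simp add: mult_nonpos_nonneg)
          then have "nat \<lfloor>u * n\<rfloor> = 0" by simp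
          then show ?thesis using False by simp
        qed
        ultimately show ?case unfolding u_def[symmetric] n_def[symmetric] using n by (simp add: divide_right_mono)
      qed
      show "((\<lambda>z. 1 / real (fst z)) \<longlongrightarrow> 0) ?F" by (rule filterlim_compose[OF lim_1_over_n fst])
    qed
    moreover have "((\<lambda>z. max 0 (1 - fst (snd z))) \<longlongrightarrow> max 0 (1 - t0)) ?F" by (intro tendsto_intros t)
    ultimately have "((\<lambda>z. (real (nat \<lfloor>(1 - fst (snd z)) * real (fst z)\<rfloor>) / real (fst z) - max 0 (1 - fst (snd z))) + max 0 (1 - fst (snd z)))
      \<longlongrightarrow> 0 + max 0 (1 - t0)) ?F" by (rule tendsto_add)
    then show ?thesis using assms(2) by simp
  qed
  have "((\<lambda>z. walk_value \<sigma> (1 / real (fst z)) (nat \<lfloor>(1 - fst (snd z)) * real (fst z)\<rfloor>)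
      (post_mean a b (fst (snd (snd z))) (snd (snd (snd z)))) (b + snd (snd (snd z))))
    \<longlongrightarrow> lim_value \<sigma> (1 - t0) (post_mean a b s0 q0) (b + q0)) ?F"
    by (intro tendsto_lim_value fst j tendsto_post_mean s q tendsto_intros) (use assms in auto)
  then show ?thesis by (simp add: hjb_scheme_def hjb_value_def case_prod_unfold)
qed

text \<open>The drift of one pull. Moving \<open>s $ k\<close> at the speed of the posterior mean
  while \<open>q $ k\<close> grows at unit speed leaves \<open>post_mean\<close> unchanged.\<close>

definition hjb_dir :: "real^'k \<Rightarrow> real^'k \<Rightarrow> 'k \<Rightarrow> real \<times> (real^'k) \<times> (real^'k::finite) \<Rightarrow> real \<times> (real^'k) \<times> (real^'k)" where
  "hjb_dir a b k = (\<lambda>(t, s, q). (1, (post_mean a b s q $ k) *\<^sub>R axis k 1, axis k 1))"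

text \<open>A step of the mean is multiplied by the new precision \<open>b $ k + q $ k + h\<close>
  to become a step of \<open>s $ k\<close>. Splitting off \<open>sqrt h\<close> leaves this factor,
  which tends to \<sigma>.\<close>

definition hjb_noise :: "real \<Rightarrow> real^'k \<Rightarrow> 'k \<Rightarrow> real \<Rightarrow> real \<times> (real^'k) \<times> (real^'k::finite) \<Rightarrow> real \<times> (real^'k) \<times> (real^'k)" where
  "hjb_noise \<sigma> b k h = (\<lambda>(t, s, q). (0, (\<sigma> * sqrt ((b $ k + q $ k + h) / (b $ k + q $ k))) *\<^sub>R axis k 1, 0))"

definition hjb_up :: "real \<Rightarrow> real^'k \<Rightarrow> real^'k \<Rightarrow> 'k \<Rightarrow> real \<Rightarrow> real \<times> (real^'k) \<times> (real^'k::finite) \<Rightarrow> real \<times> (real^'k) \<times> (real^'k)" where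
  "hjb_up \<sigma> a b k h x = x + (h *\<^sub>R hjb_dir a b k x + sqrt h *\<^sub>R hjb_noise \<sigma> b k h x)"

definition hjb_down :: "real \<Rightarrow> real^'k \<Rightarrow> real^'k \<Rightarrow> 'k \<Rightarrow> real \<Rightarrow> real \<times> (real^'k) \<times> (real^'k::finite) \<Rightarrow> real \<times> (real^'k) \<times> (real^'k)" where
  "hjb_down \<sigma> a b k h x = x + (h *\<^sub>R hjb_dir a b k x - sqrt h *\<^sub>R hjb_noise \<sigma> b k h x)"

definition hjb_avg :: "real \<Rightarrow> real^'k \<Rightarrow> real^'k \<Rightarrow> 'k \<Rightarrow> real \<Rightarrow> (real \<times> (real^'k) \<times> (real^'k::finite) \<Rightarrow> real) \<Rightarrow> real \<times> (real^'k) \<times> (real^'k) \<Rightarrow> real" where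
  "hjb_avg \<sigma> a b k h g x = (g (hjb_up \<sigma> a b k h x) + g (hjb_down \<sigma> a b k h x)) / 2"

text \<open>The dynamic programming equation of the walk in the coordinates (t, s, q). Since
  \<open>hjb_avg\<close> is a plain average, the scheme is monotone. The condition on
  \<open>t\<close> says that at least one round is left.\<close>

lemma hjb_scheme_step:
  fixes a b s q :: "real^'k::finite" and t :: real
  assumes n: "0 < n" and t: "1 \<le> (1 - t) * real n" and pos: "\<And>k. 0 < b $ k + q $ k"
  defines "h \<equiv> 1 / real n" and "x \<equiv> (t, s, q)"
  shows "hjb_scheme \<sigma> a b n x = (MAX k\<in>UNIV. h * post_mean a b s q $ k + hjb_avg \<sigma> a b k h (hjb_scheme \<sigma> a b n) x)"
proof -
  define m where "m = post_mean a b s q"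
  define j where "j = nat \<lfloor>(1 - (t + h)) * real n\<rfloor>"
  have h: "0 < h" using n by (simp add: h_def)
  have hn: "(1 - (t + h)) * real n = (1 - t) * real n - 1"
    using n by (simp add: h_def algebra_simps)
  \<comment> \<open>Advancing time by \<open>h\<close> removes exactly one round, also from times
    off the grid.\<close>
  have j: "nat \<lfloor>(1 - t) * real n\<rfloor> = Suc j"
  proof -
    have "\<lfloor>(1 - (t + h)) * real n\<rfloor> = \<lfloor>(1 - t) * real n\<rfloor> - 1" unfolding hn by linarith
    moreover have "1 \<le> \<lfloor>(1 - t) * real n\<rfloor>" using t by simp
    ultimately show ?thesis unfolding j_def by linarith
  qed
  let ?noise = "\<lambda>k. sqrt h * (\<sigma> * sqrt ((b $ k + q $ k + h) / (b $ k + q $ k)))"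
  have state: "hjb_scheme \<sigma> a b n (t + h, s + (h * m $ k + e * ?noise k) *\<^sub>R axis k 1, q + h *\<^sub>R axis k 1)
    = walk_value \<sigma> h j (m + (e * step_size \<sigma> h ((b + q) $ k)) *\<^sub>R axis k 1) (b + q + h *\<^sub>R axis k 1)" for k e
  proof -
    define p where "p = b $ k + q $ k"
    have p: "0 < p" using pos by (simp add: p_def)
    \<comment> \<open>The step of the mean times the new denominator \<open>p + h\<close> is the
      step of \<open>s $ k\<close>.\<close>
    have noise: "sqrt h * (\<sigma> * sqrt ((p + h) / p)) = step_size \<sigma> h p * (p + h)"
    proof -
      have "sqrt (h / (p * (p + h))) * (p + h) = sqrt (h / (p * (p + h))) * sqrt ((p + h) * (p + h))"
        using p h by (simp only: real_sqrt_abs2)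
      also have "\<dots> = sqrt (h * ((p + h) / p))"
      proof -
        have "h / (p * y) * (y * y) = h * (y / p)" if "y \<noteq> 0" for y using that by simp
        then show ?thesis unfolding real_sqrt_mult[symmetric] using p h by simp
      qed
      finally have e: "sqrt (h / (p * (p + h))) * (p + h) = sqrt (h * ((p + h) / p))" .
      have "sqrt h * (\<sigma> * sqrt ((p + h) / p)) = \<sigma> * (sqrt h * sqrt ((p + h) / p))" by simp
      also have "\<dots> = \<sigma> * sqrt (h * ((p + h) / p))" by (simp only: real_sqrt_mult)
      finally show ?thesis by (simp only: step_size_def mult.assoc e)
    qed
    have "post_mean a b (s + (h * m $ k + e * (step_size \<sigma> h p * (p + h))) *\<^sub>R axis k 1) (q + h *\<^sub>R axis k 1)
       = m + (e * step_size \<sigma> h p) *\<^sub>R axis k 1"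
    proof (subst vec_eq_iff, rule allI)
      fix i
      show "post_mean a b (s + (h * m $ k + e * (step_size \<sigma> h p * (p + h))) *\<^sub>R axis k 1) (q + h *\<^sub>R axis k 1) $ i
         = (m + (e * step_size \<sigma> h p) *\<^sub>R axis k 1) $ i"
      proof (cases "i = k")
        case True
        have "a $ k + s $ k = m $ k * p" using p by (simp add: m_def post_mean_def p_def)
        then have "a $ k + (s $ k + (h * m $ k + e * (step_size \<sigma> h p * (p + h)))) = (m $ k + e * step_size \<sigma> h p) * (p + h)"
          by (simp add: algebra_simps)
        then show ?thesis using True p h by (simp add: post_mean_def p_def add.assoc)
      qed (simp add: m_def post_mean_def axis_def)
    qed
    then show ?thesis
      unfolding hjb_scheme_def using noise by (simp add: h_def[symmetric] j_def p_def add.assoc)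
  qed
  have up: "hjb_up \<sigma> a b k h x
     = (t + h, s + (h * m $ k + 1 * ?noise k) *\<^sub>R axis k 1, q + h *\<^sub>R axis k 1)" for k
    by (simp add: hjb_up_def x_def hjb_dir_def hjb_noise_def m_def scaleR_add_left)
  have down: "hjb_down \<sigma> a b k h x
     = (t + h, s + (h * m $ k + (- 1) * ?noise k) *\<^sub>R axis k 1, q + h *\<^sub>R axis k 1)" for k
    by (simp add: hjb_down_def x_def hjb_dir_def hjb_noise_def m_def scaleR_diff_left)
  have "hjb_scheme \<sigma> a b n x = walk_value \<sigma> h (Suc j) m (b + q)"
    by (simp add: hjb_scheme_def x_def j h_def m_def)
  then show ?thesis
    unfolding hjb_avg_def m_def[symmetric] up down state by (simp add: walk_value.simps(2))
qed

lemma tendsto_hjb_dir: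
  fixes x0 :: "real \<times> (real^'k) \<times> (real^'k::finite)"
  assumes "(x \<longlongrightarrow> x0) F" "\<And>k. 0 < b $ k + snd (snd x0) $ k"
  shows "((\<lambda>i. hjb_dir a b k (x i)) \<longlongrightarrow> hjb_dir a b k x0) F"
  unfolding hjb_dir_def case_prod_unfold
  by (intro tendsto_intros tendsto_post_mean assms)

lemma tendsto_hjb_noise:
  fixes x0 :: "real \<times> (real^'k) \<times> (real^'k::finite)"
  assumes "(x \<longlongrightarrow> x0) F" "0 < b $ k + snd (snd x0) $ k" "(h \<longlongrightarrow> 0) F"
  shows "((\<lambda>i. hjb_noise \<sigma> b k (h i) (x i)) \<longlongrightarrow> (0, \<sigma> *\<^sub>R axis k 1, 0)) F"
proof -
  have "((\<lambda>i. hjb_noise \<sigma> b k (h i) (x i)) \<longlongrightarrow> hjb_noise \<sigma> b k 0 x0) F"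
    unfolding hjb_noise_def case_prod_unfold
    by (intro tendsto_intros assms) (use assms(2) in auto)
  then show ?thesis using assms(2) by (simp add: hjb_noise_def case_prod_unfold)
qed

section \<open>The HJB operator on test functions\<close>

lemma C2_onE:
  assumes "C2_on S \<phi>"
  obtains D D2 where "\<forall>x\<in>S. (\<phi> has_derivative blinfun_apply (D x)) (at x)"
    "\<forall>x\<in>S. (D has_derivative blinfun_apply (D2 x)) (at x)" "continuous_on S D2"
  using assms unfolding C2_on_def by (elim exE conjE) (rule that)

lemma line_has_derivative:
  fixes \<phi> :: "'a::real_normed_vector \<Rightarrow> real" and D :: "'a \<Rightarrow>\<^sub>L real"
  assumes "(\<phi> has_derivative D) (at (x + r *\<^sub>R w))"
  shows "((\<lambda>h. \<phi> (x + h *\<^sub>R w)) has_real_derivative D w) (at r)"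
proof -
  have "((\<lambda>h. x + h *\<^sub>R w) has_derivative (\<lambda>h. h *\<^sub>R w)) (at r)"
    by (auto intro!: derivative_eq_intros)
  from has_derivative_compose[OF this assms]
  show ?thesis
    by (rule has_derivative_imp_has_field_derivative) (simp add: blinfun.scaleR_right)
qed

text \<open>The direction \<open>hjb_dir\<close> contains the time direction, so \<open>A k\<close>
  includes the time derivative; the equation keeps that outside the supremum, hence the
  subtraction.\<close>

lemma hjb_lhs_eq:
  fixes D :: "real \<times> (real^'k) \<times> (real^'k::finite) \<Rightarrow> (real \<times> (real^'k) \<times> (real^'k)) \<Rightarrow>\<^sub>L real"
    and D2 :: "real \<times> (real^'k) \<times> (real^'k) \<Rightarrow> (real \<times> (real^'k) \<times> (real^'k)) \<Rightarrow>\<^sub>L (real \<times> (real^'k) \<times> (real^'k)) \<Rightarrow>\<^sub>L real"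
    and a b :: "real^'k" and \<sigma> :: real
  defines "U \<equiv> {0<..<1} \<times> UNIV \<times> {q. \<forall>k. q $ k \<in> {0<..<1}}"
  assumes D: "\<And>x. x \<in> U \<Longrightarrow> (\<phi> has_derivative D x) (at x)" "\<And>x. x \<in> U \<Longrightarrow> (D has_derivative D2 x) (at x)"
    and x: "x = (t, s, q)" "x \<in> U"
  defines "A \<equiv> \<lambda>k. D x (hjb_dir a b k x) + D2 x (0, \<sigma> *\<^sub>R axis k 1, 0) (0, \<sigma> *\<^sub>R axis k 1, 0) / 2 + post_mean a b s q $ k"
  shows "hjb_lhs \<sigma> a b \<phi> x = D x (1, 0, 0) + (SUP \<pi>\<in>prob_simplex. \<Sum>k\<in>UNIV. (A k - D x (1, 0, 0)) * \<pi> $ k)"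
proof -
  have t: "deriv (\<lambda>\<tau>. \<phi> (\<tau>, s, q)) t = D x (1, 0, 0)"
  proof (rule DERIV_imp_deriv)
    have "((\<lambda>h. \<phi> ((0, s, q) + h *\<^sub>R (1, 0, 0))) has_real_derivative D x (1, 0, 0)) (at t)"
      by (rule line_has_derivative) (use D(1)[OF x(2)] x(1) in simp)
    then show "((\<lambda>\<tau>. \<phi> (\<tau>, s, q)) has_real_derivative D x (1, 0, 0)) (at t)" by simp
  qed
  have q: "deriv (\<lambda>h. \<phi> (t, s, q + h *\<^sub>R axis k 1)) 0 = D x (0, 0, axis k 1)" for k
  proof (rule DERIV_imp_deriv)
    have "((\<lambda>h. \<phi> (x + h *\<^sub>R (0, 0, axis k 1))) has_real_derivative D x (0, 0, axis k 1)) (at 0)"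
      by (rule line_has_derivative) (simp only: scaleR_zero_left add_0_right D(1)[OF x(2)])
    then show "((\<lambda>h. \<phi> (t, s, q + h *\<^sub>R axis k 1)) has_real_derivative D x (0, 0, axis k 1)) (at 0)"
      by (simp add: x(1))
  qed
  \<comment> \<open>The domain is unrestricted in \<open>s\<close>, so the first derivative is known
    along the whole line and can be differentiated again.\<close>
  have U: "x + h *\<^sub>R (0, v, 0) \<in> U" for h v using x by (auto simp: U_def)
  have sh: "deriv (\<lambda>h. \<phi> (t, s + h *\<^sub>R axis k 1, q)) = (\<lambda>h. D (x + h *\<^sub>R (0, axis k 1, 0)) (0, axis k 1, 0))" for k
  proof
    fix h
    have "((\<lambda>h. \<phi> (x + h *\<^sub>R (0, axis k 1, 0))) has_real_derivative D (x + h *\<^sub>R (0, axis k 1, 0)) (0, axis k 1, 0)) (at h)"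
      by (rule line_has_derivative) (rule D(1)[OF U])
    then show "deriv (\<lambda>h. \<phi> (t, s + h *\<^sub>R axis k 1, q)) h = D (x + h *\<^sub>R (0, axis k 1, 0)) (0, axis k 1, 0)"
      by (intro DERIV_imp_deriv) (simp add: x(1))
  qed
  have s2: "(deriv ^^ 2) (\<lambda>h. \<phi> (t, s + h *\<^sub>R axis k 1, q)) 0 = D2 x (0, axis k 1, 0) (0, axis k 1, 0)" for k
  proof -
    let ?w = "(0, axis k 1, 0) :: real \<times> (real^'k) \<times> (real^'k)"
    have "((\<lambda>h. x + h *\<^sub>R ?w) has_derivative (\<lambda>h. h *\<^sub>R ?w)) (at 0)"
      by (auto intro!: derivative_eq_intros)
    moreover have "(D has_derivative D2 x) (at (x + 0 *\<^sub>R ?w))"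
      by (simp only: scaleR_zero_left add_0_right D(2)[OF x(2)])
    ultimately have "((\<lambda>h. D (x + h *\<^sub>R ?w)) has_derivative (\<lambda>h. D2 x (h *\<^sub>R ?w))) (at 0)"
      by (rule has_derivative_compose)
    then have "((\<lambda>h. D (x + h *\<^sub>R ?w) ?w) has_derivative (\<lambda>h. D2 x (h *\<^sub>R ?w) ?w)) (at 0)"
      by (auto intro!: derivative_eq_intros)
    then have "((\<lambda>h. D (x + h *\<^sub>R ?w) ?w) has_real_derivative D2 x ?w ?w) (at 0)"
      by (rule has_derivative_imp_has_field_derivative)
        (simp only: blinfun.scaleR_right blinfun.scaleR_left real_scaleR_def)
    then show ?thesis by (simp add: numeral_2_eq_2 sh DERIV_imp_deriv)
  qed
  have s1: "deriv (\<lambda>h. \<phi> (t, s + h *\<^sub>R axis k 1, q)) 0 = D x (0, axis k 1, 0)" for k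
    by (simp only: sh scaleR_zero_left add_0_right)
  have A: "A k - D x (1, 0, 0) = D x (0, 0, axis k 1)
     + hjb_drift (s $ k) (q $ k) (a $ k) (b $ k) * D x (0, axis k 1, 0)
     + 1/2 * \<sigma>\<^sup>2 * D2 x (0, axis k 1, 0) (0, axis k 1, 0) + hjb_drift (s $ k) (q $ k) (a $ k) (b $ k)" for k
  proof -
    have drift: "post_mean a b s q $ k = hjb_drift (s $ k) (q $ k) (a $ k) (b $ k)"
      by (simp add: post_mean_def hjb_drift_def)
    have "hjb_dir a b k x = (1, 0, 0) + post_mean a b s q $ k *\<^sub>R (0, axis k 1, 0) + (0, 0, axis k 1)"
      by (simp add: hjb_dir_def x(1))
    then have "D x (hjb_dir a b k x) = D x (1, 0, 0) + post_mean a b s q $ k * D x (0, axis k 1, 0) + D x (0, 0, axis k 1)"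
      by (simp only: blinfun.add_right blinfun.scaleR_right real_scaleR_def)
    moreover have "(0, \<sigma> *\<^sub>R axis k 1, 0) = \<sigma> *\<^sub>R (0 :: real, axis k 1 :: real^'k, 0 :: real^'k)" by simp
    then have "D2 x (0, \<sigma> *\<^sub>R axis k 1, 0) (0, \<sigma> *\<^sub>R axis k 1, 0) = \<sigma>\<^sup>2 * D2 x (0, axis k 1, 0) (0, axis k 1, 0)"
      by (simp only: blinfun.scaleR_right blinfun.scaleR_left real_scaleR_def power2_eq_square mult.assoc)
    ultimately show ?thesis unfolding A_def drift by simp
  qed
  show ?thesis
    unfolding A unfolding t[symmetric] q[symmetric] s1[symmetric] s2[symmetric]
    by (simp only: hjb_lhs_def x(1) prod.case)
qed

lemma axis_in_prob_simplex: "axis k 1 \<in> prob_simplex"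
  by (auto simp: prob_simplex_def axis_def)

lemma open_hjb_domain:
  "open ({0<..<1::real} \<times> (UNIV :: (real^'k) set) \<times> {q :: real^'k::finite. \<forall>k. q $ k \<in> {0<..<1}})"
proof -
  have "{q :: real^'k. \<forall>k. q $ k \<in> {0<..<1}} = (\<Inter>k. {q. 0 < q $ k} \<inter> {q. q $ k < 1})" by auto
  moreover have "open \<dots>"
    by (intro open_INT open_Int open_Collect_less continuous_intros ballI) auto
  ultimately show ?thesis by (intro open_Times) auto
qed

definition hjb_gen where
  "hjb_gen \<sigma> a b D D2 k x = blinfun_apply (D x) (hjb_dir a b k x)
     + blinfun_apply (blinfun_apply (D2 x) (0, \<sigma> *\<^sub>R axis k 1, 0)) (0, \<sigma> *\<^sub>R axis k 1, 0) / (2::real)"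

text \<open>The penalty adds only \<open>\<eta> * \<sigma>\<^sup>2\<close>: its gradient vanishes at
  \<open>x0\<close>, and its second-order part sees the noise alone.\<close>

lemma hjb_gen_limit:
  fixes x0 :: "real \<times> (real^'k) \<times> (real^'k::finite)" and a b :: "real^'k" and \<sigma> \<eta> :: real
    and \<phi> :: "real \<times> (real^'k) \<times> (real^'k) \<Rightarrow> real" and r :: "nat \<Rightarrow> nat"
  assumes U: "open U" "x0 \<in> U" and D: "\<And>z. z \<in> U \<Longrightarrow> (\<phi> has_derivative blinfun_apply (D z)) (at z)"
      "\<And>z. z \<in> U \<Longrightarrow> (D has_derivative blinfun_apply (D2 z)) (at z)"
    and D2: "continuous_on U D2" and pos: "\<And>k. 0 < b $ k + snd (snd x0) $ k"
    and x: "x \<longlonglongrightarrow> x0" and r: "filterlim r at_top sequentially"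
  defines "\<psi> \<equiv> \<lambda>y. \<phi> y + \<eta> * (norm (y - x0))\<^sup>2" and "h \<equiv> \<lambda>i::nat. 1 / real (r i)"
  shows "(\<lambda>i. (hjb_avg \<sigma> a b k (h i) \<psi> (x i) - \<psi> (x i)) / h i) \<longlonglongrightarrow> hjb_gen \<sigma> a b D D2 k x0 + \<eta> * \<sigma>\<^sup>2"
    and "(\<lambda>i. hjb_up \<sigma> a b k (h i) (x i)) \<longlonglongrightarrow> x0" "(\<lambda>i. hjb_down \<sigma> a b k (h i) (x i)) \<longlonglongrightarrow> x0"
proof -
  let ?z = "(0, \<sigma> *\<^sub>R axis k 1, 0) :: real \<times> (real^'k) \<times> (real^'k)"
  let ?up = "\<lambda>i. hjb_up \<sigma> a b k (h i) (x i)" and ?down = "\<lambda>i. hjb_down \<sigma> a b k (h i) (x i)"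
  have h0: "h \<longlonglongrightarrow> 0" unfolding h_def by (rule filterlim_compose[OF lim_1_over_n r])
  have hpos: "\<forall>\<^sub>F i in sequentially. 0 < h i"
    unfolding h_def using eventually_compose_filterlim[OF eventually_gt_at_top[of "0::nat"] r]
    by eventually_elim simp
  have u: "(\<lambda>i. hjb_dir a b k (x i)) \<longlonglongrightarrow> hjb_dir a b k x0" by (rule tendsto_hjb_dir[OF x pos])
  have \<zeta>: "(\<lambda>i. hjb_noise \<sigma> b k (h i) (x i)) \<longlonglongrightarrow> ?z" by (rule tendsto_hjb_noise[OF x pos h0])
  have n: "(norm ?z)\<^sup>2 = \<sigma>\<^sup>2" by (simp add: norm_Pair)
  have L1: "(\<lambda>i. ((\<phi> (?up i) + \<phi> (?down i)) / 2 - \<phi> (x i)) / h i) \<longlonglongrightarrow> hjb_gen \<sigma> a b D D2 k x0"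
    unfolding hjb_up_def hjb_down_def hjb_gen_def by (rule second_order_limit[OF U D D2 x u \<zeta> h0 hpos])
  have L2: "(\<lambda>i. (((norm (?up i - x0))\<^sup>2 + (norm (?down i - x0))\<^sup>2) / 2 - (norm (x i - x0))\<^sup>2) / h i) \<longlonglongrightarrow> \<sigma>\<^sup>2"
    unfolding hjb_up_def hjb_down_def n[symmetric] by (rule second_order_limit_norm[OF x u \<zeta> h0 hpos])
  have "(\<lambda>i. ((\<phi> (?up i) + \<phi> (?down i)) / 2 - \<phi> (x i)) / h i
      + \<eta> * ((((norm (?up i - x0))\<^sup>2 + (norm (?down i - x0))\<^sup>2) / 2 - (norm (x i - x0))\<^sup>2) / h i))
     \<longlonglongrightarrow> hjb_gen \<sigma> a b D D2 k x0 + \<eta> * \<sigma>\<^sup>2"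
    by (intro tendsto_add tendsto_mult_left L1 L2)
  moreover have "((p + q) / 2 - f) / c + \<eta> * (((p' + q') / 2 - f') / c) = (((p + \<eta> * p') + (q + \<eta> * q')) / 2 - (f + \<eta> * f')) / c"
    for p q f c p' q' f' :: real
    by (simp add: add_divide_distrib diff_divide_distrib distrib_left right_diff_distrib)
  ultimately show "(\<lambda>i. (hjb_avg \<sigma> a b k (h i) \<psi> (x i) - \<psi> (x i)) / h i) \<longlonglongrightarrow> hjb_gen \<sigma> a b D D2 k x0 + \<eta> * \<sigma>\<^sup>2"
    unfolding \<psi>_def hjb_avg_def by simp
  have "?up \<longlonglongrightarrow> x0 + (0 *\<^sub>R hjb_dir a b k x0 + sqrt 0 *\<^sub>R ?z)"
    unfolding hjb_up_def by (intro tendsto_add tendsto_scaleR tendsto_real_sqrt x h0 u \<zeta>)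
  then show "?up \<longlonglongrightarrow> x0" by (simp only: real_sqrt_zero scaleR_zero_left add_0_right)
  have "?down \<longlonglongrightarrow> x0 + (0 *\<^sub>R hjb_dir a b k x0 - sqrt 0 *\<^sub>R ?z)"
    unfolding hjb_down_def by (intro tendsto_add tendsto_diff tendsto_scaleR tendsto_real_sqrt x h0 u \<zeta>)
  then show "?down \<longlonglongrightarrow> x0" by (simp only: real_sqrt_zero scaleR_zero_left add_0_right diff_0_right)
qed

text \<open>The sign \<open>\<epsilon>\<close> selects between a local maximum and a local minimum of \<open>v - \<phi>\<close>.\<close>

lemma hjb_touching:
  fixes x0 :: "real \<times> (real^'k) \<times> (real^'k::finite)"
  assumes U: "open U" "x0 \<in> U" and D: "\<And>z. z \<in> U \<Longrightarrow> (\<phi> has_derivative blinfun_apply (D z)) (at z)"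
      "\<And>z. z \<in> U \<Longrightarrow> (D has_derivative blinfun_apply (D2 z)) (at z)"
    and D2: "continuous_on U D2" and pos: "\<And>k. 0 < b $ k + snd (snd x0) $ k"
    and conv: "\<And>x. x \<in> U \<Longrightarrow> ((\<lambda>(n, y). F n y) \<longlongrightarrow> v x) (sequentially \<times>\<^sub>F nhds x)"
    and \<epsilon>: "\<epsilon> * \<epsilon> = (1::real)" and ext: "\<forall>\<^sub>F y in nhds x0. \<epsilon> * v y - \<epsilon> * \<phi> y \<le> \<epsilon> * v x0 - \<epsilon> * \<phi> x0" and \<eta>: "0 < \<eta>"
  obtains x :: "nat \<Rightarrow> real \<times> (real^'k) \<times> (real^'k)" and r :: "nat \<Rightarrow> nat" and \<Delta>
  where "filterlim r at_top sequentially" "x \<longlonglongrightarrow> x0"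
    "\<forall>k. (\<lambda>i. \<Delta> k i / (1 / real (r i))) \<longlonglongrightarrow> hjb_gen \<sigma> a b D D2 k x0 + \<epsilon> * \<eta> * \<sigma>\<^sup>2"
    "\<forall>\<^sub>F i in sequentially. \<forall>k. \<epsilon> * (hjb_avg \<sigma> a b k (1 / real (r i)) (F (r i)) (x i) - F (r i) (x i))
       \<le> \<epsilon> * \<Delta> k i + (1 / real (r i))\<^sup>2"
proof -
  have cont: "continuous_on U \<phi>"
    by (rule has_derivative_continuous_on) (rule has_derivative_at_withinI[OF D(1)])
  have conv': "((\<lambda>(n, y). \<epsilon> * F n y) \<longlongrightarrow> \<epsilon> * v x) (sequentially \<times>\<^sub>F nhds x)" if "x \<in> U" for x
    using tendsto_mult_left[OF conv[OF that], of \<epsilon>] by (simp add: case_prod_unfold)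
  have cont': "continuous_on U (\<lambda>y. \<epsilon> * \<phi> y)" by (intro continuous_intros cont)
  obtain \<rho> x and r :: "nat \<Rightarrow> nat" where \<rho>: "0 < \<rho>" "cball x0 \<rho> \<subseteq> U" and r: "filterlim r at_top sequentially" and x: "x \<longlonglongrightarrow> x0"
    and near: "\<forall>i. \<forall>y\<in>cball x0 \<rho>. \<epsilon> * F (r i) y - \<epsilon> * \<phi> y - \<eta> * (norm (y - x0))\<^sup>2
       \<le> \<epsilon> * F (r i) (x i) - \<epsilon> * \<phi> (x i) - \<eta> * (norm (x i - x0))\<^sup>2 + (1 / real (r i))\<^sup>2"
    by (rule near_maximizers[OF U conv' cont' ext \<eta>])
  \<comment> \<open>The sign in front of the penalty is such that, by
    \<open>\<epsilon> * \<epsilon> = 1\<close>, it enters \<open>\<epsilon> * \<psi>\<close> with a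
    plus sign in both cases.\<close>
  define \<psi> where "\<psi> y = \<phi> y + \<epsilon> * \<eta> * (norm (y - x0))\<^sup>2" for y
  have \<psi>: "\<epsilon> * \<psi> y = \<epsilon> * \<phi> y + \<eta> * (norm (y - x0))\<^sup>2" for y
    unfolding \<psi>_def distrib_left by (simp add: \<epsilon> flip: mult.assoc)
  let ?h = "\<lambda>i. 1 / real (r i)"
  let ?up = "\<lambda>k i. hjb_up \<sigma> a b k (?h i) (x i)" and ?down = "\<lambda>k i. hjb_down \<sigma> a b k (?h i) (x i)"
  note lim = hjb_gen_limit[OF U D D2 pos x r]
  show ?thesis
  proof (rule that[OF r x])
    show "\<forall>k. (\<lambda>i. (hjb_avg \<sigma> a b k (?h i) \<psi> (x i) - \<psi> (x i)) / ?h i) \<longlonglongrightarrow> hjb_gen \<sigma> a b D D2 k x0 + \<epsilon> * \<eta> * \<sigma>\<^sup>2"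
      unfolding \<psi>_def by (intro allI lim(1))
    have "\<forall>\<^sub>F i in sequentially. \<forall>k. ?up k i \<in> ball x0 \<rho>"
      by (intro eventually_all_finite topological_tendstoD[OF lim(2)]) (use \<rho> in auto)
    moreover have "\<forall>\<^sub>F i in sequentially. \<forall>k. ?down k i \<in> ball x0 \<rho>"
      by (intro eventually_all_finite topological_tendstoD[OF lim(3)]) (use \<rho> in auto)
    ultimately show "\<forall>\<^sub>F i in sequentially. \<forall>k. \<epsilon> * (hjb_avg \<sigma> a b k (?h i) (F (r i)) (x i) - F (r i) (x i))
       \<le> \<epsilon> * (hjb_avg \<sigma> a b k (?h i) \<psi> (x i) - \<psi> (x i)) + (?h i)\<^sup>2"
    proof eventually_elim
      case (elim i)
      have le: "\<epsilon> * F (r i) y - \<epsilon> * \<psi> y \<le> \<epsilon> * F (r i) (x i) - \<epsilon> * \<psi> (x i) + (?h i)\<^sup>2" if "y \<in> ball x0 \<rho>" for y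
        using near[rule_format, of y i] that unfolding \<psi> by simp
      show ?case
      proof
        fix k
        show "\<epsilon> * (hjb_avg \<sigma> a b k (?h i) (F (r i)) (x i) - F (r i) (x i))
           \<le> \<epsilon> * (hjb_avg \<sigma> a b k (?h i) \<psi> (x i) - \<psi> (x i)) + (?h i)\<^sup>2"
          using le[OF elim(1)[rule_format, of k]] le[OF elim(2)[rule_format, of k]]
          unfolding hjb_avg_def add_divide_distrib right_diff_distrib distrib_left times_divide_eq_right by linarith
      qed
    qed
  qed
qed

section \<open>The limit is a viscosity solution\<close>

lemma le_0_if_le_scaled:
  fixes c s :: real
  assumes "\<And>\<eta>. 0 < \<eta> \<Longrightarrow> c \<le> \<eta> * s\<^sup>2"
  shows "c \<le> 0"
proof (rule field_le_epsilon)
  fix e :: real assume e: "0 < e"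
  \<comment> \<open>The summand 1 allows division when \<open>s\<close> is zero.\<close>
  have s: "0 < s\<^sup>2 + 1" by (intro add_nonneg_pos) auto
  have "c \<le> e / (s\<^sup>2 + 1) * s\<^sup>2" using assms[of "e / (s\<^sup>2 + 1)"] e s by simp
  also have "\<dots> \<le> e" using e s by (simp add: pos_divide_le_eq)
  finally show "c \<le> 0 + e" by simp
qed

text \<open>At a local maximum, an arm maximising generator plus reward has a nonnegative value, and
  the corresponding vertex of the simplex bounds the supremum from below. At a local minimum all
  arms have nonpositive values, and so do their convex combinations. Both follow by letting the
  weight \<eta> of the penalty tend to 0.\<close>

lemma hjb_value_viscosity_solution:
  fixes a b :: "real^'k::finite" and \<sigma> :: real
  assumes \<sigma>: "0 \<le> \<sigma>" and b: "\<And>k. 0 \<le> b $ k"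
  shows "viscosity_solution (hjb_lhs \<sigma> a b) ({0<..<1} \<times> UNIV \<times> {q. \<forall>k. q $ k \<in> {0<..<1}}) (hjb_value \<sigma> a b)"
proof -
  define U :: "(real \<times> (real^'k) \<times> (real^'k)) set" where "U = {0<..<1} \<times> UNIV \<times> {q. \<forall>k. q $ k \<in> {0<..<1}}"
  let ?F = "hjb_scheme \<sigma> a b" and ?v = "hjb_value \<sigma> a b"
  have oU: "open U" unfolding U_def by (rule open_hjb_domain)
  have pos: "0 < b $ k + snd (snd x) $ k" if "x \<in> U" for x k
    using that b[of k] by (auto simp: U_def add_nonneg_pos)
  have conv: "((\<lambda>(n, y). ?F n y) \<longlongrightarrow> ?v x) (sequentially \<times>\<^sub>F nhds x)" if "x \<in> U" for x
  proof -
    obtain t s q where x: "x = (t, s, q)" by (cases x)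
    show ?thesis unfolding x
      by (rule hjb_scheme_tendsto) (use \<sigma> pos[OF that] that in \<open>auto simp: x U_def\<close>)
  qed
  define \<mu> where "\<mu> k x = post_mean a b (fst (snd x)) (snd (snd x)) $ k" for k and x :: "real \<times> (real^'k) \<times> (real^'k)"
  have \<mu>: "(\<lambda>i. \<mu> k (x i)) \<longlonglongrightarrow> \<mu> k x0" if "x \<longlonglongrightarrow> x0" "x0 \<in> U" for x x0 k
    unfolding \<mu>_def by (intro tendsto_intros tendsto_post_mean that pos)
  have step: "\<forall>\<^sub>F i in sequentially. 0 < 1 / real (r i) \<and>
      ?F (r i) (x i) = (MAX k\<in>UNIV. 1 / real (r i) * \<mu> k (x i) + hjb_avg \<sigma> a b k (1 / real (r i)) (?F (r i)) (x i))"
    if x: "x \<longlonglongrightarrow> x0" "x0 \<in> U" and r: "filterlim r at_top sequentially" for x x0 and r :: "nat \<Rightarrow> nat"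
  proof -
    \<comment> \<open>Half the distance to the terminal time: near \<open>x0\<close> and for small
      steps at least one round remains.\<close>
    define e where "e = (1 - fst x0) / 2"
    have e: "0 < e" "fst x0 < 1 - e" using x(2) by (auto simp: e_def U_def field_simps)
    have "\<forall>\<^sub>F i in sequentially. fst (x i) < 1 - e" using tendsto_fst[OF x(1)] e(2) by (rule order_tendstoD)
    moreover have "\<forall>\<^sub>F i in sequentially. x i \<in> U" using topological_tendstoD[OF x(1) oU x(2)] .
    moreover have "\<forall>\<^sub>F i in sequentially. nat \<lceil>1 / e\<rceil> < r i"
      by (rule eventually_compose_filterlim[OF eventually_gt_at_top r])
    ultimately show ?thesis
    proof eventually_elim
      case (elim i)
      obtain t s q where xi: "x i = (t, s, q)" by (cases "x i")
      have "1 / e \<le> real (r i)" using elim(3) by linarith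
      then have "1 \<le> e * real (r i)" using e by (simp add: field_simps)
      also have "\<dots> \<le> (1 - t) * real (r i)" using elim(1) by (intro mult_right_mono) (auto simp: xi)
      finally have t: "1 \<le> (1 - t) * real (r i)" .
      have n: "0 < r i" using elim(3) by simp
      have p: "0 < b $ k + q $ k" for k using pos[OF elim(2), of k] by (simp add: xi)
      show ?case using hjb_scheme_step[OF n t p, of \<sigma> a s] n by (simp add: xi \<mu>_def)
    qed
  qed
  have lhs: "hjb_lhs \<sigma> a b \<phi> x = blinfun_apply (D x) (1, 0, 0)
      + (SUP \<pi>\<in>prob_simplex. \<Sum>k\<in>UNIV. (hjb_gen \<sigma> a b D D2 k x + \<mu> k x - blinfun_apply (D x) (1, 0, 0)) * \<pi> $ k)"
    if "\<And>z. z \<in> U \<Longrightarrow> (\<phi> has_derivative blinfun_apply (D z)) (at z)"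
      "\<And>z. z \<in> U \<Longrightarrow> (D has_derivative blinfun_apply (D2 z)) (at z)" "x \<in> U" for \<phi> D D2 x
  proof -
    obtain t s q where x: "x = (t, s, q)" by (cases x)
    show ?thesis using hjb_lhs_eq[of \<phi> D D2 x t s q \<sigma> a b, folded U_def, OF that(1,2) x that(3)]
      by (simp add: x hjb_gen_def \<mu>_def)
  qed
  have sub: "viscosity_subsolution (hjb_lhs \<sigma> a b) U ?v"
    unfolding viscosity_subsolution_def
  proof (intro allI impI, elim conjE)
    fix \<phi> :: "real \<times> (real^'k) \<times> (real^'k) \<Rightarrow> real" and x0
    assume C2: "C2_on U \<phi>" and x0: "x0 \<in> U" and max: "\<forall>\<^sub>F y in nhds x0. ?v y - \<phi> y \<le> ?v x0 - \<phi> x0"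
    obtain D D2 where D_all: "\<forall>z\<in>U. (\<phi> has_derivative blinfun_apply (D z)) (at z)" "\<forall>z\<in>U. (D has_derivative blinfun_apply (D2 z)) (at z)"
      and D2: "continuous_on U D2"
      by (rule C2_onE[OF C2])
    note D = D_all[rule_format]
    define A where "A k = hjb_gen \<sigma> a b D D2 k x0 + \<mu> k x0" for k
    obtain k where k: "(MAX k\<in>UNIV. A k) = A k" by (rule max_arm_attained)
    \<comment> \<open>The optimal arm of the scheme may change with \<open>i\<close>, so the limit
      is taken of the maximum over all arms.\<close>
    have "- A k \<le> \<eta> * \<sigma>\<^sup>2" if \<eta>: "0 < \<eta>" for \<eta>
    proof -
      have max': "\<forall>\<^sub>F y in nhds x0. 1 * ?v y - 1 * \<phi> y \<le> 1 * ?v x0 - 1 * \<phi> x0" using max by simp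
      obtain x r \<Delta> where r: "filterlim r at_top sequentially" and x: "x \<longlonglongrightarrow> x0"
        and lim: "\<forall>k. (\<lambda>i. \<Delta> k i / (1 / real (r i))) \<longlonglongrightarrow> hjb_gen \<sigma> a b D D2 k x0 + 1 * \<eta> * \<sigma>\<^sup>2"
        and le: "\<forall>\<^sub>F i in sequentially. \<forall>k. 1 * (hjb_avg \<sigma> a b k (1 / real (r i)) (?F (r i)) (x i) - ?F (r i) (x i))
          \<le> 1 * \<Delta> k i + (1 / real (r i))\<^sup>2"
        by (rule hjb_touching[OF oU x0 D D2 pos[OF x0] conv mult_1 max' \<eta>, where \<sigma>=\<sigma> and a=a])
      have "(\<lambda>i. (MAX k\<in>UNIV. \<mu> k (x i) + \<Delta> k i / (1 / real (r i))) + 1 / real (r i))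
        \<longlonglongrightarrow> (MAX k\<in>UNIV. \<mu> k x0 + (hjb_gen \<sigma> a b D D2 k x0 + 1 * \<eta> * \<sigma>\<^sup>2)) + 0"
        by (intro tendsto_add tendsto_max_arm \<mu> x x0 lim[rule_format] filterlim_compose[OF lim_1_over_n r])
      moreover have "\<forall>\<^sub>F i in sequentially. 0 \<le> (MAX k\<in>UNIV. \<mu> k (x i) + \<Delta> k i / (1 / real (r i))) + 1 / real (r i)"
        using le step[OF x x0 r]
      proof eventually_elim
        case (elim i)
        let ?h = "1 / real (r i)"
        define B where "B k = ?h * \<mu> k (x i) + hjb_avg \<sigma> a b k ?h (?F (r i)) (x i)" for k
        obtain k where "(MAX k\<in>UNIV. B k) = B k" by (rule max_arm_attained)
        then have "?F (r i) (x i) = B k" using elim(2) unfolding B_def by simp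
        then have "0 \<le> ?h * \<mu> k (x i) + \<Delta> k i + ?h\<^sup>2"
          using elim(1)[rule_format, of k] unfolding B_def by simp
        moreover have "0 < c \<Longrightarrow> 0 \<le> c * y + d + c\<^sup>2 \<Longrightarrow> 0 \<le> (y + d / c) + c" for c y d :: real
          by (simp add: field_simps power2_eq_square)
        ultimately have "0 \<le> (\<mu> k (x i) + \<Delta> k i / ?h) + ?h" using elim(2) by blast
        also have "\<dots> \<le> (MAX k\<in>UNIV. \<mu> k (x i) + \<Delta> k i / ?h) + ?h" by (intro add_right_mono max_arm_ge)
        finally show ?case .
      qed
      ultimately have "0 \<le> (MAX k\<in>UNIV. \<mu> k x0 + (hjb_gen \<sigma> a b D D2 k x0 + 1 * \<eta> * \<sigma>\<^sup>2)) + 0"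
        by (intro tendsto_lowerbound) auto
      moreover have "(MAX k\<in>UNIV. \<mu> k x0 + (hjb_gen \<sigma> a b D D2 k x0 + 1 * \<eta> * \<sigma>\<^sup>2)) \<le> A k + \<eta> * \<sigma>\<^sup>2"
      proof (rule max_arm_le)
        fix i
        have "A i \<le> A k" using max_arm_ge[of A i] unfolding k .
        then show "\<mu> i x0 + (hjb_gen \<sigma> a b D D2 i x0 + 1 * \<eta> * \<sigma>\<^sup>2) \<le> A k + \<eta> * \<sigma>\<^sup>2"
          unfolding A_def by simp
      qed
      ultimately show ?thesis by linarith
    qed
    then have A: "0 \<le> A k" using le_0_if_le_scaled[of "- A k" \<sigma>] by simp
    define C where "C k = A k - blinfun_apply (D x0) (1, 0, 0)" for k
    \<comment> \<open>A real supremum dominates its members only when they are bounded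
      above.\<close>
    have "bdd_above ((\<lambda>\<pi>. \<Sum>k\<in>UNIV. C k * \<pi> $ k) ` prob_simplex)"
    proof (rule bdd_aboveI2)
      fix \<pi> :: "real^'k" assume \<pi>: "\<pi> \<in> prob_simplex"
      show "(\<Sum>k\<in>UNIV. C k * \<pi> $ k) \<le> (\<Sum>k\<in>UNIV. \<bar>C k\<bar>)"
      proof (rule sum_mono)
        fix k
        have "0 \<le> \<pi> $ k" "\<pi> $ k \<le> 1" using \<pi> by (auto simp: prob_simplex_def)
        then have "C k * \<pi> $ k \<le> \<bar>C k\<bar> * \<pi> $ k" "\<bar>C k\<bar> * \<pi> $ k \<le> \<bar>C k\<bar> * 1"
          by (intro mult_right_mono mult_left_mono; simp)+
        then show "C k * \<pi> $ k \<le> \<bar>C k\<bar>" by simp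
      qed
    qed
    then have "(\<Sum>i\<in>UNIV. C i * axis k 1 $ i) \<le> (SUP \<pi>\<in>prob_simplex. \<Sum>k\<in>UNIV. C k * \<pi> $ k)"
      by (rule cSUP_upper[OF axis_in_prob_simplex])
    moreover have "(\<Sum>i\<in>UNIV. C i * axis k 1 $ i) = C k"
      by (simp add: axis_def if_distrib cong: if_cong)
    moreover have "hjb_lhs \<sigma> a b \<phi> x0 = blinfun_apply (D x0) (1, 0, 0) + (SUP \<pi>\<in>prob_simplex. \<Sum>k\<in>UNIV. C k * \<pi> $ k)"
      unfolding C_def A_def by (rule lhs[OF D x0])
    ultimately show "0 \<le> hjb_lhs \<sigma> a b \<phi> x0" using A C_def[of k] by linarith
  qed
  have super: "viscosity_supersolution (hjb_lhs \<sigma> a b) U ?v"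
    unfolding viscosity_supersolution_def
  proof (intro allI impI, elim conjE)
    fix \<phi> :: "real \<times> (real^'k) \<times> (real^'k) \<Rightarrow> real" and x0
    assume C2: "C2_on U \<phi>" and x0: "x0 \<in> U" and min: "\<forall>\<^sub>F y in nhds x0. ?v y - \<phi> y \<ge> ?v x0 - \<phi> x0"
    obtain D D2 where D_all: "\<forall>z\<in>U. (\<phi> has_derivative blinfun_apply (D z)) (at z)" "\<forall>z\<in>U. (D has_derivative blinfun_apply (D2 z)) (at z)"
      and D2: "continuous_on U D2"
      by (rule C2_onE[OF C2])
    note D = D_all[rule_format]
    define A where "A k = hjb_gen \<sigma> a b D D2 k x0 + \<mu> k x0" for k
    \<comment> \<open>The scheme dominates each arm, so every arm can be followed separately to the
      limit.\<close>
    have "A k \<le> \<eta> * \<sigma>\<^sup>2" if \<eta>: "0 < \<eta>" for \<eta> k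
    proof -
      have min': "\<forall>\<^sub>F y in nhds x0. (-1) * ?v y - (-1) * \<phi> y \<le> (-1) * ?v x0 - (-1) * \<phi> x0"
        using min by eventually_elim simp
      have sgn: "(-1) * (-1) = (1::real)" by simp
      obtain x r \<Delta> where r: "filterlim r at_top sequentially" and x: "x \<longlonglongrightarrow> x0"
        and lim: "\<forall>k. (\<lambda>i. \<Delta> k i / (1 / real (r i))) \<longlonglongrightarrow> hjb_gen \<sigma> a b D D2 k x0 + (-1) * \<eta> * \<sigma>\<^sup>2"
        and le: "\<forall>\<^sub>F i in sequentially. \<forall>k. (-1) * (hjb_avg \<sigma> a b k (1 / real (r i)) (?F (r i)) (x i) - ?F (r i) (x i))
          \<le> (-1) * \<Delta> k i + (1 / real (r i))\<^sup>2"
        by (rule hjb_touching[OF oU x0 D D2 pos[OF x0] conv sgn min' \<eta>, where \<sigma>=\<sigma> and a=a])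
      have "(\<lambda>i. \<mu> k (x i) + \<Delta> k i / (1 / real (r i)) - 1 / real (r i))
        \<longlonglongrightarrow> \<mu> k x0 + (hjb_gen \<sigma> a b D D2 k x0 + (-1) * \<eta> * \<sigma>\<^sup>2) - 0"
        by (intro tendsto_add tendsto_diff \<mu> x x0 lim[rule_format] filterlim_compose[OF lim_1_over_n r])
      moreover have "\<forall>\<^sub>F i in sequentially. \<mu> k (x i) + \<Delta> k i / (1 / real (r i)) - 1 / real (r i) \<le> 0"
        using le step[OF x x0 r]
      proof eventually_elim
        case (elim i)
        let ?h = "1 / real (r i)"
        have "?h * \<mu> k (x i) + hjb_avg \<sigma> a b k ?h (?F (r i)) (x i) \<le> ?F (r i) (x i)"
          unfolding elim(2)[THEN conjunct2] by (rule max_arm_ge)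
        then have "?h * \<mu> k (x i) + \<Delta> k i - ?h\<^sup>2 \<le> 0"
          using elim(1)[rule_format, of k] by simp
        moreover have "0 < c \<Longrightarrow> c * y + d - c\<^sup>2 \<le> 0 \<Longrightarrow> y + d / c - c \<le> 0" for c y d :: real
          by (simp add: field_simps power2_eq_square)
        ultimately show ?case using elim(2) by blast
      qed
      ultimately have "\<mu> k x0 + (hjb_gen \<sigma> a b D D2 k x0 + (-1) * \<eta> * \<sigma>\<^sup>2) - 0 \<le> 0"
        by (intro tendsto_upperbound) auto
      then show ?thesis unfolding A_def by simp
    qed
    then have A: "A k \<le> 0" for k using le_0_if_le_scaled[of "A k" \<sigma>] by simp
    define d where "d = blinfun_apply (D x0) (1, 0, 0)"
    have "(SUP \<pi>\<in>prob_simplex. \<Sum>k\<in>UNIV. (A k - d) * \<pi> $ k) \<le> - d"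
    proof (rule cSUP_least)
      show "(prob_simplex :: (real^'k) set) \<noteq> {}" using axis_in_prob_simplex by blast
      fix \<pi> :: "real^'k" assume \<pi>: "\<pi> \<in> prob_simplex"
      have "(\<Sum>k\<in>UNIV. (A k - d) * \<pi> $ k) \<le> (\<Sum>k\<in>UNIV. (- d) * \<pi> $ k)"
        using \<pi> A by (intro sum_mono mult_right_mono) (auto simp: prob_simplex_def)
      also have "\<dots> = (- d) * (\<Sum>k\<in>UNIV. \<pi> $ k)" by (rule sum_distrib_left[symmetric])
      also have "\<dots> = - d" using \<pi> by (simp add: prob_simplex_def)
      finally show "(\<Sum>k\<in>UNIV. (A k - d) * \<pi> $ k) \<le> - d" .
    qed
    moreover have "hjb_lhs \<sigma> a b \<phi> x0 = d + (SUP \<pi>\<in>prob_simplex. \<Sum>k\<in>UNIV. (A k - d) * \<pi> $ k)"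
      unfolding d_def A_def by (rule lhs[OF D x0])
    ultimately show "hjb_lhs \<sigma> a b \<phi> x0 \<le> 0" by simp
  qed
  have "continuous_on U ?v"
    by (rule continuous_convergence_continuous_on[OF oU conv])
  then show ?thesis using sub super unfolding viscosity_solution_def U_def by blast
qed

section \<open>Convergence of the rescaled Bayesian bandit\<close>

text \<open>The witness is \<open>hjb_value\<close>. The limits assumed for the prior are just what
  makes the rescaled posterior means and precisions converge, while \<sigma> and the limiting prior
  precisions are nonnegative as limits of positive sequences.\<close>

theorem lemma3:
  fixes \<gamma> f :: "nat \<Rightarrow> real"
    and \<alpha> \<beta> :: "nat \<Rightarrow> real^'k::finite"
    and \<alpha>_hat \<beta>_hat :: "real^'k"
    and \<sigma>_hat :: real
  assumes "\<And>n. n > 0 \<Longrightarrow> \<gamma> n > 0"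
    and "\<And>n k. n > 0 \<Longrightarrow> \<alpha> n $ k > 0"
    and "\<And>n k. n > 0 \<Longrightarrow> \<beta> n $ k > 0"
    and "\<And>n. n > 0 \<Longrightarrow> f n > 0"
    and "\<And>k. (\<lambda>n. \<gamma> n * (\<alpha> n $ k - \<beta> n $ k) / f n) \<longlonglongrightarrow> \<alpha>_hat $ k"
    and "\<And>k. (\<lambda>n. (\<alpha> n $ k + \<beta> n $ k) / real n) \<longlonglongrightarrow> \<beta>_hat $ k"
    and "(\<lambda>n. sqrt (real n) / f n * \<gamma> n) \<longlonglongrightarrow> \<sigma>_hat"
  shows "converges_to_hjb \<gamma> \<alpha> \<beta> f \<sigma>_hat \<alpha>_hat \<beta>_hat"
  unfolding converges_to_hjb_def
proof (intro exI[of _ "hjb_value \<sigma>_hat \<alpha>_hat \<beta>_hat"] conjI allI ballI impI)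
  have \<sigma>: "0 \<le> \<sigma>_hat"
  proof (rule LIMSEQ_le_const[OF assms(7)])
    have "0 \<le> sqrt (real n) / f n * \<gamma> n" if "1 \<le> n" for n using assms(1)[of n] assms(4)[of n] that by simp
    then show "\<exists>N. \<forall>n\<ge>N. 0 \<le> sqrt (real n) / f n * \<gamma> n" by blast
  qed
  have b: "0 \<le> \<beta>_hat $ k" for k
  proof (rule LIMSEQ_le_const[OF assms(6)])
    have "0 \<le> (\<alpha> n $ k + \<beta> n $ k) / real n" if "1 \<le> n" for n
      using assms(2)[of n k] assms(3)[of n k] that by simp
    then show "\<exists>N. \<forall>n\<ge>N. 0 \<le> (\<alpha> n $ k + \<beta> n $ k) / real n" by blast
  qed
  show "viscosity_solution (hjb_lhs \<sigma>_hat \<alpha>_hat \<beta>_hat) ({0<..<1} \<times> UNIV \<times> {q. \<forall>k. q $ k \<in> {0<..<1}}) (hjb_value \<sigma>_hat \<alpha>_hat \<beta>_hat)"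
    by (rule hjb_value_viscosity_solution[OF \<sigma> b])
  \<comment> \<open>At \<open>t = 1\<close> the horizon is 0, so no round is played.\<close>
  show "hjb_value \<sigma>_hat \<alpha>_hat \<beta>_hat (1, s, q) = 0" for s q
    by (simp add: hjb_value_def lim_value_def)
  fix t s q i sn qn
  assume t: "t \<in> {0..1}" and q: "q \<in> q_domain \<beta>_hat"
    and adm: "\<forall>n>0. i n \<in> {1..n + 1} \<and> admissible (\<gamma> n) (i n) (sn n) (qn n)"
    and ti: "(\<lambda>n. (real (i n) - 1) / real n) \<longlonglongrightarrow> t" and sn: "(\<lambda>n. sn n /\<^sub>R f n) \<longlonglongrightarrow> s"
    and qn: "(\<lambda>n. \<chi> k. real (qn n $ k) / real n) \<longlonglongrightarrow> q"
  have pos: "0 < \<beta>_hat $ k + q $ k" for k using q by (simp add: q_domain_def)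
  have ev: "\<forall>\<^sub>F n::nat in sequentially. 0 < n" by (rule eventually_gt_at_top)
  have sk: "(\<lambda>n. sn n $ k / f n) \<longlonglongrightarrow> s $ k" for k
    using tendsto_vec_nth[OF sn, of k] by (simp add: divide_inverse mult.commute)
  have qk: "(\<lambda>n. real (qn n $ k) / real n) \<longlonglongrightarrow> q $ k" for k
    using tendsto_vec_nth[OF qn, of k] by simp
  \<comment> \<open>The rounds from \<open>i n\<close> to \<open>n\<close> remain; the subtraction
    of naturals is exact because \<open>i n \<le> n + 1\<close>.\<close>
  have j: "(\<lambda>n. real (Suc n - i n) / real n) \<longlonglongrightarrow> 1 - t"
  proof (rule Lim_transform_eventually)
    show "(\<lambda>n. 1 - (real (i n) - 1) / real n) \<longlonglongrightarrow> 1 - t" by (intro tendsto_intros ti)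
    show "\<forall>\<^sub>F n in sequentially. 1 - (real (i n) - 1) / real n = real (Suc n - i n) / real n"
      using ev
    proof eventually_elim
      case (elim n)
      have "i n \<le> Suc n" using adm elim by auto
      then have "real (Suc n - i n) = real n - (real (i n) - 1)" by (simp add: of_nat_diff)
      then show ?case using elim by (simp add: diff_divide_distrib)
    qed
  qed
  have m: "(\<lambda>n. scaled_mean n (f n) (\<gamma> n) (\<alpha> n) (\<beta> n) (sn n) (qn n)) \<longlonglongrightarrow> post_mean \<alpha>_hat \<beta>_hat s q"
  proof (rule vec_tendstoI)
    fix k
    show "(\<lambda>n. scaled_mean n (f n) (\<gamma> n) (\<alpha> n) (\<beta> n) (sn n) (qn n) $ k) \<longlonglongrightarrow> post_mean \<alpha>_hat \<beta>_hat s q $ k"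
    proof (rule Lim_transform_eventually)
      \<comment> \<open>Dividing the numerator by \<open>f n\<close> and the denominator by
        \<open>n\<close> separates the two limits; the denominator stays away from 0 by the choice
        of \<open>q_domain\<close>.\<close>
      have "(\<lambda>n. (\<gamma> n * (\<alpha> n $ k - \<beta> n $ k) / f n + sn n $ k / f n) / ((\<alpha> n $ k + \<beta> n $ k) / real n + real (qn n $ k) / real n))
         \<longlonglongrightarrow> (\<alpha>_hat $ k + s $ k) / (\<beta>_hat $ k + q $ k)"
        by (intro tendsto_divide tendsto_add assms sk qk) (use pos[of k] in simp)
      then show "(\<lambda>n. (\<gamma> n * (\<alpha> n $ k - \<beta> n $ k) / f n + sn n $ k / f n) / ((\<alpha> n $ k + \<beta> n $ k) / real n + real (qn n $ k) / real n))
         \<longlonglongrightarrow> post_mean \<alpha>_hat \<beta>_hat s q $ k" by (simp add: post_mean_def)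
      show "\<forall>\<^sub>F n in sequentially. (\<gamma> n * (\<alpha> n $ k - \<beta> n $ k) / f n + sn n $ k / f n) / ((\<alpha> n $ k + \<beta> n $ k) / real n + real (qn n $ k) / real n)
         = scaled_mean n (f n) (\<gamma> n) (\<alpha> n) (\<beta> n) (sn n) (qn n) $ k"
        using ev
      proof eventually_elim
        case (elim n)
        have "X / f n / (Y / real n) = real n / f n * X / Y" for X Y using elim by simp
        then show ?case by (simp add: scaled_mean_def flip: add_divide_distrib)
      qed
    qed
  qed
  have p: "(\<lambda>n. scaled_precision n (\<alpha> n) (\<beta> n) (qn n)) \<longlonglongrightarrow> \<beta>_hat + q"
  proof (rule vec_tendstoI)
    fix k
    have "(\<lambda>n. (\<alpha> n $ k + \<beta> n $ k) / real n + real (qn n $ k) / real n) \<longlonglongrightarrow> \<beta>_hat $ k + q $ k"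
      by (intro tendsto_add assms qk)
    then show "(\<lambda>n. scaled_precision n (\<alpha> n) (\<beta> n) (qn n) $ k) \<longlonglongrightarrow> (\<beta>_hat + q) $ k"
      by (simp add: scaled_precision_def add_divide_distrib)
  qed
  have "(\<lambda>n. opt_reward (\<gamma> n) (\<alpha> n) (\<beta> n) n (i n) (sn n) (qn n) / f n)
      \<longlonglongrightarrow> lim_value \<sigma>_hat (1 - t) (post_mean \<alpha>_hat \<beta>_hat s q) (\<beta>_hat + q)"
    by (rule opt_reward_tendsto[OF assms(1-4) assms(7) _ _ j m p]) (use adm pos in auto)
  then show "(\<lambda>n. opt_reward (\<gamma> n) (\<alpha> n) (\<beta> n) n (i n) (sn n) (qn n) / f n)
      \<longlonglongrightarrow> hjb_value \<sigma>_hat \<alpha>_hat \<beta>_hat (t, s, q)"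
    by (simp add: hjb_value_def)
qed

end
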